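(* Let $X$ be a compact space. Let $P$ be a topological directed set which is separable metrizable but not compact, in which down sets are compact and every convergent sequence has an upper bound. Then the following are equivalent: (1) $X$ has a $P$-point finite almost subbase; (2) $X$ has a $P$-point additively Noetherian base; (3) $X$ has a $P$-point finite expandable network; (4) $X$ has a $P$-finite strong point network; (5) $X$ has a $P$-finite point network.
   Context: All spaces are Tychonoff (completely regular Hausdorff). $\mathbb N=\{1,2,\dots\}$. A directed set is a partially ordered set in which any two elements have an upper bound. A topological directed set is a directed set equipped with a topology. Down sets are the sets $\{q\in P:q\le p\}$, $p\in P$. `Every convergent sequence has an upper bound' means that for every convergent sequence in $P$ there is an element of $P$ above all its terms. $P$-ordering. A collection $\mathcal C$ is $P$-ordered as $\mathcal C=\bigcup_{p\in P}\mathcal C_p$ if $p\le p'$ implies $\mathcal C_p\subseteq\mathcal C_{p'}$. For a property $\mathcal Q$ of collections, $\mathcal C$ is $P$-$\mathcal Q$ if it can be $P$-ordered so that every $\mathcal C_p$ has $\mathcal Q$. For a collection $\mathcal C$ of subsets of $X$ and $x\in X$, $(\mathcal C)_x=\{C\in\mathcal C:x\in C\}$; for a collection $\mathcal C$ of pairs of subsets, $(\mathcal C)_x=\{(C_1,C_2)\in\mathcal C:x\in C_2\}$. $\mathcal C$ is point finite if every $(\mathcal C)_x$ is finite, and point additively Noetherian if every $(\mathcal C)_x$ is additively Noetherian. A family of sets is Noetherian if every subfamily well-ordered by $\subseteq$ is finite; it is additively Noetherian if the collection of all unions of its members is Noetherian. Almost subbase. A (co)zero set of $X$ is the (co)zero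 set of some continuous $f:X\to[0,1]$. A $U$-representation of $V\subseteq X$ is a sequence $U(V)=\{U_n(V):n\in\mathbb N\}$ with $V=\bigcup_n U_n(V)$, $U_n(V)\subseteq U_{n+1}(V)$, $U_{2n-1}(V)$ a zero set and $U_{2n}(V)$ a cozero set for all $n$. A family $\alpha$ of subsets of $X$ is an almost subbase if one can choose $U$-representations $U(V)$, $V\in\alpha$, such that $\alpha\cup\{X\setminus U_{2n-1}(V):V\in\alpha,n\in\mathbb N\}$ is a subbase of $X$. Expandable network. A collection $\mathcal N$ of pairs $(N,V)$ of subsets of $X$ with $N\subseteq V$ and $V$ open, such that whenever $x\in U$, $U$ open, there is $(N,V)\in\mathcal N$ with $x\in N\subseteq U$. Point networks (in the order sense). A $P$-finite point network (respectively strong point network) for $X$ is $\mathcal W=\{\mathcal W(x):x\in X\}$, where each $\mathcal W(x)=\bigcup_{p\in P}\mathcal W_p(x)$ is a collection of subsets of $X$ containing $x$, each $\mathcal W_p(x)$ is finite, $p\le p'$ implies $\mathcal W_p(x)\subseteq\mathcal W_{p'}(x)$, and whenever a point $x$ is in an open set $U$ there are an open $V$ with $x\in V\subseteq U$ and a $p\in P$ such that for every $y\in V$ there is $W\in\mathcal W_p(y)$ with $x\in W\subseteq U$ (respectively $x\in W\subseteq V$). *)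

theory Defs
  imports "HOL-Analysis.Analysis"
begin

text \<open>A partially ordered set is given by a carrier \<open>A\<close> and a relation \<open>r\<close>,
  where \<open>(p, q) \<in> r\<close> means \<open>p \<le> q\<close>.\<close>

definition directed_set :: "'p set \<Rightarrow> 'p rel \<Rightarrow> bool" where
  "directed_set A r \<longleftrightarrow>
     partial_order_on A r \<and> (\<forall>p\<in>A. \<forall>q\<in>A. \<exists>s\<in>A. (p, s) \<in> r \<and> (q, s) \<in> r)"

definition down_set :: "'p set \<Rightarrow> 'p rel \<Rightarrow> 'p \<Rightarrow> 'p set" where
  "down_set A r p = {q \<in> A. (q, p) \<in> r}"

text \<open>In the library, \<open>limitin\<close> only constrains the tail of a sequence, so membership
  of all terms in the space is required separately.\<close>

definition convergent_seqs_bounded :: "'p topology \<Rightarrow> 'p rel \<Rightarrow> bool" where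
  "convergent_seqs_bounded T r \<longleftrightarrow>
     (\<forall>s :: nat \<Rightarrow> 'p. range s \<subseteq> topspace T \<and> (\<exists>l. limitin T s l sequentially) \<longrightarrow>
        (\<exists>p\<in>topspace T. \<forall>n. (s n, p) \<in> r))"

definition ordered_as :: "'p set \<Rightarrow> 'p rel \<Rightarrow> 'c set \<Rightarrow> ('p \<Rightarrow> 'c set) \<Rightarrow> bool" where
  "ordered_as A r \<C> \<C>p \<longleftrightarrow>
     \<C> = (\<Union>p\<in>A. \<C>p p) \<and> (\<forall>p\<in>A. \<forall>p'\<in>A. (p, p') \<in> r \<longrightarrow> \<C>p p \<subseteq> \<C>p p')"

text \<open>The collection \<open>\<C>\<close> is \<open>P\<close>-\<open>Q\<close>, for a property \<open>Q\<close> of collections.\<close>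

definition ordered_prop :: "'p set \<Rightarrow> 'p rel \<Rightarrow> ('c set \<Rightarrow> bool) \<Rightarrow> 'c set \<Rightarrow> bool" where
  "ordered_prop A r Q \<C> \<longleftrightarrow> (\<exists>\<C>p. ordered_as A r \<C> \<C>p \<and> (\<forall>p\<in>A. Q (\<C>p p)))"

definition at_point :: "'a set set \<Rightarrow> 'a \<Rightarrow> 'a set set" where
  "at_point \<C> x = {C \<in> \<C>. x \<in> C}"

definition pairs_at_point :: "('a set \<times> 'a set) set \<Rightarrow> 'a \<Rightarrow> ('a set \<times> 'a set) set" where
  "pairs_at_point \<C> x = {(C1, C2) \<in> \<C>. x \<in> C2}"

definition point_finite :: "'a topology \<Rightarrow> 'a set set \<Rightarrow> bool" where
  "point_finite X \<C> \<longleftrightarrow> (\<forall>x\<in>topspace X. finite (at_point \<C> x))"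

definition pairs_point_finite :: "'a topology \<Rightarrow> ('a set \<times> 'a set) set \<Rightarrow> bool" where
  "pairs_point_finite X \<C> \<longleftrightarrow> (\<forall>x\<in>topspace X. finite (pairs_at_point \<C> x))"

definition noetherian :: "'a set set \<Rightarrow> bool" where
  "noetherian \<F> \<longleftrightarrow>
     (\<forall>\<S>. \<S> \<subseteq> \<F> \<and> well_order_on \<S> {(A, B) \<in> \<S> \<times> \<S>. A \<subseteq> B} \<longrightarrow> finite \<S>)"

definition additively_noetherian :: "'a set set \<Rightarrow> bool" where
  "additively_noetherian \<F> \<longleftrightarrow> noetherian {\<Union>\<S> | \<S>. \<S> \<subseteq> \<F>}"

definition point_additively_noetherian :: "'a topology \<Rightarrow> 'a set set \<Rightarrow> bool" where
  "point_additively_noetherian X \<C> \<longleftrightarrow>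
     (\<forall>x\<in>topspace X. additively_noetherian (at_point \<C> x))"

definition base_of :: "'a topology \<Rightarrow> 'a set set \<Rightarrow> bool" where
  "base_of X \<B> \<longleftrightarrow> openin X = arbitrary union_of (\<lambda>B. B \<in> \<B>)"

text \<open>The empty intersection is the whole space.\<close>

definition subbase_of :: "'a topology \<Rightarrow> 'a set set \<Rightarrow> bool" where
  "subbase_of X \<S> \<longleftrightarrow> \<S> \<subseteq> Pow (topspace X) \<and>
     openin X = arbitrary union_of (finite intersection_of (\<lambda>S. S \<in> \<S>) relative_to topspace X)"

definition zero_set :: "'a topology \<Rightarrow> 'a set \<Rightarrow> bool" where
  "zero_set X Z \<longleftrightarrow>
     (\<exists>f :: 'a \<Rightarrow> real. continuous_map X (top_of_set {0..1}) f \<and> Z = {x \<in> topspace X. f x = 0})"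

definition cozero_set :: "'a topology \<Rightarrow> 'a set \<Rightarrow> bool" where
  "cozero_set X C \<longleftrightarrow>
     (\<exists>f :: 'a \<Rightarrow> real. continuous_map X (top_of_set {0..1}) f \<and> C = {x \<in> topspace X. f x \<noteq> 0})"

text \<open>Sequences of sets are indexed from 1; the value at 0 is irrelevant.\<close>

definition U_representation :: "'a topology \<Rightarrow> 'a set \<Rightarrow> (nat \<Rightarrow> 'a set) \<Rightarrow> bool" where
  "U_representation X V U \<longleftrightarrow>
     V = (\<Union>n\<in>{1..}. U n) \<and>
     (\<forall>n\<ge>1. U n \<subseteq> U (n + 1)) \<and>
     (\<forall>n\<ge>1. zero_set X (U (2 * n - 1)) \<and> cozero_set X (U (2 * n)))"

definition almost_subbase :: "'a topology \<Rightarrow> 'a set set \<Rightarrow> bool" where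
  "almost_subbase X \<alpha> \<longleftrightarrow> \<alpha> \<subseteq> Pow (topspace X) \<and>
     (\<exists>U. (\<forall>V\<in>\<alpha>. U_representation X V (U V)) \<and>
          subbase_of X (\<alpha> \<union> {topspace X - U V (2 * n - 1) | V n. V \<in> \<alpha> \<and> n \<ge> 1}))"

definition expandable_network :: "'a topology \<Rightarrow> ('a set \<times> 'a set) set \<Rightarrow> bool" where
  "expandable_network X \<N> \<longleftrightarrow>
     (\<forall>(N, V)\<in>\<N>. N \<subseteq> V \<and> openin X V) \<and>
     (\<forall>x U. openin X U \<and> x \<in> U \<longrightarrow> (\<exists>(N, V)\<in>\<N>. x \<in> N \<and> N \<subseteq> U))"

definition has_point_finite_almost_subbase :: "'p set \<Rightarrow> 'p rel \<Rightarrow> 'a topology \<Rightarrow> bool" where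
  "has_point_finite_almost_subbase A r X \<longleftrightarrow>
     (\<exists>\<alpha>. almost_subbase X \<alpha> \<and> ordered_prop A r (point_finite X) \<alpha>)"

definition has_point_additively_noetherian_base :: "'p set \<Rightarrow> 'p rel \<Rightarrow> 'a topology \<Rightarrow> bool" where
  "has_point_additively_noetherian_base A r X \<longleftrightarrow>
     (\<exists>\<B>. base_of X \<B> \<and> ordered_prop A r (point_additively_noetherian X) \<B>)"

definition has_point_finite_expandable_network :: "'p set \<Rightarrow> 'p rel \<Rightarrow> 'a topology \<Rightarrow> bool" where
  "has_point_finite_expandable_network A r X \<longleftrightarrow>
     (\<exists>\<N>. expandable_network X \<N> \<and> ordered_prop A r (pairs_point_finite X) \<N>)"

definition point_family ::
  "'p set \<Rightarrow> 'p rel \<Rightarrow> 'a topology \<Rightarrow> ('a \<Rightarrow> 'a set set) \<Rightarrow> ('a \<Rightarrow> 'p \<Rightarrow> 'a set set) \<Rightarrow> bool" where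
  "point_family A r X W Wp \<longleftrightarrow>
     (\<forall>x\<in>topspace X.
        (\<forall>S\<in>W x. x \<in> S \<and> S \<subseteq> topspace X) \<and>
        ordered_as A r (W x) (Wp x) \<and>
        (\<forall>p\<in>A. finite (Wp x p)))"

definition has_finite_point_network :: "'p set \<Rightarrow> 'p rel \<Rightarrow> 'a topology \<Rightarrow> bool" where
  "has_finite_point_network A r X \<longleftrightarrow>
     (\<exists>W Wp. point_family A r X W Wp \<and>
        (\<forall>x U. openin X U \<and> x \<in> U \<longrightarrow>
           (\<exists>V. openin X V \<and> x \<in> V \<and> V \<subseteq> U \<and>
              (\<exists>p\<in>A. \<forall>y\<in>V. \<exists>S\<in>Wp y p. x \<in> S \<and> S \<subseteq> U))))"

definition has_finite_strong_point_network :: "'p set \<Rightarrow> 'p rel \<Rightarrow> 'a topology \<Rightarrow> bool" where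
  "has_finite_strong_point_network A r X \<longleftrightarrow>
     (\<exists>W Wp. point_family A r X W Wp \<and>
        (\<forall>x U. openin X U \<and> x \<in> U \<longrightarrow>
           (\<exists>V. openin X V \<and> x \<in> V \<and> V \<subseteq> U \<and>
              (\<exists>p\<in>A. \<forall>y\<in>V. \<exists>S\<in>Wp y p. x \<in> S \<and> S \<subseteq> V))))"

end

theory Submission
  imports Defs
begin

text \<open>The order \<open>P\<close> enters through two consequences of its topology. Because down sets are compact
and \<open>P\<close> is not, some sequence \<open>e\<close> in \<open>P\<close> has only finitely many terms below any given \<open>p\<close>; so
countably many extra parameters can always be absorbed into the levels. Because \<open>P\<close> is second
countable and convergent sequences are bounded, a set \<open>M\<close> of labels with finitely many elements
below each \<open>p\<close> meets some basic neighbourhood (a \<^emph>\<open>cell\<close>) of each \<open>q\<close> in a finite set; so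
finiteness at all levels can be read off from countably many cells. The locale \<open>level_set\<close> records
just this.

From an almost subbase the other properties follow directly. Finite intersections of subbase elements
are additively Noetherian at each point: the \<open>V\<close>'s are finite in number there, and the complements of
the closed sets \<open>U\<^sub>2\<^sub>n\<^sub>-\<^sub>1(V) \<subseteq> V\<close> are controlled by compactness, since at one level infinitely many of them,
for different \<open>V\<close>, have empty intersection. An expandable network is obtained by prescribing which \<open>V\<close>'s with
label in finitely many cells contain a point. A network pair \<open>(N, V)\<close> gives the sets \<open>N \<union> {y}\<close>,
\<open>y \<in> V\<close>, of a strong point network.

For the way back, a base as in (2) and a point network as in (5) both assign to \<open>x \<in> G\<close> (\<open>G\<close> open)
a neighbourhood \<open>V x G\<close> and a label \<open>\<pi> x G\<close>, such that no point lies, at one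
level, in infinitely many \<open>V (x i) (G i)\<close> with \<open>x i \<notin> G j\<close> for all \<open>j < i\<close>
(\<open>noetherian_assignment\<close>). Well-order the continuous functions \<open>h\<close> on \<open>X\<close>, and sort the pairs
\<open>x \<noteq> y\<close> by the first \<open>h\<close> with \<open>h x > 0 > h y\<close>. In a compact space each class is \<open>\<sigma>\<close>-compact, so it is
covered by countably many rectangles inside assigned neighbourhoods. The result is a family of functions
\<open>h\<^sub>s\<close> for which the rectangles \<open>{h\<^sub>s > 0} \<times> {h\<^sub>s < 0}\<close> cover \<open>X \<times> X\<close> off the diagonal and are point
finite at each level (\<open>assignment_imp_separating_family\<close>).

It remains to turn rectangles in the square into a \<open>T\<^sub>0\<close>-separating, levelwise point finite family of
cozero sets in \<open>X\<close> (\<open>distinguishing_family\<close>). A set \<open>G\<close> of indices generates a set \<open>gen G\<close> of indices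
and a closed subspace \<open>shadow G\<close> on which these indices separate points and which represents every
point of \<open>X\<close> up to their values. Induct on the cardinality of \<open>G\<close>: if \<open>G\<close> is uncountable, exhaust it by
initial segments. Two points that are first told apart at stage \<open>\<xi>\<close> have representatives of which
one, say \<open>u\<close>, is new. By compactness finitely many rectangles, indexed by \<open>F\<close>, separate \<open>u\<close> from the old shadow,
so \<open>u\<close> lies in the cozero set where all \<open>h\<^sub>s\<close>, \<open>s \<in> F\<close>, are positive. Intersecting these cozero sets with the
families of the smaller stages separates everything. Point finiteness survives because
a point belongs, at one level, to only finitely many of these cozero sets (\<open>finite_pieces\<close>).
Superlevel sets of the resulting functions form an almost subbase.\<close>

section \<open>Additively Noetherian families and escaping sequences\<close>

text \<open>Iterated pigeonhole. Whenever each earlier index \<open>j\<close> can choose, for every later \<open>i\<close>, one of finitely many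
reasons \<open>c \<in> E j\<close>, a subsequence exists along which the reason depends on the earlier index alone.
This single argument handles both finite intersections and products.\<close>
lemma thin_out:
  fixes E :: "nat \<Rightarrow> 'c set" and Q :: "nat \<Rightarrow> 'c \<Rightarrow> nat \<Rightarrow> bool"
  assumes fin: "\<And>j. finite (E j)" and ex: "\<And>j i. j < i \<Longrightarrow> \<exists>c\<in>E j. Q j c i"
  shows "\<exists>(k :: nat \<Rightarrow> nat) c. strict_mono k \<and> (\<forall>n. c n \<in> E (k n)) \<and> (\<forall>n m. n < m \<longrightarrow> Q (k n) (c n) (k m))"
proof -
  define least :: "nat set \<Rightarrow> nat" where "least = (\<lambda>S. LEAST i. i \<in> S)"
  have least_in: "least S \<in> S" if "infinite S" for S
    unfolding least_def using that by (metis LeastI_ex finite.emptyI ex_in_conv)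
  have step: "\<exists>S'. infinite S' \<and> (\<exists>c\<in>E (least S). S' \<subseteq> {i \<in> S. least S < i \<and> Q (least S) c i})"
    if S: "infinite S" for S
  proof -
    have inf: "infinite (S \<inter> {least S<..})"
    proof
      assume "finite (S \<inter> {least S<..})"
      moreover have "S \<subseteq> S \<inter> {least S<..} \<union> {..least S}" by auto
      ultimately show False using S finite_subset by auto
    qed
    have "S \<inter> {least S<..} \<subseteq> (\<Union>c\<in>E (least S). {i \<in> S. least S < i \<and> Q (least S) c i})"
      using ex by auto
    then have "\<exists>c\<in>E (least S). infinite {i \<in> S. least S < i \<and> Q (least S) c i}"
      using inf fin by (meson finite_UN_I finite_subset)
    then show ?thesis by blast
  qed
  have "\<exists>S. \<forall>n. infinite (S n) \<and>
      (\<exists>c\<in>E (least (S n)). S (Suc n) \<subseteq> {i \<in> S n. least (S n) < i \<and> Q (least (S n)) c i})"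
  proof (rule dependent_nat_choice)
    show "\<exists>S :: nat set. infinite S" using infinite_UNIV_nat by blast
  qed (rule step)
  then obtain S where S: "\<And>n. infinite (S n)"
    and ES: "\<And>n. \<exists>c\<in>E (least (S n)). S (Suc n) \<subseteq> {i \<in> S n. least (S n) < i \<and> Q (least (S n)) c i}"
    by blast
  from ES have "\<forall>n. \<exists>c. c \<in> E (least (S n)) \<and>
      S (Suc n) \<subseteq> {i \<in> S n. least (S n) < i \<and> Q (least (S n)) c i}" by blast
  from choice[OF this] obtain c where c: "\<And>n. c n \<in> E (least (S n))"
    and sub: "\<And>n. S (Suc n) \<subseteq> {i \<in> S n. least (S n) < i \<and> Q (least (S n)) (c n) i}"
    by blast
  have dec: "S m \<subseteq> S n" if "n \<le> m" for n m
    using that by (rule lift_Suc_antimono_le[rotated]) (use sub in blast)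
  have later: "least (S m) \<in> {i \<in> S n. least (S n) < i \<and> Q (least (S n)) (c n) i}" if "n < m" for n m
    using least_in[OF S, of m] dec[of "Suc n" m] sub[of n] that by auto
  have "strict_mono (\<lambda>n. least (S n))"
    by (rule strict_monoI) (use later in blast)
  then show ?thesis
  proof (intro exI conjI allI impI)
    show "c n \<in> E (least (S n))" for n by (rule c)
    show "Q (least (S n)) (c n) (least (S m))" if "n < m" for n m using later[OF that] by blast
  qed
qed

lemma well_order_on_least:
  assumes "well_order_on S r" "Z \<subseteq> S" "Z \<noteq> {}"
  shows "\<exists>a\<in>Z. \<forall>b\<in>Z. (a, b) \<in> r"
proof -
  have wf: "wf (r - Id)" and tot: "total_on S r" and refl: "refl_on S r"
    using assms(1) by (auto simp: order_on_defs)
  obtain x where "x \<in> Z" using assms(3) by blast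
  then obtain a where a: "a \<in> Z" "\<And>y. (y, a) \<in> r - Id \<Longrightarrow> y \<notin> Z"
    using wfE_min[OF wf] by metis
  have "(a, b) \<in> r" if "b \<in> Z" for b
  proof (cases "a = b")
    case True
    then show ?thesis using refl that assms(2) by (auto dest: refl_onD)
  next
    case False
    then have "(a, b) \<in> r \<or> (b, a) \<in> r"
      using tot a(1) that assms(2) by (auto simp: total_on_def)
    then show ?thesis using a(2)[of b] that False by auto
  qed
  then show ?thesis using a(1) by blast
qed

lemma well_order_on_increasing_sequence:
  assumes "well_order_on S r" "Z \<subseteq> S" "infinite Z"
  shows "\<exists>f::nat \<Rightarrow> 'a. (\<forall>n. f n \<in> Z) \<and> (\<forall>i j. i < j \<longrightarrow> (f i, f j) \<in> r \<and> f i \<noteq> f j)"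
proof -
  define least where "least = (\<lambda>Z'. SOME a. a \<in> Z' \<and> (\<forall>b\<in>Z'. (a, b) \<in> r))"
  have least: "least Z' \<in> Z'" "\<And>b. b \<in> Z' \<Longrightarrow> (least Z', b) \<in> r" if "infinite Z'" "Z' \<subseteq> Z" for Z'
  proof -
    have "\<exists>a. a \<in> Z' \<and> (\<forall>b\<in>Z'. (a, b) \<in> r)"
      using well_order_on_least[OF assms(1), of Z'] that assms(2) by fastforce
    from someI_ex[OF this] show "least Z' \<in> Z'" "\<And>b. b \<in> Z' \<Longrightarrow> (least Z', b) \<in> r"
      by (auto simp: least_def)
  qed
  define D where "D = rec_nat Z (\<lambda>_ Z'. Z' - {least Z'})"
  have D0: "D 0 = Z" and DS: "\<And>n. D (Suc n) = D n - {least (D n)}" by (auto simp: D_def)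
  have D: "infinite (D n) \<and> D n \<subseteq> Z" for n
    by (induction n) (auto simp: D0 DS assms(3))
  have dec: "D m \<subseteq> D n" if "n \<le> m" for n m
    using that by (rule lift_Suc_antimono_le[rotated]) (auto simp: DS)
  have "(least (D i), least (D j)) \<in> r \<and> least (D i) \<noteq> least (D j)" if "i < j" for i j
  proof -
    have "least (D j) \<in> D (Suc i)"
      using least(1)[of "D j"] D[of j] dec[of "Suc i" j] that by auto
    then show ?thesis using least(2)[of "D i" "least (D j)"] D[of i] by (auto simp: DS)
  qed
  moreover have "least (D n) \<in> Z" for n
    using least(1)[of "D n"] D[of n] by blast
  ultimately show ?thesis by (intro exI[of _ "\<lambda>n. least (D n)"]) blast
qed

text \<open>Sequences \<open>z i \<in> B i\<close> that are never covered by the earlier \<open>B j\<close> are the concrete obstruction to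
every union of members being a finite union.\<close>
definition escape_free :: "'a set set \<Rightarrow> bool" where
  "escape_free \<F> \<longleftrightarrow>
     \<not> (\<exists>(z :: nat \<Rightarrow> 'a) B. \<forall>i. B i \<in> \<F> \<and> z i \<in> B i \<and> (\<forall>j<i. z i \<notin> B j))"

lemma escape_freeI:
  assumes "\<And>(z :: nat \<Rightarrow> 'a) B. (\<And>i. B i \<in> \<F>) \<Longrightarrow> (\<And>i. z i \<in> B i) \<Longrightarrow>
    (\<And>i j. j < i \<Longrightarrow> z i \<notin> B j) \<Longrightarrow> False"
  shows "escape_free \<F>"
  using assms unfolding escape_free_def by metis

lemma escape_freeD:
  fixes z :: "nat \<Rightarrow> 'a"
  assumes "escape_free \<F>" "\<And>i. B i \<in> \<F>" "\<And>i. z i \<in> B i" "\<And>i j. j < i \<Longrightarrow> z i \<notin> B j"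
  shows False
  using assms unfolding escape_free_def by blast

lemma escape_free_subsequenceD:
  fixes z :: "nat \<Rightarrow> 'a"
  assumes "escape_free \<F>" "\<And>i. z i \<in> B i" "\<And>i j. j < i \<Longrightarrow> z i \<notin> B j"
  shows "finite {i. B i \<in> \<F>}"
proof (rule ccontr)
  assume inf: "infinite {i. B i \<in> \<F>}"
  let ?e = "enumerate {i. B i \<in> \<F>}"
  have e: "B (?e n) \<in> \<F>" for n using enumerate_in_set[OF inf] by blast
  have "?e j < ?e i" if "j < i" for i j using enumerate_mono[OF that inf] .
  then show False
    using escape_freeD[OF assms(1), of "B \<circ> ?e" "z \<circ> ?e"] e assms(2,3) by auto
qed

lemma escape_free_subset:
  "escape_free \<G> \<Longrightarrow> \<F> \<subseteq> \<G> \<Longrightarrow> escape_free \<F>"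
  unfolding escape_free_def by blast

lemma escape_free_finite:
  assumes "finite \<F>"
  shows "escape_free \<F>"
proof (rule escape_freeI)
  fix z :: "nat \<Rightarrow> 'a" and B
  assume B: "\<And>i. B i \<in> \<F>" "\<And>i. z i \<in> B i" "\<And>i j. j < i \<Longrightarrow> z i \<notin> B j"
  have "inj B"
    by (rule linorder_injI) (use B in metis)
  moreover have "finite (range B)" using B(1) assms by (auto intro: finite_subset)
  ultimately show False using finite_imageD infinite_UNIV_nat by blast
qed

lemma escape_free_Un:
  assumes "escape_free \<F>" "escape_free \<G>"
  shows "escape_free (\<F> \<union> \<G>)"
proof (rule escape_freeI)
  fix z :: "nat \<Rightarrow> 'a" and B
  assume B: "\<And>i. B i \<in> \<F> \<union> \<G>" "\<And>i. z i \<in> B i" "\<And>i j. j < i \<Longrightarrow> z i \<notin> B j"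
  have "finite ({i. B i \<in> \<F>} \<union> {i. B i \<in> \<G>})"
    using escape_free_subsequenceD[OF assms(1), of z B] escape_free_subsequenceD[OF assms(2), of z B] B
    by blast
  moreover have "{i. B i \<in> \<F>} \<union> {i. B i \<in> \<G>} = UNIV" using B(1) by auto
  ultimately show False by simp
qed

text \<open>If \<open>z i\<close> escapes an intersection, it escapes one of its finitely many members, and \<open>thin_out\<close>
makes that member independent of \<open>i\<close>; so an escaping sequence of intersections yields one of members.\<close>
lemma escape_free_finite_Inter:
  assumes "escape_free \<F>"
  shows "escape_free {Y \<inter> \<Inter>\<E> | \<E>. finite \<E> \<and> \<E> \<subseteq> \<F>}"
proof (rule escape_freeI)
  fix z :: "nat \<Rightarrow> 'a" and B
  assume B: "\<And>i. B i \<in> {Y \<inter> \<Inter>\<E> | \<E>. finite \<E> \<and> \<E> \<subseteq> \<F>}" "\<And>i. z i \<in> B i"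
    and esc: "\<And>i j. j < i \<Longrightarrow> z i \<notin> B j"
  from B(1) have "\<forall>i. \<exists>\<E>. B i = Y \<inter> \<Inter>\<E> \<and> finite \<E> \<and> \<E> \<subseteq> \<F>" by blast
  then obtain E where E: "\<And>i. B i = Y \<inter> \<Inter>(E i)" "\<And>i. finite (E i)" "\<And>i. E i \<subseteq> \<F>"
    by metis
  have zY: "z i \<in> Y" for i using B(2)[of i] E(1) by auto
  have "\<exists>c\<in>E j. z i \<notin> c" if "j < i" for j i
    using esc[OF that] E(1)[of j] zY by auto
  then obtain k :: "nat \<Rightarrow> nat" and c where k: "strict_mono k" "\<And>n. c n \<in> E (k n)"
    "\<And>n m. n < m \<Longrightarrow> z (k m) \<notin> c n"
    using thin_out[of E "\<lambda>j c i. z i \<notin> c"] E(2) by blast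
  have "z (k n) \<in> c n" for n
    using B(2)[of "k n"] E(1)[of "k n"] k(2)[of n] by auto
  moreover have "c n \<in> \<F>" for n using k(2) E(3) by blast
  ultimately show False
    using escape_freeD[OF assms, of c "z \<circ> k"] k(3) by simp
qed

text \<open>The partial unions of an escaping sequence increase strictly, and a strictly increasing sequence of
unions yields an escaping sequence by picking new points.\<close>
lemma additively_noetherian_iff_escape_free:
  "additively_noetherian \<F> \<longleftrightarrow> escape_free \<F>"
proof
  assume noe: "additively_noetherian \<F>"
  show "escape_free \<F>"
  proof (rule escape_freeI)
    fix z :: "nat \<Rightarrow> 'a" and B
    assume B: "\<And>i. B i \<in> \<F>" "\<And>i. z i \<in> B i" and esc: "\<And>i j. j < i \<Longrightarrow> z i \<notin> B j"
    define G where "G = (\<lambda>n. \<Union>(B ` {..n}))"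
    have G_le: "G a \<subseteq> G b \<longleftrightarrow> a \<le> b" for a b
    proof
      assume sub: "G a \<subseteq> G b"
      show "a \<le> b"
      proof (rule ccontr)
        assume "\<not> a \<le> b"
        then have "z a \<notin> G b" using esc[of _ a] by (auto simp: G_def)
        moreover have "z a \<in> G a" using B(2) by (auto simp: G_def)
        ultimately show False using sub by blast
      qed
    next
      show "a \<le> b \<Longrightarrow> G a \<subseteq> G b" by (force simp: G_def)
    qed
    have inj: "inj G"
      by (rule injI) (metis G_le order_antisym order_refl)
    let ?r = "{(A, B) \<in> range G \<times> range G. A \<subseteq> B}"
    have "wf (?r - Id)"
    proof (rule wf_subset[OF wf_inv_image[OF wf_less_than, of "inv G"]])
      show "?r - Id \<subseteq> inv_image less_than (inv G)"
        using G_le inj by (auto simp: inv_f_f)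
    qed
    then have "well_order_on (range G) ?r"
      using G_le
      by (auto simp: order_on_defs refl_on_def trans_def antisym_def total_on_def)
    moreover have "range G \<subseteq> {\<Union>\<S> | \<S>. \<S> \<subseteq> \<F>}"
      using B(1) by (auto simp: G_def)
    ultimately have "finite (range G)"
      using noe unfolding additively_noetherian_def noetherian_def by blast
    then show False using inj finite_imageD infinite_UNIV_nat by blast
  qed
next
  assume free: "escape_free \<F>"
  show "additively_noetherian \<F>"
    unfolding additively_noetherian_def noetherian_def
  proof (intro allI impI, rule ccontr)
    fix \<T> assume T: "\<T> \<subseteq> {\<Union>\<S> | \<S>. \<S> \<subseteq> \<F>} \<and> well_order_on \<T> {(A, B) \<in> \<T> \<times> \<T>. A \<subseteq> B}"
      and inf: "infinite \<T>"
    obtain f :: "nat \<Rightarrow> 'a set" where f: "\<And>n. f n \<in> \<T>"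
      and "\<forall>i j. i < j \<longrightarrow> (f i, f j) \<in> {(A, B) \<in> \<T> \<times> \<T>. A \<subseteq> B} \<and> f i \<noteq> f j"
      using well_order_on_increasing_sequence[OF conjunct2[OF T] subset_refl inf] by blast
    then have inc: "f i \<subset> f j" if "i < j" for i j using that by blast
    have "\<forall>n. \<exists>\<S>. f n = \<Union>\<S> \<and> \<S> \<subseteq> \<F>" using f T by blast
    then obtain S where S: "\<And>n. f n = \<Union>(S n)" "\<And>n. S n \<subseteq> \<F>" by metis
    have "\<forall>n. \<exists>z. z \<in> f (Suc n) \<and> z \<notin> f n" using inc by blast
    then obtain z where z: "\<And>n. z n \<in> f (Suc n)" "\<And>n. z n \<notin> f n" by metis
    have "\<forall>n. \<exists>b. b \<in> S (Suc n) \<and> z n \<in> b" using z(1) S(1) by blast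
    then obtain B where B: "\<And>n. B n \<in> S (Suc n)" "\<And>n. z n \<in> B n" by metis
    have "z i \<notin> B j" if "j < i" for i j
    proof -
      have "B j \<subseteq> f (Suc j)" using B(1) S(1) by blast
      also have "\<dots> \<subseteq> f i" using inc[of "Suc j" i] that by (cases "Suc j = i") auto
      finally show ?thesis using z(2) by blast
    qed
    then show False using escape_freeD[OF free, of B z] B S(2) by blast
  qed
qed

section \<open>Levels\<close>

text \<open>The properties of a directed set \<open>P\<close> on which the equivalences rest. The sets \<open>cell k\<close> stand for a
countable base of \<open>P\<close>.\<close>
locale level_set =
  fixes A :: "'p set" and r :: "'p rel" and e :: "nat \<Rightarrow> 'p" and cell :: "nat \<Rightarrow> 'p set"
  assumes directed: "directed_set A r"
    and e_in: "e n \<in> A"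
    and e_finite: "p \<in> A \<Longrightarrow> finite {n. (e n, p) \<in> r}"
    and cell_finite: "M \<subseteq> A \<Longrightarrow> (\<And>p. p \<in> A \<Longrightarrow> finite {m \<in> M. (m, p) \<in> r}) \<Longrightarrow> q \<in> A
      \<Longrightarrow> \<exists>k. q \<in> cell k \<and> finite (M \<inter> cell k)"
begin

lemma le_refl: "p \<in> A \<Longrightarrow> (p, p) \<in> r"
  using directed by (auto simp: directed_set_def order_on_defs dest: refl_onD)

lemma le_trans: "(p, q) \<in> r \<Longrightarrow> (q, s) \<in> r \<Longrightarrow> (p, s) \<in> r"
  using directed by (auto simp: directed_set_def order_on_defs dest: transD)

lemma upper_bound:
  assumes "finite Q" "Q \<subseteq> A"
  shows "\<exists>q\<in>A. \<forall>p\<in>Q. (p, q) \<in> r"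
  using assms
proof (induction Q)
  case empty
  then show ?case using e_in by blast
next
  case (insert a Q)
  then obtain q where q: "q \<in> A" "\<forall>p\<in>Q. (p, q) \<in> r" by blast
  obtain s where "s \<in> A" "(a, s) \<in> r" "(q, s) \<in> r"
    using directed insert.prems q(1) unfolding directed_set_def by blast
  then show ?case using q(2) le_trans by blast
qed

lemma ordered_asI_level:
  assumes "\<C> \<subseteq> (\<Union>p\<in>A. \<C>p p)" "\<And>p. p \<in> A \<Longrightarrow> \<C>p p \<subseteq> \<C>"
    "\<And>p q. p \<in> A \<Longrightarrow> q \<in> A \<Longrightarrow> (p, q) \<in> r \<Longrightarrow> \<C>p p \<subseteq> \<C>p q"
  shows "ordered_as A r \<C> \<C>p"
  using assms unfolding ordered_as_def by blast

text \<open>Finiteness at all levels means that the labels do not accumulate anywhere, hence that every label has a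
cell with finitely many indices. Since there are countably many cells, the index set is countable.\<close>
lemma countable_if_finite_levels:
  fixes \<iota> :: "'i \<Rightarrow> 'p"
  assumes "\<And>i. i \<in> I \<Longrightarrow> \<iota> i \<in> A" and fin: "\<And>p. p \<in> A \<Longrightarrow> finite {i \<in> I. (\<iota> i, p) \<in> r}"
  shows "q \<in> A \<Longrightarrow> \<exists>k. q \<in> cell k \<and> finite {i \<in> I. \<iota> i \<in> cell k}" and "countable I"
proof -
  have fib: "finite {i \<in> I. \<iota> i = m}" if "m \<in> A" for m
    by (rule finite_subset[OF _ fin[OF that]]) (use le_refl that in auto)
  have key: "\<exists>k. q \<in> cell k \<and> finite {i \<in> I. \<iota> i \<in> cell k}" if q: "q \<in> A" for q
  proof -
    have "finite {m \<in> \<iota> ` I. (m, p) \<in> r}" if "p \<in> A" for p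
      by (rule finite_subset[of _ "\<iota> ` {i \<in> I. (\<iota> i, p) \<in> r}"]) (use fin[OF that] in auto)
    then obtain k where k: "q \<in> cell k" "finite (\<iota> ` I \<inter> cell k)"
      using cell_finite[of "\<iota> ` I" q] assms(1) q by blast
    have "{i \<in> I. \<iota> i \<in> cell k} \<subseteq> (\<Union>m\<in>\<iota> ` I \<inter> cell k. {i \<in> I. \<iota> i = m})" by auto
    moreover have "finite (\<Union>m\<in>\<iota> ` I \<inter> cell k. {i \<in> I. \<iota> i = m})"
      using k(2) fib assms(1) by (intro finite_UN_I) auto
    ultimately show ?thesis using k(1) finite_subset by blast
  qed
  show "\<exists>k. q \<in> cell k \<and> finite {i \<in> I. \<iota> i \<in> cell k}" if "q \<in> A" using key that .
  have "I \<subseteq> (\<Union>k\<in>{k. finite {i \<in> I. \<iota> i \<in> cell k}}. {i \<in> I. \<iota> i \<in> cell k})"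
    using key assms(1) by blast
  moreover have "countable (\<Union>k\<in>{k. finite {i \<in> I. \<iota> i \<in> cell k}}. {i \<in> I. \<iota> i \<in> cell k})"
    by (intro countable_UN) (auto intro: countable_finite)
  ultimately show "countable I" using countable_subset by blast
qed

end

text \<open>A sequence without convergent subsequence meets each compact down set finitely often; this gives \<open>e\<close>.
As for the cells: if every ball around \<open>q\<close> contained infinitely many points of a set \<open>M\<close> of labels, distinct ones would converge to
\<open>q\<close> and have a common upper bound, which would lie above infinitely many points of \<open>M\<close>.\<close>
lemma level_set_exists:
  assumes dir: "directed_set (topspace T) r"
    and sep: "separable_space T" and met: "metrizable_space T" and ncp: "\<not> compact_space T"
    and down: "\<forall>p\<in>topspace T. compactin T (down_set (topspace T) r p)"
    and csb: "convergent_seqs_bounded T r"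
  shows "\<exists>e cell. level_set (topspace T) r e cell"
proof -
  obtain M d where Md: "Metric_space M d" and T: "T = Metric_space.mtopology M d"
    using met unfolding metrizable_space_def by blast
  interpret Metric_space M d by (rule Md)
  have top: "topspace T = M" by (simp add: T)
  have "\<not> (\<forall>\<sigma>::nat\<Rightarrow>'a. range \<sigma> \<subseteq> M \<longrightarrow>
      (\<exists>l f. l \<in> M \<and> strict_mono f \<and> limitin T (\<sigma> \<circ> f) l sequentially))"
    using ncp unfolding T compact_space_sequentially by (simp add: conj_assoc)
  then obtain e :: "nat \<Rightarrow> 'a" where e: "range e \<subseteq> M"
    and noconv: "\<And>l f. strict_mono f \<Longrightarrow> \<not> limitin T (e \<circ> f) l sequentially"
    by (metis limitin_topspace top)
  have e_fin: "finite {n. (e n, p) \<in> r}" if p: "p \<in> topspace T" for p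
  proof (rule ccontr)
    assume inf: "infinite {n. (e n, p) \<in> r}"
    let ?k = "enumerate {n. (e n, p) \<in> r}"
    have k: "strict_mono ?k" using inf by (rule strict_mono_enumerate)
    have rng: "range (e \<circ> ?k) \<subseteq> down_set (topspace T) r p"
      using enumerate_in_set[OF inf] e top unfolding down_set_def by auto
    have "compactin mtopology (down_set (topspace T) r p)" using down p T by auto
    then obtain l f where "strict_mono f" "limitin mtopology ((e \<circ> ?k) \<circ> f) l sequentially"
      using rng unfolding compactin_sequentially by meson
    then show False
      using noconv[of "?k \<circ> f" l] k T by (simp add: comp_assoc strict_mono_o)
  qed
  obtain C where C: "countable C" "C \<subseteq> M" "T closure_of C = M"
    using sep unfolding separable_space_def top by blast
  define \<B> where "\<B> = (\<lambda>(c, n). mball c (1 / real (Suc n))) ` (C \<times> (UNIV :: nat set))"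
  have cB: "countable \<B>" unfolding \<B>_def using C(1) by blast
  have local_fin: "\<exists>b\<in>\<B>. q \<in> b \<and> finite (Z \<inter> b)"
    if Z: "Z \<subseteq> M" and fin: "\<And>p. p \<in> M \<Longrightarrow> finite {m \<in> Z. (m, p) \<in> r}" and q: "q \<in> M" for Z q
  proof -
    have "\<exists>\<epsilon>>0. finite (Z \<inter> mball q \<epsilon>)"
    proof (rule ccontr)
      assume "\<not> ?thesis"
      then have inf: "infinite (Z \<inter> mball q \<epsilon>)" if "\<epsilon> > 0" for \<epsilon> using that by blast
      \<comment> \<open>A stage consists of the points chosen before and the current point, so that the points are distinct.\<close>
      have "\<exists>s :: nat \<Rightarrow> 'a set \<times> 'a. \<forall>n. (finite (fst (s n)) \<and> snd (s n) \<in> Z \<inter> mball q (1 / real (Suc n))) \<and>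
          (snd (s (Suc n)) \<notin> fst (s (Suc n)) \<and> insert (snd (s n)) (fst (s n)) \<subseteq> fst (s (Suc n)))"
      proof (rule dependent_nat_choice)
        have "infinite (Z \<inter> mball q (1 / real (Suc 0)))" by (rule inf) simp
        then show "\<exists>s :: 'a set \<times> 'a. finite (fst s) \<and> snd s \<in> Z \<inter> mball q (1 / real (Suc 0))"
          by (metis finite.emptyI fst_conv snd_conv ex_in_conv)
      next
        fix s :: "'a set \<times> 'a" and n assume s: "finite (fst s) \<and> snd s \<in> Z \<inter> mball q (1 / real (Suc n))"
        let ?F = "insert (snd s) (fst s)"
        have "infinite (Z \<inter> mball q (1 / real (Suc (Suc n))) - ?F)"
          using inf[of "1 / real (Suc (Suc n))"] s by (auto intro: Diff_infinite_finite)
        then obtain w where "w \<in> Z \<inter> mball q (1 / real (Suc (Suc n))) - ?F"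
          by (metis finite.emptyI ex_in_conv)
        then show "\<exists>s'. (finite (fst s') \<and> snd s' \<in> Z \<inter> mball q (1 / real (Suc (Suc n)))) \<and>
            (snd s' \<notin> fst s' \<and> insert (snd s) (fst s) \<subseteq> fst s')"
          using s by (intro exI[of _ "(?F, w)"]) auto
      qed
      then obtain s where sZ: "\<And>n. snd (s n) \<in> Z \<inter> mball q (1 / real (Suc n))"
        and sn: "\<And>n. snd (s (Suc n)) \<notin> fst (s (Suc n))"
          "\<And>n. insert (snd (s n)) (fst (s n)) \<subseteq> fst (s (Suc n))" by blast
      define u where "u = snd \<circ> s"
      have mono: "fst (s n) \<subseteq> fst (s m)" if "n \<le> m" for n m
        using that by (rule lift_Suc_mono_le[rotated]) (use sn(2) in blast)
      have "u i \<noteq> u j" if "i < j" for i j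
      proof -
        obtain j' where j': "j = Suc j'" using \<open>i < j\<close> by (metis less_imp_Suc_add)
        have "u i \<in> fst (s (Suc i))" using sn(2)[of i] by (auto simp: u_def)
        moreover have "fst (s (Suc i)) \<subseteq> fst (s j)" using mono that by simp
        ultimately show ?thesis using sn(1)[of j'] j' by (auto simp: u_def)
      qed
      then have inj: "inj u" by (rule linorder_injI)
      have uZ: "u n \<in> Z" and ud: "d (u n) q < 1 / real (Suc n)" for n
        using sZ[of n] by (auto simp: u_def commute)
      have "limitin T u q sequentially"
        unfolding T limit_metric_sequentially
      proof (intro conjI allI impI)
        fix \<epsilon> :: real assume "\<epsilon> > 0"
        then obtain N where N: "1 / real (Suc N) < \<epsilon>" using nat_approx_posE by blast
        have "d (u n) q < \<epsilon>" if "N \<le> n" for n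
        proof -
          have "1 / real (Suc n) \<le> 1 / real (Suc N)" using that by (simp add: frac_le)
          then show ?thesis using ud[of n] N by linarith
        qed
        then show "\<exists>N. \<forall>n\<ge>N. u n \<in> M \<and> d (u n) q < \<epsilon>" using uZ Z by blast
      qed (rule q)
      then obtain p where p: "p \<in> M" "\<And>n. (u n, p) \<in> r"
        using csb uZ Z top unfolding convergent_seqs_bounded_def by (metis image_subsetI subsetD)
      then have "range u \<subseteq> {m \<in> Z. (m, p) \<in> r}" using uZ by blast
      then have "finite (range u)" using fin[OF p(1)] finite_subset by blast
      then show False using inj finite_imageD infinite_UNIV_nat by blast
    qed
    then obtain \<epsilon> where \<epsilon>: "\<epsilon> > 0" "finite (Z \<inter> mball q \<epsilon>)" by blast
    obtain N where N: "1 / real (Suc N) < \<epsilon> / 2" using nat_approx_posE[of "\<epsilon>/2"] \<epsilon>(1) by auto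
    have "q \<in> T closure_of C" using C(3) q by simp
    moreover have "0 < 1 / real (Suc N)" by simp
    ultimately obtain c where c: "c \<in> C" "c \<in> mball q (1 / real (Suc N))"
      unfolding T metric_closure_of by blast
    have "mball c (1 / real (Suc N)) \<subseteq> mball q \<epsilon>"
    proof
      fix x assume x: "x \<in> mball c (1 / real (Suc N))"
      then have "d q x \<le> d q c + d c x" using c q by (intro triangle) auto
      then show "x \<in> mball q \<epsilon>" using x c N q by auto
    qed
    then have "finite (Z \<inter> mball c (1 / real (Suc N)))"
      using \<epsilon>(2) by (meson finite_subset Int_mono order_refl)
    moreover have "q \<in> mball c (1 / real (Suc N))" using c q by (auto simp: commute)
    moreover have "mball c (1 / real (Suc N)) \<in> \<B>" using c(1) unfolding \<B>_def by blast
    ultimately show ?thesis by blast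
  qed
  have "level_set (topspace T) r e (from_nat_into \<B>)"
  proof
    show "directed_set (topspace T) r" by (rule dir)
    show "e n \<in> topspace T" for n using e top by auto
    show "finite {n. (e n, p) \<in> r}" if "p \<in> topspace T" for p using e_fin that .
    fix Z q assume "Z \<subseteq> topspace T" "\<And>p. p \<in> topspace T \<Longrightarrow> finite {m \<in> Z. (m, p) \<in> r}"
      and "q \<in> topspace T"
    then obtain b where b: "b \<in> \<B>" "q \<in> b" "finite (Z \<inter> b)" using local_fin top by metis
    moreover obtain k where "b = from_nat_into \<B> k"
      using cB b(1) by (metis from_nat_into_surj)
    ultimately show "\<exists>k. q \<in> from_nat_into \<B> k \<and> finite (Z \<inter> from_nat_into \<B> k)" by blast
  qed
  then show ?thesis by blast
qed

section \<open>Consequences of an almost subbase\<close>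

lemma base_of_iff:
  "base_of X \<B> \<longleftrightarrow> (\<forall>U. openin X U \<longleftrightarrow> (\<forall>x\<in>U. \<exists>b\<in>\<B>. x \<in> b \<and> b \<subseteq> U))"
  unfolding base_of_def fun_eq_iff arbitrary_union_of_alt by (simp add: Bex_def)

lemma base_of_openin: "base_of X \<B> \<Longrightarrow> b \<in> \<B> \<Longrightarrow> openin X b"
  unfolding base_of_iff by auto

lemma base_of_neighbourhood:
  "base_of X \<B> \<Longrightarrow> openin X U \<Longrightarrow> x \<in> U \<Longrightarrow> \<exists>b\<in>\<B>. x \<in> b \<and> b \<subseteq> U"
  unfolding base_of_iff by simp

lemma subbase_of_iff:
  "subbase_of X \<S> \<longleftrightarrow> \<S> \<subseteq> Pow (topspace X) \<and>
     base_of X {topspace X \<inter> \<Inter>\<E> | \<E>. finite \<E> \<and> \<E> \<subseteq> \<S>}"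
proof -
  have "(finite intersection_of (\<lambda>S. S \<in> \<S>) relative_to topspace X) =
      (\<lambda>b. b \<in> {topspace X \<inter> \<Inter>\<E> | \<E>. finite \<E> \<and> \<E> \<subseteq> \<S>})"
    by (auto simp: fun_eq_iff relative_to_def intersection_of_def)
  then show ?thesis unfolding subbase_of_def base_of_def by simp
qed

lemma compactin_indexed_subcover:
  assumes "compactin X K" "\<And>i. i \<in> I \<Longrightarrow> openin X (U i)" "K \<subseteq> (\<Union>i\<in>I. U i)"
  shows "\<exists>F\<subseteq>I. finite F \<and> K \<subseteq> (\<Union>i\<in>F. U i)"
proof -
  obtain \<F> where "finite \<F>" "\<F> \<subseteq> U ` I" "K \<subseteq> \<Union>\<F>"
    using compactinD[OF assms(1), of "U ` I"] assms(2,3) by blast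
  then show ?thesis using finite_subset_image[of \<F> U I] by blast
qed

lemma closedin_zero_set: "zero_set X Z \<Longrightarrow> closedin X Z"
proof -
  assume "zero_set X Z"
  then obtain f :: "'a \<Rightarrow> real" where f: "continuous_map X (top_of_set {0..1}) f"
    and Z: "Z = {x \<in> topspace X. f x = 0}" unfolding zero_set_def by blast
  have "continuous_map X euclideanreal f" using f by (simp add: continuous_map_in_subtopology)
  then have "closedin X {x \<in> topspace X. f x \<in> {0}}"
    by (rule closedin_continuous_map_preimage) simp
  then show "closedin X Z" using Z by simp
qed

lemma U_representation_props:
  assumes "U_representation X V U"
  shows "n \<ge> 1 \<Longrightarrow> U n \<subseteq> V" "n \<ge> 1 \<Longrightarrow> n \<le> m \<Longrightarrow> U n \<subseteq> U m"
    "n \<ge> 1 \<Longrightarrow> closedin X (U (2 * n - 1))"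
proof -
  show "n \<ge> 1 \<Longrightarrow> U n \<subseteq> V" using assms unfolding U_representation_def by auto
  have grow: "1 \<le> k \<Longrightarrow> U k \<subseteq> U (Suc k)" for k
    using assms unfolding U_representation_def by auto
  show "U n \<subseteq> U m" if "n \<ge> 1" "n \<le> m"
    using that(2)
  proof (induction rule: dec_induct)
    case (step k)
    then show ?case using grow[of k] that(1) by auto
  qed simp
  show "n \<ge> 1 \<Longrightarrow> closedin X (U (2 * n - 1))"
    using assms closedin_zero_set unfolding U_representation_def by blast
qed

text \<open>Along an escaping sequence either one \<open>V\<close> occurs infinitely often, and then the indices \<open>n\<close> would have to stay
below a bound because the \<open>Z V n\<close> increase; or infinitely many \<open>V\<close> occur, and then no point
lies in all the closed sets, so by compactness finitely many of their complements already cover the space.\<close>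
lemma escape_free_complements:
  fixes Z :: "'a set \<Rightarrow> nat \<Rightarrow> 'a set"
  assumes X: "compact_space X" and \<beta>: "point_finite X \<beta>"
    and closed: "\<And>V n. V \<in> \<beta> \<Longrightarrow> closedin X (Z V n)"
    and sub: "\<And>V n. V \<in> \<beta> \<Longrightarrow> Z V n \<subseteq> V"
    and mono: "\<And>V n m. V \<in> \<beta> \<Longrightarrow> n \<le> m \<Longrightarrow> Z V n \<subseteq> Z V m"
  shows "escape_free {topspace X - Z V n | V n. V \<in> \<beta>}"
proof (rule escape_freeI)
  fix z :: "nat \<Rightarrow> 'a" and B
  assume B: "\<And>i. B i \<in> {topspace X - Z V n | V n. V \<in> \<beta>}" "\<And>i. z i \<in> B i"
    and esc: "\<And>i j. j < i \<Longrightarrow> z i \<notin> B j"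
  from B(1) have "\<forall>i. \<exists>V n. B i = topspace X - Z V n \<and> V \<in> \<beta>" by blast
  then obtain V n where Vn: "\<And>i. B i = topspace X - Z (V i) (n i)" "\<And>i. V i \<in> \<beta>"
    by metis
  show False
  proof (cases "finite (range V)")
    case True
    then obtain i0 where inf: "infinite {i. V i = V i0}"
      using pigeonhole_infinite[of "UNIV :: nat set" V] by auto
    let ?\<F> = "(\<lambda>k. topspace X - Z (V i0) k) ` {..n i0}"
    have "B i \<in> ?\<F>" if i: "V i = V i0" "i0 < i" for i
    proof -
      have "z i \<in> Z (V i0) (n i0)" using esc[OF i(2)] B(2)[of i] Vn(1) by auto
      moreover have "z i \<notin> Z (V i0) (n i)" using B(2)[of i] Vn(1) i(1) by auto
      moreover have "Z (V i0) (n i0) \<subseteq> Z (V i0) (n i)" if "n i0 \<le> n i"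
        by (rule mono) (use Vn(2) that in auto)
      ultimately show "B i \<in> ?\<F>" using Vn(1) i(1) by (cases "n i0 \<le> n i") auto
    qed
    then have "{i. V i = V i0} \<subseteq> {i. B i \<in> ?\<F>} \<union> {..i0}" by (auto simp: not_le)
    moreover have "finite {i. B i \<in> ?\<F>}"
      by (rule escape_free_subsequenceD[of _ z]) (use escape_free_finite B(2) esc in auto)
    ultimately have "finite {i. V i = V i0}" by (meson finite_UnI finite_atMost finite_subset)
    with inf show False ..
  next
    case False
    have "topspace X \<subseteq> (\<Union>i. B i)"
    proof
      fix x assume x: "x \<in> topspace X"
      show "x \<in> (\<Union>i. B i)"
      proof (rule ccontr)
        assume "x \<notin> (\<Union>i. B i)"
        then have "x \<in> V i" for i using Vn(1)[of i] sub[OF Vn(2)[of i]] x by auto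
        then have "range V \<subseteq> at_point \<beta> x" using Vn(2) by (auto simp: at_point_def)
        moreover have "finite (at_point \<beta> x)" using \<beta> x by (simp add: point_finite_def)
        ultimately show False using False finite_subset by metis
      qed
    qed
    moreover have "openin X (B i)" for i
      unfolding Vn(1)[of i] by (intro openin_diff openin_topspace closed Vn(2))
    ultimately obtain F where F: "finite F" "topspace X \<subseteq> (\<Union>i\<in>F. B i)"
      using compactin_indexed_subcover[of X "topspace X" UNIV B] X unfolding compact_space_def
      by auto
    obtain m where m: "\<And>i. i \<in> F \<Longrightarrow> i < m" using F(1) by (auto simp: finite_nat_set_iff_bounded)
    have "z m \<in> topspace X" using B(2)[of m] Vn(1) by auto
    then obtain i where "i \<in> F" "z m \<in> B i" using F(2) by auto
    then show False using esc[OF m] by blast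
  qed
qed

lemma almost_subbaseE:
  assumes "has_point_finite_almost_subbase A r X"
  obtains \<alpha> \<alpha>p U where "\<forall>V\<in>\<alpha>. U_representation X V (U V)"
    "subbase_of X (\<alpha> \<union> {topspace X - U V (2 * n - 1) | V n. V \<in> \<alpha> \<and> n \<ge> 1})"
    "ordered_as A r \<alpha> \<alpha>p" "\<forall>p\<in>A. point_finite X (\<alpha>p p)"
proof -
  obtain \<alpha> where \<alpha>: "almost_subbase X \<alpha>" "ordered_prop A r (point_finite X) \<alpha>"
    using assms unfolding has_point_finite_almost_subbase_def by blast
  obtain \<alpha>p where \<alpha>p: "ordered_as A r \<alpha> \<alpha>p" "\<forall>p\<in>A. point_finite X (\<alpha>p p)"
    using \<alpha>(2) unfolding ordered_prop_def by blast
  obtain U where U: "\<forall>V\<in>\<alpha>. U_representation X V (U V)"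
    "subbase_of X (\<alpha> \<union> {topspace X - U V (2 * n - 1) | V n. V \<in> \<alpha> \<and> n \<ge> 1})"
    using \<alpha>(1) unfolding almost_subbase_def by (elim conjE exE)
  show thesis by (rule that[OF U \<alpha>p])
qed

context level_set
begin

lemma finite_subset_of_level:
  assumes "finite \<E>" "\<E> \<subseteq> (\<Union>p\<in>A. C p)"
    and "\<And>p q. p \<in> A \<Longrightarrow> q \<in> A \<Longrightarrow> (p, q) \<in> r \<Longrightarrow> C p \<subseteq> C q"
  shows "\<exists>p\<in>A. \<E> \<subseteq> C p"
proof -
  have "\<forall>E\<in>\<E>. \<exists>p. p \<in> A \<and> E \<in> C p" using assms(2) by blast
  then obtain p where p: "\<And>E. E \<in> \<E> \<Longrightarrow> p E \<in> A" "\<And>E. E \<in> \<E> \<Longrightarrow> E \<in> C (p E)" by metis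
  obtain q where "q \<in> A" "\<forall>s\<in>p ` \<E>. (s, q) \<in> r"
    using upper_bound[of "p ` \<E>"] assms(1) p(1) by blast
  have "E \<in> C q" if "E \<in> \<E>" for E
    using assms(3)[OF p(1)[OF that] \<open>q \<in> A\<close>] \<open>\<forall>s\<in>p ` \<E>. (s, q) \<in> r\<close> p(2)[OF that] that by auto
  then show ?thesis using \<open>q \<in> A\<close> by blast
qed

text \<open>At a point, a basic set is cut out by some of the finitely many \<open>V\<close> containing the point
and by complements of closed sets; both kinds are escape free, hence so are their finite intersections.\<close>
lemma almost_subbase_imp_noetherian_base:
  assumes X: "compact_space X" and "has_point_finite_almost_subbase A r X"
  shows "has_point_additively_noetherian_base A r X"
proof -
  obtain \<alpha> \<alpha>p U where U: "\<forall>V\<in>\<alpha>. U_representation X V (U V)"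
    and sb: "subbase_of X (\<alpha> \<union> {topspace X - U V (2 * n - 1) | V n. V \<in> \<alpha> \<and> n \<ge> 1})"
    and ord: "ordered_as A r \<alpha> \<alpha>p" and pf: "\<forall>p\<in>A. point_finite X (\<alpha>p p)"
    by (rule almost_subbaseE[OF assms(2)])
  note U = bspec[OF U] and pf = bspec[OF pf]
  have \<alpha>: "\<alpha> = (\<Union>p\<in>A. \<alpha>p p)"
    and mono: "\<And>p q. p \<in> A \<Longrightarrow> q \<in> A \<Longrightarrow> (p, q) \<in> r \<Longrightarrow> \<alpha>p p \<subseteq> \<alpha>p q"
    using ord unfolding ordered_as_def by blast+
  define S where "S = (\<lambda>\<beta>. \<beta> \<union> {topspace X - U V (2 * n - 1) | V n. V \<in> \<beta> \<and> n \<ge> 1})"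
  define \<B> where "\<B> = (\<lambda>\<beta>. {topspace X \<inter> \<Inter>\<E> | \<E>. finite \<E> \<and> \<E> \<subseteq> S \<beta>})"
  have Smono: "S \<beta> \<subseteq> S \<gamma>" if "\<beta> \<subseteq> \<gamma>" for \<beta> \<gamma> using that unfolding S_def by blast
  have S\<alpha>: "S \<alpha> = (\<Union>p\<in>A. S (\<alpha>p p))" unfolding S_def \<alpha> by blast
  have "base_of X (\<B> \<alpha>)" using sb unfolding subbase_of_iff \<B>_def S_def by blast
  moreover have "ordered_as A r (\<B> \<alpha>) (\<lambda>p. \<B> (\<alpha>p p))"
  proof (rule ordered_asI_level)
    show "\<B> \<alpha> \<subseteq> (\<Union>p\<in>A. \<B> (\<alpha>p p))"
    proof
      fix b assume "b \<in> \<B> \<alpha>"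
      then obtain \<E> where \<E>: "b = topspace X \<inter> \<Inter>\<E>" "finite \<E>" "\<E> \<subseteq> (\<Union>p\<in>A. S (\<alpha>p p))"
        unfolding \<B>_def S\<alpha> by blast
      moreover have "\<exists>p\<in>A. \<E> \<subseteq> S (\<alpha>p p)"
        by (rule finite_subset_of_level[OF \<E>(2,3)]) (intro Smono mono)
      ultimately obtain p where "p \<in> A" "\<E> \<subseteq> S (\<alpha>p p)" by blast
      then show "b \<in> (\<Union>p\<in>A. \<B> (\<alpha>p p))" using \<E> unfolding \<B>_def by blast
    qed
    have \<B>mono: "\<B> \<beta> \<subseteq> \<B> \<gamma>" if "\<beta> \<subseteq> \<gamma>" for \<beta> \<gamma>
      using Smono[OF that] unfolding \<B>_def by blast
    show "\<B> (\<alpha>p p) \<subseteq> \<B> \<alpha>" if "p \<in> A" for p by (rule \<B>mono) (use that \<alpha> in blast)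
    show "\<B> (\<alpha>p p) \<subseteq> \<B> (\<alpha>p q)" if "p \<in> A" "q \<in> A" "(p, q) \<in> r" for p q
      by (rule \<B>mono) (rule mono[OF that])
  qed
  moreover have "point_additively_noetherian X (\<B> (\<alpha>p p))" if p: "p \<in> A" for p
    unfolding point_additively_noetherian_def additively_noetherian_iff_escape_free
  proof
    fix x assume x: "x \<in> topspace X"
    have rep: "U_representation X V (U V)" if "V \<in> \<alpha>p p" for V using U \<alpha> p that by blast
    have "escape_free {topspace X - U V (2 * n + 1) | V n. V \<in> \<alpha>p p}"
    proof (rule escape_free_complements[OF X pf[OF p]])
      fix V n m assume V: "V \<in> \<alpha>p p"
      show "closedin X (U V (2 * n + 1))"
        using U_representation_props(3)[OF rep[OF V], of "Suc n"] by simp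
      show "U V (2 * n + 1) \<subseteq> V" using U_representation_props(1)[OF rep[OF V]] by simp
      show "U V (2 * n + 1) \<subseteq> U V (2 * m + 1)" if "n \<le> m"
        using U_representation_props(2)[OF rep[OF V]] that by simp
    qed
    moreover have "{topspace X - U V (2 * n - 1) | V n. V \<in> \<alpha>p p \<and> n \<ge> 1}
        \<subseteq> {topspace X - U V (2 * n + 1) | V n. V \<in> \<alpha>p p}"
    proof clarify
      fix V and n :: nat assume V: "V \<in> \<alpha>p p" and n: "1 \<le> n"
      have "2 * n - 1 = 2 * (n - 1) + 1" using n by arith
      then have "topspace X - U V (2 * n - 1) = topspace X - U V (2 * (n - 1) + 1)"
        by (simp only:)
      then show "\<exists>V' n'. topspace X - U V (2 * n - 1) = topspace X - U V' (2 * n' + 1) \<and> V' \<in> \<alpha>p p"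
        using V by blast
    qed
    moreover have "escape_free (at_point (\<alpha>p p) x)"
      by (rule escape_free_finite) (use pf[OF p] x in \<open>auto simp: point_finite_def\<close>)
    ultimately have "escape_free (at_point (\<alpha>p p) x \<union>
        {topspace X - U V (2 * n - 1) | V n. V \<in> \<alpha>p p \<and> n \<ge> 1})"
      by (intro escape_free_Un) (auto elim: escape_free_subset)
    then have "escape_free (at_point (S (\<alpha>p p)) x)"
      by (rule escape_free_subset) (auto simp: S_def at_point_def)
    then have "escape_free {topspace X \<inter> \<Inter>\<E> | \<E>. finite \<E> \<and> \<E> \<subseteq> at_point (S (\<alpha>p p)) x}"
      by (rule escape_free_finite_Inter)
    then show "escape_free (at_point (\<B> (\<alpha>p p)) x)"
      by (rule escape_free_subset) (unfold \<B>_def at_point_def, blast)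
  qed
  ultimately show ?thesis
    unfolding has_point_additively_noetherian_base_def ordered_prop_def
    by (intro exI conjI ballI)
qed

text \<open>To decide membership in a basic set near \<open>x\<close> it is enough to know which \<open>V\<close> contain the point, among
those with label in finitely many cells chosen so that only a finite set \<open>F\<close> of them contain \<open>x\<close>, together with
finitely many conditions about sets in \<open>F\<close>. So the network sets are determined by \<open>F\<close>, a
finite set \<open>K\<close> of cells and a finite set \<open>Q\<close> of conditions, and \<open>\<Inter>F\<close> expands them.\<close>
lemma almost_subbase_imp_expandable_network:
  assumes "has_point_finite_almost_subbase A r X"
  shows "has_point_finite_expandable_network A r X"
proof -
  obtain \<alpha> \<alpha>p U where U: "\<forall>V\<in>\<alpha>. U_representation X V (U V)"
    and sb: "subbase_of X (\<alpha> \<union> {topspace X - U V (2 * n - 1) | V n. V \<in> \<alpha> \<and> n \<ge> 1})"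
    and ord: "ordered_as A r \<alpha> \<alpha>p" and pf: "\<forall>p\<in>A. point_finite X (\<alpha>p p)"
    by (rule almost_subbaseE[OF assms])
  note U = bspec[OF U] and pf = bspec[OF pf]
  have \<alpha>: "\<alpha> = (\<Union>p\<in>A. \<alpha>p p)"
    and mono: "\<And>p q. p \<in> A \<Longrightarrow> q \<in> A \<Longrightarrow> (p, q) \<in> r \<Longrightarrow> \<alpha>p p \<subseteq> \<alpha>p q"
    using ord unfolding ordered_as_def by blast+
  let ?S = "\<alpha> \<union> {topspace X - U V (2 * n - 1) | V n. V \<in> \<alpha> \<and> n \<ge> 1}"
  have base: "base_of X {topspace X \<inter> \<Inter>\<E> | \<E>. finite \<E> \<and> \<E> \<subseteq> ?S}"
    using sb unfolding subbase_of_iff by blast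
  have open_fin: "openin X (topspace X \<inter> \<Inter>F)" if "finite F" "F \<subseteq> \<alpha>" for F
    by (rule base_of_openin[OF base]) (use that in blast)
  have "\<forall>V\<in>\<alpha>. \<exists>p. p \<in> A \<and> V \<in> \<alpha>p p" unfolding \<alpha> by blast
  from bchoice[OF this] obtain \<iota> where \<iota>: "\<And>V. V \<in> \<alpha> \<Longrightarrow> \<iota> V \<in> A"
    "\<And>V. V \<in> \<alpha> \<Longrightarrow> V \<in> \<alpha>p (\<iota> V)" by auto
  define N where "N = (\<lambda>F K Q. {z \<in> topspace X. {V \<in> \<alpha>. (\<exists>k\<in>K. \<iota> V \<in> cell k) \<and> z \<in> V} = F \<and>
      (\<forall>(V, n)\<in>Q. z \<notin> U V (2 * n - 1))})"
  define \<phi> where "\<phi> = (\<lambda>p. {n. (e n, p) \<in> r})"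
  \<comment> \<open>The sequence \<open>e\<close> bounds the numerical parameters \<open>K\<close> and \<open>Q\<close> at each level, leaving finitely many choices once
\<open>F\<close> is fixed.\<close>
  define \<N>p where "\<N>p = (\<lambda>p. {(N F K Q, topspace X \<inter> \<Inter>F) | F K Q.
      finite F \<and> F \<subseteq> \<alpha>p p \<and> K \<subseteq> \<phi> p \<and> Q \<subseteq> F \<times> \<phi> p})"
  have \<phi>: "finite (\<phi> p)" if "p \<in> A" for p using e_finite[OF that] by (simp add: \<phi>_def)
  have \<phi>mono: "\<phi> p \<subseteq> \<phi> q" if "(p, q) \<in> r" for p q using that le_trans by (auto simp: \<phi>_def)
  have "ordered_as A r (\<Union>p\<in>A. \<N>p p) \<N>p"
  proof (rule ordered_asI_level)
    show "\<N>p p \<subseteq> \<N>p q" if "p \<in> A" "q \<in> A" "(p, q) \<in> r" for p q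
      using mono[OF that] \<phi>mono[OF that(3)] unfolding \<N>p_def by blast
  qed auto
  moreover have "pairs_point_finite X (\<N>p p)" if p: "p \<in> A" for p
    unfolding pairs_point_finite_def
  proof
    fix x assume x: "x \<in> topspace X"
    have fin: "finite (at_point (\<alpha>p p) x)" using pf[OF p] x by (auto simp: point_finite_def)
    let ?I = "Pow (at_point (\<alpha>p p) x) \<times> Pow (\<phi> p) \<times> Pow (at_point (\<alpha>p p) x \<times> \<phi> p)"
    have "pairs_at_point (\<N>p p) x \<subseteq> (\<lambda>(F, K, Q). (N F K Q, topspace X \<inter> \<Inter>F)) ` ?I"
    proof
      fix c assume "c \<in> pairs_at_point (\<N>p p) x"
      then obtain F K Q where c: "c = (N F K Q, topspace X \<inter> \<Inter>F)" "x \<in> topspace X \<inter> \<Inter>F"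
        and FKQ: "F \<subseteq> \<alpha>p p" "K \<subseteq> \<phi> p" "Q \<subseteq> F \<times> \<phi> p"
        by (auto simp: pairs_at_point_def \<N>p_def)
      have "F \<subseteq> at_point (\<alpha>p p) x" using c(2) FKQ(1) by (auto simp: at_point_def)
      then have "(F, K, Q) \<in> ?I" using FKQ by auto
      then show "c \<in> (\<lambda>(F, K, Q). (N F K Q, topspace X \<inter> \<Inter>F)) ` ?I"
        unfolding c(1) by (rule rev_image_eqI) simp
    qed
    then show "finite (pairs_at_point (\<N>p p) x)"
      by (rule finite_subset) (use fin \<phi>[OF p] in auto)
  qed
  moreover have "expandable_network X (\<Union>p\<in>A. \<N>p p)"
    unfolding expandable_network_def
  proof (intro conjI allI impI)
    show "\<forall>(M, V)\<in>\<Union>p\<in>A. \<N>p p. M \<subseteq> V \<and> openin X V"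
    proof clarify
      fix p M V assume p: "p \<in> A" and MV: "(M, V) \<in> \<N>p p"
      then obtain F K Q where F: "M = N F K Q" "V = topspace X \<inter> \<Inter>F" "finite F" "F \<subseteq> \<alpha>p p"
        unfolding \<N>p_def by auto
      then have "F \<subseteq> \<alpha>" using p \<alpha> by blast
      then show "M \<subseteq> V \<and> openin X V" using open_fin F by (auto simp: N_def)
    qed
    fix x G assume xG: "openin X G \<and> x \<in> G"
    obtain \<E> where \<E>: "finite \<E>" "\<E> \<subseteq> ?S" "x \<in> topspace X \<inter> \<Inter>\<E>" "topspace X \<inter> \<Inter>\<E> \<subseteq> G"
      using base_of_neighbourhood[OF base conjunct1[OF xG] conjunct2[OF xG]] by auto
    have "\<forall>E\<in>\<E>. \<exists>v n. v \<in> \<alpha> \<and> n \<ge> 1 \<and> (E = v \<or> E = topspace X - U v (2 * n - 1))"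
      using \<E>(2) by blast
    then obtain v n where v: "\<And>E. E \<in> \<E> \<Longrightarrow> v E \<in> \<alpha>" and n: "\<And>E. E \<in> \<E> \<Longrightarrow> n E \<ge> (1::nat)"
      and E: "\<And>E. E \<in> \<E> \<Longrightarrow> E = v E \<or> E = topspace X - U (v E) (2 * n E - 1)" by metis
    have cellx: "\<exists>k. q \<in> cell k \<and> finite {V \<in> at_point \<alpha> x. \<iota> V \<in> cell k}" if "q \<in> A" for q
    proof (rule countable_if_finite_levels(1)[OF _ _ that])
      show "\<iota> V \<in> A" if "V \<in> at_point \<alpha> x" for V using \<iota>(1) that by (simp add: at_point_def)
      show "finite {V \<in> at_point \<alpha> x. (\<iota> V, p) \<in> r}" if p: "p \<in> A" for p
      proof (rule finite_subset)
        show "finite (at_point (\<alpha>p p) x)"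
          using pf[OF p] \<E>(3) by (auto simp: point_finite_def)
        show "{V \<in> at_point \<alpha> x. (\<iota> V, p) \<in> r} \<subseteq> at_point (\<alpha>p p) x"
        proof
          fix V assume V: "V \<in> {V \<in> at_point \<alpha> x. (\<iota> V, p) \<in> r}"
          then have "V \<in> \<alpha>" "x \<in> V" by (auto simp: at_point_def)
          moreover have "\<alpha>p (\<iota> V) \<subseteq> \<alpha>p p" using V \<open>V \<in> \<alpha>\<close> by (intro mono \<iota> p) auto
          ultimately show "V \<in> at_point (\<alpha>p p) x" using \<iota>(2) by (auto simp: at_point_def)
        qed
      qed
    qed
    have "\<forall>E\<in>\<E>. \<exists>k. \<iota> (v E) \<in> cell k \<and> finite {V \<in> at_point \<alpha> x. \<iota> V \<in> cell k}"
      by (intro ballI cellx \<iota>(1) v)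
    then obtain k where k: "\<And>E. E \<in> \<E> \<Longrightarrow> \<iota> (v E) \<in> cell (k E)"
      "\<And>E. E \<in> \<E> \<Longrightarrow> finite {V \<in> at_point \<alpha> x. \<iota> V \<in> cell (k E)}" by metis
    define F where "F = {V \<in> \<alpha>. (\<exists>m\<in>k ` \<E>. \<iota> V \<in> cell m) \<and> x \<in> V}"
    define Q where "Q = {(v E, n E) | E. E \<in> \<E> \<and> v E \<in> F \<and> x \<notin> U (v E) (2 * n E - 1)}"
    have "F \<subseteq> (\<Union>E\<in>\<E>. {V \<in> at_point \<alpha> x. \<iota> V \<in> cell (k E)})" by (auto simp: F_def at_point_def)
    then have finF: "finite F" by (rule finite_subset) (use \<E>(1) k(2) in auto)
    have F\<alpha>: "F \<subseteq> \<alpha>" by (auto simp: F_def)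
    let ?P = "\<iota> ` F \<union> e ` k ` \<E> \<union> e ` n ` \<E>"
    obtain p where p: "p \<in> A" "\<forall>s\<in>?P. (s, p) \<in> r"
      using upper_bound[of ?P] finF \<E>(1) F\<alpha> \<iota>(1) e_in by blast
    have "F \<subseteq> \<alpha>p p"
    proof
      fix V assume V: "V \<in> F"
      then have "\<alpha>p (\<iota> V) \<subseteq> \<alpha>p p" using p F\<alpha> by (intro mono \<iota>) auto
      then show "V \<in> \<alpha>p p" using \<iota>(2) V F\<alpha> by blast
    qed
    moreover have "k ` \<E> \<subseteq> \<phi> p" "Q \<subseteq> F \<times> \<phi> p" using p(2) by (auto simp: \<phi>_def Q_def)
    ultimately have mem: "(N F (k ` \<E>) Q, topspace X \<inter> \<Inter>F) \<in> \<N>p p"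
      using finF unfolding \<N>p_def by blast
    have "x \<in> N F (k ` \<E>) Q" using \<E>(3) by (auto simp: N_def F_def Q_def)
    moreover have "N F (k ` \<E>) Q \<subseteq> G"
    proof
      fix z assume z: "z \<in> N F (k ` \<E>) Q"
      then have zF: "{V \<in> \<alpha>. (\<exists>m\<in>k ` \<E>. \<iota> V \<in> cell m) \<and> z \<in> V} = F"
        and zQ: "\<And>V m. (V, m) \<in> Q \<Longrightarrow> z \<notin> U V (2 * m - 1)" and zX: "z \<in> topspace X"
        by (auto simp: N_def)
      have vF: "v E \<in> F \<longleftrightarrow> z \<in> v E" if "E \<in> \<E>" for E
        unfolding zF[symmetric] using v[OF that] k(1)[OF that] that by auto
      have vx: "v E \<in> F \<longleftrightarrow> x \<in> v E" if "E \<in> \<E>" for E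
        unfolding F_def using v[OF that] k(1)[OF that] that by auto
      have "z \<in> E" if EE: "E \<in> \<E>" for E
      proof (cases "E = v E")
        case True
        then show ?thesis using vF[OF EE] vx[OF EE] \<E>(3) EE by auto
      next
        case False
        then have eq: "E = topspace X - U (v E) (2 * n E - 1)" using E[OF EE] by blast
        have "z \<notin> U (v E) (2 * n E - 1)"
        proof (cases "v E \<in> F")
          case True
          have "x \<in> E" using \<E>(3) EE by blast
          then have "x \<notin> U (v E) (2 * n E - 1)" by (subst (asm) eq) simp
          then have "(v E, n E) \<in> Q" using True EE unfolding Q_def by blast
          then show ?thesis by (rule zQ)
        next
          case False
          have "U (v E) (2 * n E - 1) \<subseteq> v E"
            using U_representation_props(1)[OF U[OF v[OF EE]]] n[OF EE] by simp
          then show ?thesis using False vF[OF EE] by blast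
        qed
        then show ?thesis using zX by (subst eq) simp
      qed
      then show "z \<in> G" using \<E>(4) zX by blast
    qed
    ultimately have "case (N F (k ` \<E>) Q, topspace X \<inter> \<Inter>F) of (M, V) \<Rightarrow> x \<in> M \<and> M \<subseteq> G"
      by simp
    then show "\<exists>(M, V)\<in>\<Union>p\<in>A. \<N>p p. x \<in> M \<and> M \<subseteq> G"
      by (rule bexI) (use mem p(1) in blast)
  qed
  ultimately show ?thesis
    unfolding has_point_finite_expandable_network_def ordered_prop_def
    by (intro exI conjI ballI)
qed

end

section \<open>Networks\<close>

text \<open>The sets \<open>N \<union> {y}\<close> with \<open>y \<in> V\<close> do it: around \<open>x \<in> N \<subseteq> U\<close> take the neighbourhood \<open>V \<inter> U\<close>.\<close>
lemma expandable_network_imp_strong_point_network: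
  assumes "has_point_finite_expandable_network A r X"
  shows "has_finite_strong_point_network A r X"
proof -
  obtain \<N> \<N>p where net: "expandable_network X \<N>" and ord: "ordered_as A r \<N> \<N>p"
    and pf: "\<And>p. p \<in> A \<Longrightarrow> pairs_point_finite X (\<N>p p)"
    using assms unfolding has_point_finite_expandable_network_def ordered_prop_def by auto
  have \<N>: "\<And>N V. (N, V) \<in> \<N> \<Longrightarrow> N \<subseteq> V \<and> openin X V"
    and netD: "\<And>x U. openin X U \<Longrightarrow> x \<in> U \<Longrightarrow> \<exists>(N, V)\<in>\<N>. x \<in> N \<and> N \<subseteq> U"
    using net unfolding expandable_network_def by (auto split: prod.splits)
  define Wp where "Wp = (\<lambda>y p. (\<lambda>(N, V). insert y N) ` pairs_at_point (\<N>p p) y)"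
  have "point_family A r X (\<lambda>y. \<Union>p\<in>A. Wp y p) Wp"
    unfolding point_family_def
  proof (intro ballI conjI)
    fix y assume y: "y \<in> topspace X"
    show "ordered_as A r (\<Union>p\<in>A. Wp y p) (Wp y)"
      unfolding ordered_as_def
    proof (intro conjI ballI impI)
      show "Wp y p \<subseteq> Wp y q" if "p \<in> A" "q \<in> A" "(p, q) \<in> r" for p q
        unfolding Wp_def
        by (rule image_mono) (use ord that in \<open>auto simp: ordered_as_def pairs_at_point_def\<close>)
    qed simp
    show "finite (Wp y p)" if "p \<in> A" for p
      using pf[OF that] y unfolding Wp_def pairs_point_finite_def by auto
    fix S assume "S \<in> (\<Union>p\<in>A. Wp y p)"
    then obtain p N V where "p \<in> A" "(N, V) \<in> \<N>p p" "S = insert y N"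
      by (auto simp: Wp_def pairs_at_point_def)
    moreover have "(N, V) \<in> \<N>" using calculation ord by (auto simp: ordered_as_def)
    ultimately show "y \<in> S" "S \<subseteq> topspace X"
      using \<N>[of N V] openin_subset[of X V] y by auto
  qed
  moreover have "\<exists>V. openin X V \<and> x \<in> V \<and> V \<subseteq> U \<and> (\<exists>p\<in>A. \<forall>y\<in>V. \<exists>S\<in>Wp y p. x \<in> S \<and> S \<subseteq> V)"
    if xU: "openin X U" "x \<in> U" for x U
  proof -
    obtain N V where NV: "(N, V) \<in> \<N>" "x \<in> N" "N \<subseteq> U" using netD[OF xU] by auto
    obtain p where p: "p \<in> A" "(N, V) \<in> \<N>p p" using NV(1) ord by (auto simp: ordered_as_def)
    have "insert y N \<in> Wp y p" if "y \<in> V \<inter> U" for y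
      using p(2) that by (auto simp: Wp_def pairs_at_point_def image_iff intro!: bexI[of _ "(N, V)"])
    moreover have "openin X (V \<inter> U)" "x \<in> V \<inter> U" "N \<subseteq> V \<inter> U"
      using \<N>[OF NV(1)] NV xU by auto
    moreover have "x \<in> insert y N \<and> insert y N \<subseteq> V \<inter> U" if "y \<in> V \<inter> U" for y
      using NV(2) that calculation(4) by blast
    ultimately have "\<forall>y\<in>V \<inter> U. \<exists>S\<in>Wp y p. x \<in> S \<and> S \<subseteq> V \<inter> U" by blast
    then show ?thesis using p(1) \<open>openin X (V \<inter> U)\<close> \<open>x \<in> V \<inter> U\<close> by blast
  qed
  ultimately show ?thesis unfolding has_finite_strong_point_network_def
    by (intro exI[of _ "\<lambda>y. \<Union>p\<in>A. Wp y p"] exI[of _ Wp] conjI allI impI) simp_all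
qed

lemma strong_point_network_imp_point_network:
  assumes "has_finite_strong_point_network A r X"
  shows "has_finite_point_network A r X"
  using assms unfolding has_finite_strong_point_network_def has_finite_point_network_def
  by (meson order_trans)

section \<open>Noetherian neighbourhood assignments\<close>

context level_set
begin

text \<open>The common content of a point additively Noetherian base and of a finite point network.\<close>
definition noetherian_assignment ::
  "'a topology \<Rightarrow> ('a \<Rightarrow> 'a set \<Rightarrow> 'a set) \<Rightarrow> ('a \<Rightarrow> 'a set \<Rightarrow> 'p) \<Rightarrow> bool" where
  "noetherian_assignment X V \<pi> \<longleftrightarrow>
     (\<forall>x G. openin X G \<and> x \<in> G \<longrightarrow>
        openin X (V x G) \<and> x \<in> V x G \<and> V x G \<subseteq> G \<and> \<pi> x G \<in> A) \<and>
     (\<forall>p\<in>A. \<forall>y. \<not> (\<exists>(x :: nat \<Rightarrow> 'a) G. \<forall>i. openin X (G i) \<and> x i \<in> G i \<and>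
        y \<in> V (x i) (G i) \<and> (\<pi> (x i) (G i), p) \<in> r \<and> (\<forall>j<i. x i \<notin> G j)))"

text \<open>Assign to \<open>x \<in> G\<close> a basic set between \<open>x\<close> and \<open>G\<close>; a forbidden sequence would escape in the basic
sets at \<open>y\<close>.\<close>
lemma noetherian_base_imp_assignment:
  assumes "has_point_additively_noetherian_base A r X"
  shows "\<exists>V \<pi>. noetherian_assignment X V \<pi>"
proof -
  obtain \<B> \<B>p where base: "base_of X \<B>" and ord: "ordered_as A r \<B> \<B>p"
    and noe: "\<forall>p\<in>A. point_additively_noetherian X (\<B>p p)"
    using assms unfolding has_point_additively_noetherian_base_def ordered_prop_def by auto
  have \<B>: "\<B> = (\<Union>p\<in>A. \<B>p p)"
    and mono: "\<And>p q. p \<in> A \<Longrightarrow> q \<in> A \<Longrightarrow> (p, q) \<in> r \<Longrightarrow> \<B>p p \<subseteq> \<B>p q"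
    using ord unfolding ordered_as_def by blast+
  have ex: "\<forall>c :: 'a \<times> 'a set. \<exists>d. openin X (snd c) \<and> fst c \<in> snd c \<longrightarrow>
      fst c \<in> fst d \<and> fst d \<subseteq> snd c \<and> snd d \<in> A \<and> fst d \<in> \<B>p (snd d)"
    (is "\<forall>c. \<exists>d. ?P c d")
  proof
    fix c :: "'a \<times> 'a set"
    show "\<exists>d. ?P c d"
    proof (cases "openin X (snd c) \<and> fst c \<in> snd c")
    case True
    then obtain b where b: "b \<in> \<B>" "fst c \<in> b" "b \<subseteq> snd c"
      using base_of_neighbourhood[OF base, of "snd c" "fst c"] by blast
    then obtain p where "p \<in> A" "b \<in> \<B>p p" using \<B> by blast
    then show ?thesis using b by (intro exI[of _ "(b, p)"]) simp
    qed auto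
  qed
  from choice[OF ex] obtain d where d0: "\<forall>c. ?P c (d c)" ..
  have d: "\<And>x G. openin X G \<Longrightarrow> x \<in> G \<Longrightarrow>
      x \<in> fst (d (x, G)) \<and> fst (d (x, G)) \<subseteq> G \<and> snd (d (x, G)) \<in> A \<and>
      fst (d (x, G)) \<in> \<B>p (snd (d (x, G)))"
    using d0 by auto
  have "noetherian_assignment X (\<lambda>x G. fst (d (x, G))) (\<lambda>x G. snd (d (x, G)))"
    unfolding noetherian_assignment_def
  proof (intro conjI allI impI ballI notI)
    fix x G assume "openin X G \<and> x \<in> G"
    then have xG: "openin X G" "x \<in> G" by auto
    show "x \<in> fst (d (x, G))" "fst (d (x, G)) \<subseteq> G" "snd (d (x, G)) \<in> A" using d[OF xG] by auto
    have "fst (d (x, G)) \<in> \<B>" using d[OF xG] \<B> by blast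
    then show "openin X (fst (d (x, G)))" by (rule base_of_openin[OF base])
  next
    fix p y assume p: "p \<in> A" and "\<exists>(x :: nat \<Rightarrow> 'a) G. \<forall>i. openin X (G i) \<and> x i \<in> G i \<and>
      y \<in> fst (d (x i, G i)) \<and> (snd (d (x i, G i)), p) \<in> r \<and> (\<forall>j<i. x i \<notin> G j)"
    then obtain x :: "nat \<Rightarrow> 'a" and G where G: "\<And>i. openin X (G i)" "\<And>i. x i \<in> G i"
      "\<And>i. y \<in> fst (d (x i, G i))" "\<And>i. (snd (d (x i, G i)), p) \<in> r"
      and esc: "\<And>i j. j < i \<Longrightarrow> x i \<notin> G j" by blast
    note d' = d[OF G(1,2)]
    have "fst (d (x i, G i)) \<in> \<B>p p" for i
      using d'[of i] mono[OF _ p G(4)[of i]] by auto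
    then have "fst (d (x i, G i)) \<in> at_point (\<B>p p) y" for i
      using G(3) by (simp add: at_point_def)
    moreover have "x i \<notin> fst (d (x j, G j))" if "j < i" for i j
      using esc[OF that] d'[of j] by auto
    moreover have "y \<in> topspace X" using G(1)[of 0] G(3)[of 0] d'[of 0] openin_subset by blast
    then have "escape_free (at_point (\<B>p p) y)"
      using noe p unfolding point_additively_noetherian_def additively_noetherian_iff_escape_free
      by simp
    ultimately show False
      using escape_freeD[of "at_point (\<B>p p) y" "\<lambda>i. fst (d (x i, G i))" x] d' by auto
  qed
  then show ?thesis by blast
qed

text \<open>Assign to \<open>x \<in> G\<close> the neighbourhood provided by the network. A forbidden sequence would give sets
\<open>S i \<in> Wp y p\<close> with \<open>x i \<in> S i \<subseteq> G i\<close>, all distinct because \<open>x i \<notin> G j\<close>; but \<open>Wp y p\<close> is finite.\<close>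
lemma point_network_imp_assignment:
  assumes "has_finite_point_network A r X"
  shows "\<exists>V \<pi>. noetherian_assignment X V \<pi>"
proof -
  obtain W Wp where fam: "point_family A r X W Wp"
    and net: "\<And>x G. openin X G \<Longrightarrow> x \<in> G \<Longrightarrow> \<exists>V. openin X V \<and> x \<in> V \<and> V \<subseteq> G \<and>
      (\<exists>p\<in>A. \<forall>y\<in>V. \<exists>S\<in>Wp y p. x \<in> S \<and> S \<subseteq> G)"
    using assms unfolding has_finite_point_network_def by auto
  have mono: "Wp y p \<subseteq> Wp y q" if "y \<in> topspace X" "p \<in> A" "q \<in> A" "(p, q) \<in> r" for y p q
    using fam that unfolding point_family_def ordered_as_def by simp
  have fin: "finite (Wp y p)" if "y \<in> topspace X" "p \<in> A" for y p
    using fam that unfolding point_family_def by simp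
  have ex: "\<forall>c :: 'a \<times> 'a set. \<exists>d. openin X (snd c) \<and> fst c \<in> snd c \<longrightarrow>
      openin X (fst d) \<and> fst c \<in> fst d \<and> fst d \<subseteq> snd c \<and> snd d \<in> A \<and>
      (\<forall>y\<in>fst d. \<exists>S\<in>Wp y (snd d). fst c \<in> S \<and> S \<subseteq> snd c)"
    (is "\<forall>c. \<exists>d. ?P c d")
  proof
    fix c :: "'a \<times> 'a set"
    show "\<exists>d. ?P c d"
    proof (cases "openin X (snd c) \<and> fst c \<in> snd c")
    case True
    then obtain V p where "openin X V" "fst c \<in> V" "V \<subseteq> snd c" "p \<in> A"
      "\<forall>y\<in>V. \<exists>S\<in>Wp y p. fst c \<in> S \<and> S \<subseteq> snd c"
      using net[of "snd c" "fst c"] by auto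
    then show ?thesis by (intro exI[of _ "(V, p)"]) simp
    qed auto
  qed
  from choice[OF ex] obtain d where d0: "\<forall>c. ?P c (d c)" ..
  have d: "\<And>x G. openin X G \<Longrightarrow> x \<in> G \<Longrightarrow>
      openin X (fst (d (x, G))) \<and> x \<in> fst (d (x, G)) \<and> fst (d (x, G)) \<subseteq> G \<and> snd (d (x, G)) \<in> A \<and>
      (\<forall>y\<in>fst (d (x, G)). \<exists>S\<in>Wp y (snd (d (x, G))). x \<in> S \<and> S \<subseteq> G)"
    using d0 by auto
  have "noetherian_assignment X (\<lambda>x G. fst (d (x, G))) (\<lambda>x G. snd (d (x, G)))"
    unfolding noetherian_assignment_def
  proof (intro conjI allI impI ballI notI)
    fix x G assume "openin X G \<and> x \<in> G"
    then have xG: "openin X G" "x \<in> G" by auto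
    show "openin X (fst (d (x, G)))" "x \<in> fst (d (x, G))" "fst (d (x, G)) \<subseteq> G"
      "snd (d (x, G)) \<in> A" using d[OF xG] by auto
  next
    fix p y assume p: "p \<in> A" and "\<exists>(x :: nat \<Rightarrow> 'a) G. \<forall>i. openin X (G i) \<and> x i \<in> G i \<and>
      y \<in> fst (d (x i, G i)) \<and> (snd (d (x i, G i)), p) \<in> r \<and> (\<forall>j<i. x i \<notin> G j)"
    then obtain x :: "nat \<Rightarrow> 'a" and G where G: "\<And>i. openin X (G i)" "\<And>i. x i \<in> G i"
      "\<And>i. y \<in> fst (d (x i, G i))" "\<And>i. (snd (d (x i, G i)), p) \<in> r"
      and esc: "\<And>i j. j < i \<Longrightarrow> x i \<notin> G j" by blast
    note d' = d[OF G(1,2)]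
    have y: "y \<in> topspace X" using G(1)[of 0] G(3)[of 0] d'[of 0] openin_subset by blast
    have "\<exists>S. S \<in> Wp y p \<and> x i \<in> S \<and> S \<subseteq> G i" for i
    proof -
      obtain S where S: "S \<in> Wp y (snd (d (x i, G i)))" "x i \<in> S" "S \<subseteq> G i"
        using d'[of i] G(3)[of i] by blast
      have "Wp y (snd (d (x i, G i))) \<subseteq> Wp y p"
        using mono[OF y _ p G(4)[of i]] d'[of i] by simp
      then show ?thesis using S by blast
    qed
    then obtain S where S: "\<And>i. S i \<in> Wp y p" "\<And>i. x i \<in> S i" "\<And>i. S i \<subseteq> G i" by metis
    have "x i \<notin> S j" if "j < i" for i j using esc[OF that] S(3)[of j] by auto
    then show False
      using escape_freeD[OF escape_free_finite[OF fin[OF y p]], of S x] S(1,2) by auto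
  qed
  then show ?thesis by blast
qed

end

section \<open>Separating pairs of points by rectangles\<close>

context level_set
begin

text \<open>A cover of \<open>X \<times> X\<close> minus the diagonal by the cozero rectangles \<open>{h s > 0} \<times> {h s < 0}\<close>, point finite at
each level. Encoding a rectangle by one function makes its two sides disjoint automatically.\<close>
definition separating_family ::
  "'a topology \<Rightarrow> 'i set \<Rightarrow> ('i \<Rightarrow> 'a \<Rightarrow> real) \<Rightarrow> ('i \<Rightarrow> 'p) \<Rightarrow> bool" where
  "separating_family X I h \<iota> \<longleftrightarrow>
     (\<forall>s\<in>I. continuous_map X euclideanreal (h s) \<and> \<iota> s \<in> A) \<and>
     (\<forall>x\<in>topspace X. \<forall>y\<in>topspace X. x \<noteq> y \<longrightarrow> (\<exists>s\<in>I. h s x > 0 \<and> h s y < 0)) \<and>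
     (\<forall>p\<in>A. \<forall>x\<in>topspace X. \<forall>y\<in>topspace X.
        finite {s \<in> I. (\<iota> s, p) \<in> r \<and> h s x > 0 \<and> h s y < 0})"

end

lemma completely_regular_bump:
  assumes "completely_regular_space X" "openin X V" "x \<in> V"
  shows "\<exists>f. continuous_map X euclideanreal f \<and> (\<forall>z\<in>topspace X. 0 \<le> f z \<and> (f z > 0 \<longrightarrow> z \<in> V)) \<and>
    f x > 0"
proof -
  have "closedin X (topspace X - V)" "x \<in> topspace X - (topspace X - V)"
    using assms(2,3) openin_subset by auto
  then obtain f :: "'a \<Rightarrow> real" where f: "continuous_map X (top_of_set {0..1}) f" "f x = 0"
    "f ` (topspace X - V) \<subseteq> {1}"
    using assms(1) unfolding completely_regular_space_def by meson
  have cont: "continuous_map X euclideanreal f" and rng: "f \<in> topspace X \<rightarrow> {0..1}"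
    using f(1) by (auto simp: continuous_map_in_subtopology)
  have "continuous_map X euclideanreal (\<lambda>z. 1 - f z)"
    by (intro continuous_map_diff continuous_map_const[THEN iffD2] cont) auto
  moreover have "0 \<le> 1 - f z \<and> (1 - f z > 0 \<longrightarrow> z \<in> V)" if "z \<in> topspace X" for z
    using rng f(3) that by (auto simp: Pi_iff)
  ultimately show ?thesis using f(2) by (intro exI[of _ "\<lambda>z. 1 - f z"]) auto
qed

lemma openin_continuous_pos:
  "continuous_map X euclideanreal f \<Longrightarrow> openin X {z \<in> topspace X. f z > 0}"
  "continuous_map X euclideanreal f \<Longrightarrow> openin X {z \<in> topspace X. f z < 0}"
  using openin_continuous_map_preimage[of X euclideanreal f "{0<..}"]
    openin_continuous_map_preimage[of X euclideanreal f "{..<0}"] by auto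

context level_set
begin

text \<open>Each pair \<open>x \<noteq> y\<close> is sorted by the least function \<open>h\<close> that is positive at \<open>x\<close> and negative at
\<open>y\<close>. The pairs sorted to \<open>h\<close> for which \<open>h\<close> is in addition bounded away from \<open>0\<close> by \<open>1 / (n + 1)\<close> form a
compact set \<open>H h n\<close>, which finitely many rectangles cover. A point of the square in infinitely many rectangles of one level
would lie in rectangles for an increasing sequence of functions; a pair sorted to a
later function misses the earlier rectangle in one coordinate, and \<open>thin_out\<close> fixes that
coordinate, contradicting the property of the assignment.\<close>
lemma assignment_imp_separating_family:
  fixes X :: "'a topology"
  assumes comp: "compact_space X" and haus: "Hausdorff_space X" and creg: "completely_regular_space X"
    and asg: "noetherian_assignment X V \<pi>"
  shows "\<exists>(I :: (('a \<Rightarrow> real) \<times> nat \<times> 'a \<times> 'a) set) h \<iota>. separating_family X I h \<iota>"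
proof -
  have V: "openin X (V x G)" "x \<in> V x G" "V x G \<subseteq> G" "\<pi> x G \<in> A" if "openin X G" "x \<in> G" for x G
    using asg that unfolding noetherian_assignment_def by auto
  have no_bad: False if "p \<in> A" "\<And>i. openin X (G i)" "\<And>i. x i \<in> G i" "\<And>i. y \<in> V (x i) (G i)"
    "\<And>i. (\<pi> (x i) (G i), p) \<in> r" "\<And>i j. j < i \<Longrightarrow> x i \<notin> G j" for p y and x :: "nat \<Rightarrow> 'a" and G :: "nat \<Rightarrow> 'a set"
  proof -
    have "\<not> (\<exists>(x :: nat \<Rightarrow> 'a) G. \<forall>i. openin X (G i) \<and> x i \<in> G i \<and>
        y \<in> V (x i) (G i) \<and> (\<pi> (x i) (G i), p) \<in> r \<and> (\<forall>j<i. x i \<notin> G j))"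
      using asg that(1) unfolding noetherian_assignment_def by simp
    then show False using that(2-) by (elim notE) (intro exI[of _ x] exI[of _ G], simp)
  qed
  define \<Phi> where "\<Phi> = {h. continuous_map X euclideanreal h}"
  obtain w where w: "well_order_on \<Phi> w" using well_order_on by blast
  have anti: "antisym w" using w by (auto simp: order_on_defs)
  define P M where "P = (\<lambda>h :: 'a \<Rightarrow> real. {z \<in> topspace X. h z > 0})"
    and "M = (\<lambda>h :: 'a \<Rightarrow> real. {z \<in> topspace X. h z < 0})"
  have PM: "openin X (P h)" "openin X (M h)" if "h \<in> \<Phi>" for h
    using openin_continuous_pos that by (auto simp: P_def M_def \<Phi>_def)
  define C where "C = (\<lambda>h n. {x \<in> topspace X. h x \<ge> 1 / real (Suc n)} \<times>
      {y \<in> topspace X. h y \<le> - 1 / real (Suc n)})"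
  define H where "H = (\<lambda>h n. C h n - (\<Union>g\<in>{g \<in> \<Phi>. (h, g) \<notin> w}. P g \<times> M g))"
  let ?XX = "prod_topology X X"
  have Hsub: "H h n \<subseteq> P h \<times> M h" for h n
  proof
    fix c assume "c \<in> H h n"
    then have c: "fst c \<in> topspace X" "snd c \<in> topspace X"
      "1 / real (Suc n) \<le> h (fst c)" "h (snd c) \<le> - 1 / real (Suc n)"
      by (simp_all add: H_def C_def mem_Times_iff)
    have "0 < 1 / real (Suc n)" "- 1 / real (Suc n) < 0" by simp_all
    then have "h (fst c) > 0" "h (snd c) < 0" using c(3,4) by linarith+
    then show "c \<in> P h \<times> M h" using c(1,2) by (simp add: P_def M_def mem_Times_iff)
  qed
  have Hcomp: "compactin ?XX (H h n)" if "h \<in> \<Phi>" for h n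
  proof (rule closedin_compact_space)
    show "compact_space ?XX" using comp by (simp add: compact_space_prod_topology)
    have cont: "continuous_map X euclideanreal h" using that by (simp add: \<Phi>_def)
    have "closedin X {x \<in> topspace X. h x \<in> {1 / real (Suc n)..}}"
      "closedin X {x \<in> topspace X. h x \<in> {..- 1 / real (Suc n)}}"
      by (rule closedin_continuous_map_preimage[OF cont], simp)+
    then have "closedin ?XX (C h n)" unfolding C_def by (simp add: closedin_prod_Times_iff)
    moreover have "openin ?XX (\<Union>g\<in>{g \<in> \<Phi>. (h, g) \<notin> w}. P g \<times> M g)"
      by (rule openin_Union) (use PM in \<open>auto simp: openin_prod_Times_iff\<close>)
    ultimately show "closedin ?XX (H h n)" unfolding H_def by (rule closedin_diff)
  qed
  have Hcover: "\<exists>h\<in>\<Phi>. \<exists>n. (x, y) \<in> H h n"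
    if xy: "x \<in> topspace X" "y \<in> topspace X" "x \<noteq> y" for x y
  proof -
    have "openin X (topspace X - {y})"
      using haus xy(2) by (intro openin_diff openin_topspace closedin_Hausdorff_singleton) auto
    moreover have "x \<in> topspace X - {y}" using xy by auto
    ultimately obtain f where f: "continuous_map X euclideanreal f" "f x > 0"
      "\<forall>z\<in>topspace X. 0 \<le> f z \<and> (f z > 0 \<longrightarrow> z \<in> topspace X - {y})"
      using completely_regular_bump[OF creg] by blast
    then have fy: "f y = 0" using xy(2) by force
    let ?g = "\<lambda>z. f z - f x / 2"
    have "continuous_map X euclideanreal ?g"
      by (intro continuous_map_diff f(1)) auto
    then have "?g \<in> {h \<in> \<Phi>. (x, y) \<in> P h \<times> M h}"
      using f(2) fy xy by (auto simp: \<Phi>_def P_def M_def)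
    then obtain h where h: "h \<in> {h \<in> \<Phi>. (x, y) \<in> P h \<times> M h}"
      and least: "\<forall>g\<in>{h \<in> \<Phi>. (x, y) \<in> P h \<times> M h}. (h, g) \<in> w"
      using well_order_on_least[OF w, of "{h \<in> \<Phi>. (x, y) \<in> P h \<times> M h}"] by auto
    have hxy: "h x > 0" "h y < 0" using h by (auto simp: P_def M_def)
    obtain n where "1 / real (Suc n) < min (h x) (- h y)"
      using nat_approx_posE[of "min (h x) (- h y)"] hxy by auto
    then have "(x, y) \<in> C h n" using xy by (auto simp: C_def)
    then have "(x, y) \<in> H h n" using least by (auto simp: H_def)
    then show ?thesis using h by blast
  qed
  have "\<forall>c. \<exists>f. openin X (snd c) \<and> fst c \<in> snd c \<longrightarrow> continuous_map X euclideanreal f \<and>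
      (\<forall>z\<in>topspace X. 0 \<le> f z \<and> (f z > 0 \<longrightarrow> z \<in> snd c)) \<and> f (fst c) > 0"
    using completely_regular_bump[OF creg] by blast
  from choice[OF this] obtain b where b0: "\<forall>c. openin X (snd c) \<and> fst c \<in> snd c \<longrightarrow>
      continuous_map X euclideanreal (b c) \<and>
      (\<forall>z\<in>topspace X. 0 \<le> b c z \<and> (b c z > 0 \<longrightarrow> z \<in> snd c)) \<and> b c (fst c) > 0" by blast
  define bump where "bump = (\<lambda>x G. b (x, V x G))"
  have bump: "continuous_map X euclideanreal (bump x G)" "bump x G x > 0"
    "\<And>z. z \<in> topspace X \<Longrightarrow> 0 \<le> bump x G z"
    "\<And>z. z \<in> topspace X \<Longrightarrow> bump x G z > 0 \<Longrightarrow> z \<in> V x G"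
    if "openin X G" "x \<in> G" for x G
    using b0[rule_format, of "(x, V x G)"] V(1,2)[OF that] by (auto simp: bump_def)
  define nbh where "nbh = (\<lambda>h (x, y). {z \<in> topspace X. bump x (P h) z > 0} \<times>
      {z \<in> topspace X. bump y (M h) z > 0})"
  have "\<exists>F\<subseteq>H h n. finite F \<and> H h n \<subseteq> (\<Union>c\<in>F. nbh h c)" if h: "h \<in> \<Phi>" for h n
  proof (rule compactin_indexed_subcover[OF Hcomp[OF h]])
    show "openin ?XX (nbh h c)" if "c \<in> H h n" for c
    proof -
      have "fst c \<in> P h" "snd c \<in> M h" using that Hsub[of h n] by auto
      then have "openin X {z \<in> topspace X. bump (fst c) (P h) z > 0}"
        "openin X {z \<in> topspace X. bump (snd c) (M h) z > 0}"
        by (simp_all add: openin_continuous_pos(1) bump(1) PM[OF h])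
      then show ?thesis by (simp add: nbh_def openin_prod_Times_iff case_prod_unfold)
    qed
    show "H h n \<subseteq> (\<Union>c\<in>H h n. nbh h c)"
    proof
      fix c assume c: "c \<in> H h n"
      then have "fst c \<in> P h" "snd c \<in> M h" using Hsub[of h n] by auto
      moreover from this have "bump (fst c) (P h) (fst c) > 0" "bump (snd c) (M h) (snd c) > 0"
        by (simp_all add: bump(2) PM[OF h])
      ultimately have "c \<in> nbh h c"
        by (simp add: nbh_def P_def M_def case_prod_unfold mem_Times_iff)
      then show "c \<in> (\<Union>c\<in>H h n. nbh h c)" using c by blast
    qed
  qed
  then have ex: "\<exists>F. F \<subseteq> H h n \<and> finite F \<and> H h n \<subseteq> (\<Union>c\<in>F. nbh h c)"
    if "h \<in> \<Phi>" for h n using that by simp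
  define E where "E = (\<lambda>h n. SOME F. F \<subseteq> H h n \<and> finite F \<and> H h n \<subseteq> (\<Union>c\<in>F. nbh h c))"
  have E: "E h n \<subseteq> H h n" "finite (E h n)" "H h n \<subseteq> (\<Union>c\<in>E h n. nbh h c)" if "h \<in> \<Phi>" for h n
    using someI_ex[OF ex[OF that]] unfolding E_def by simp_all
  define I where "I = {(h, n, x, y). h \<in> \<Phi> \<and> (x, y) \<in> E h n}"
  define k where "k = (\<lambda>(h, n :: nat, x, y) z. bump x (P h) z - bump y (M h) z)"
  \<comment> \<open>Including \<open>e n\<close> below the label leaves finitely many \<open>n\<close> at each level.\<close>
  define \<iota> where "\<iota> = (\<lambda>(h, n, x, y). SOME q. q \<in> A \<and>
      (\<forall>p\<in>{\<pi> x (P h), \<pi> y (M h), e n}. (p, q) \<in> r))"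
  have inI: "h \<in> \<Phi>" "(x, y) \<in> E h n" "(x, y) \<in> H h n" "x \<in> P h" "y \<in> M h"
    if "(h, n, x, y) \<in> I" for h n x y
  proof -
    show "h \<in> \<Phi>" "(x, y) \<in> E h n" using that by (auto simp: I_def)
    then show "(x, y) \<in> H h n" using E(1) by blast
    then show "x \<in> P h" "y \<in> M h" using Hsub[of h n] by auto
  qed
  have \<iota>: "\<iota> (h, n, x, y) \<in> A" "(\<pi> x (P h), \<iota> (h, n, x, y)) \<in> r"
    "(\<pi> y (M h), \<iota> (h, n, x, y)) \<in> r" "(e n, \<iota> (h, n, x, y)) \<in> r"
    if "(h, n, x, y) \<in> I" for h n x y
  proof -
    have "\<exists>q. q \<in> A \<and> (\<forall>p\<in>{\<pi> x (P h), \<pi> y (M h), e n}. (p, q) \<in> r)"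
      using upper_bound[of "{\<pi> x (P h), \<pi> y (M h), e n}"] V(4) PM inI[OF that] e_in by auto
    from someI_ex[OF this] show "\<iota> (h, n, x, y) \<in> A" "(\<pi> x (P h), \<iota> (h, n, x, y)) \<in> r"
      "(\<pi> y (M h), \<iota> (h, n, x, y)) \<in> r" "(e n, \<iota> (h, n, x, y)) \<in> r"
      by (auto simp: \<iota>_def)
  qed
  have bumpP: "z \<in> P h" if "(h, n, x, y) \<in> I" "z \<in> topspace X" "bump x (P h) z > 0" for h n x y z
  proof -
    note i = inI[OF that(1)]
    show ?thesis
      using bump(4)[OF PM(1)[OF i(1)] i(4) that(2,3)] V(3)[OF PM(1)[OF i(1)] i(4)] by blast
  qed
  have bumpM: "z \<in> M h" if "(h, n, x, y) \<in> I" "z \<in> topspace X" "bump y (M h) z > 0" for h n x y z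
  proof -
    note i = inI[OF that(1)]
    show ?thesis
      using bump(4)[OF PM(2)[OF i(1)] i(5) that(2,3)] V(3)[OF PM(2)[OF i(1)] i(5)] by blast
  qed
  have "separating_family X I k \<iota>"
    unfolding separating_family_def
  proof (intro conjI ballI impI)
    fix s assume s: "s \<in> I"
    obtain h n x y where [simp]: "s = (h, n, x, y)" by (cases s) auto
    show "\<iota> s \<in> A" using \<iota>(1) s by simp
    show "continuous_map X euclideanreal (k s)"
      using bump(1) PM inI[of h n x y] s by (auto simp: k_def intro!: continuous_map_diff)
  next
    fix x' y' assume xy: "x' \<in> topspace X" "y' \<in> topspace X" "x' \<noteq> y'"
    obtain h n where h: "h \<in> \<Phi>" "(x', y') \<in> H h n" using Hcover[OF xy] by blast
    obtain c where "c \<in> E h n" "(x', y') \<in> nbh h c" using subsetD[OF E(3)[OF h(1)] h(2)] by auto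
    then obtain x y where xyE: "(x, y) \<in> E h n" "(x', y') \<in> nbh h (x, y)" by (cases c) simp
    have s: "(h, n, x, y) \<in> I" using h xyE(1) by (simp add: I_def)
    have pos: "bump x (P h) x' > 0" "bump y (M h) y' > 0" using xyE(2) by (auto simp: nbh_def)
    have "x' \<notin> M h" using bumpP[OF s xy(1) pos(1)] by (auto simp: P_def M_def)
    then have "\<not> bump y (M h) x' > 0" using bumpM[OF s xy(1)] by blast
    moreover have "y' \<notin> P h" using bumpM[OF s xy(2) pos(2)] by (auto simp: P_def M_def)
    then have "\<not> bump x (P h) y' > 0" using bumpP[OF s xy(2)] by blast
    ultimately have "k (h, n, x, y) x' > 0 \<and> k (h, n, x, y) y' < 0"
      using pos by (simp add: k_def)
    then show "\<exists>s\<in>I. k s x' > 0 \<and> k s y' < 0" using s by blast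
  next
    fix p x' y' assume p: "p \<in> A" and x': "x' \<in> topspace X" and y': "y' \<in> topspace X"
    let ?J = "{s \<in> I. (\<iota> s, p) \<in> r \<and> k s x' > 0 \<and> k s y' < 0}"
    have J: "(h, n, x, y) \<in> I" "(\<pi> x (P h), p) \<in> r" "(\<pi> y (M h), p) \<in> r" "(e n, p) \<in> r"
      "x' \<in> V x (P h)" "y' \<in> V y (M h)" if "(h, n, x, y) \<in> ?J" for h n x y
    proof -
      show s: "(h, n, x, y) \<in> I" using that by simp
      show "(\<pi> x (P h), p) \<in> r" "(\<pi> y (M h), p) \<in> r" "(e n, p) \<in> r"
        using \<iota>(2-4)[OF s] that le_trans by blast+
      note i = inI[OF s]
      have nonneg: "0 \<le> bump y (M h) x'" "0 \<le> bump x (P h) y'"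
        using bump(3)[OF PM(2)[OF i(1)] i(5) x'] bump(3)[OF PM(1)[OF i(1)] i(4) y'] by auto
      then have "bump x (P h) x' > 0" "bump y (M h) y' > 0" using that by (auto simp: k_def)
      then show "x' \<in> V x (P h)" "y' \<in> V y (M h)"
        using bump(4)[OF PM(1)[OF i(1)] i(4) x'] bump(4)[OF PM(2)[OF i(1)] i(5) y'] by auto
    qed
    show "finite ?J"
    proof (rule ccontr)
      assume inf: "infinite ?J"
      have "?J \<subseteq> (\<Union>h\<in>fst ` ?J. \<Union>n\<in>{n. (e n, p) \<in> r}. {h} \<times> {n} \<times> E h n)"
      proof
        fix s assume s: "s \<in> ?J"
        obtain h n x y where [simp]: "s = (h, n, x, y)" by (cases s) auto
        have hJ: "h \<in> fst ` ?J" using s by (intro image_eqI[of _ _ s]) auto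
        have nJ: "n \<in> {n. (e n, p) \<in> r}" using J(4)[of h n x y] s by simp
        have "s \<in> {h} \<times> {n} \<times> E h n" using s inI(2)[of h n x y] by simp
        then show "s \<in> (\<Union>h\<in>fst ` ?J. \<Union>n\<in>{n. (e n, p) \<in> r}. {h} \<times> {n} \<times> E h n)"
          by (rule UN_I[OF hJ UN_I[OF nJ]])
      qed
      moreover have "finite (\<Union>h\<in>fst ` ?J. \<Union>n\<in>{n. (e n, p) \<in> r}. {h} \<times> {n} \<times> E h n)"
        if "finite (fst ` ?J)"
        using that E(2) e_finite[OF p] by (intro finite_UN_I finite_cartesian_product) (auto simp: I_def)
      ultimately have "infinite (fst ` ?J)" using inf by (meson finite_subset)
      moreover have "fst ` ?J \<subseteq> \<Phi>" by (auto simp: I_def)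
      ultimately obtain g :: "nat \<Rightarrow> 'a \<Rightarrow> real" where g: "\<forall>n. g n \<in> fst ` ?J"
        and inc: "\<forall>i j. i < j \<longrightarrow> (g i, g j) \<in> w \<and> g i \<noteq> g j"
        using well_order_on_increasing_sequence[OF w] by meson
      have "\<forall>i. \<exists>c. (g i, c) \<in> ?J" using g by force
      from choice[OF this] obtain c where c: "\<And>i. (g i, c i) \<in> ?J" by blast
      define n x y where "n = (\<lambda>i. fst (c i))" "x = (\<lambda>i. fst (snd (c i)))" "y = (\<lambda>i. snd (snd (c i)))"
      have cJ: "(g i, n i, x i, y i) \<in> ?J" for i using c[of i] by (simp add: n_x_y_def)
      have g\<Phi>: "g i \<in> \<Phi>" and xi: "x i \<in> P (g i)" and yi: "y i \<in> M (g i)"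
        and Hi: "(x i, y i) \<in> H (g i) (n i)" for i
        using inI[OF J(1)[OF cJ[of i]]] by auto
      have esc: "x i \<notin> P (g j) \<or> y i \<notin> M (g j)" if "j < i" for i j
      proof -
        have "(g i, g j) \<notin> w" using inc that anti by (metis antisymD)
        then show ?thesis using Hi[of i] g\<Phi>[of j] by (auto simp: H_def)
      qed
      \<comment> \<open>The colour \<open>c\<close> names the coordinate in which the later pair misses the earlier rectangle.\<close>
      define Q where "Q = (\<lambda>j c i. if c then x i \<notin> P (g j) else y i \<notin> M (g j))"
      have "\<exists>c\<in>{True, False}. Q j c i" if "j < i" for j i
        using esc[OF that] by (auto simp: Q_def)
      then have "\<exists>(l :: nat \<Rightarrow> nat) c. strict_mono l \<and> (\<forall>n. c n \<in> {True, False}) \<and>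
          (\<forall>n m. n < m \<longrightarrow> Q (l n) (c n) (l m))"
        by (intro thin_out) auto
      then obtain l :: "nat \<Rightarrow> nat" and col where l: "\<And>n m. n < m \<Longrightarrow> Q (l n) (col n) (l m)" by blast
      have "infinite {n. col n} \<or> infinite {n. \<not> col n}"
      proof -
        have "{n. col n} \<union> {n. \<not> col n} = UNIV" by auto
        then show ?thesis by (metis finite_Un infinite_UNIV_nat)
      qed
      then show False
      proof
        assume inf: "infinite {n. col n}"
        let ?m = "\<lambda>i. l (enumerate {n. col n} i)"
        have "x (?m i) \<notin> P (g (?m j))" if "j < i" for i j
          using l[OF enumerate_mono[OF that inf]] enumerate_in_set[OF inf, of j] by (simp add: Q_def)
        then show False
          by (intro no_bad[OF p, of "\<lambda>i. P (g (?m i))" "\<lambda>i. x (?m i)" x'] PM(1)[OF g\<Phi>] xi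
            J(2,5)[OF cJ])
      next
        assume inf: "infinite {n. \<not> col n}"
        let ?m = "\<lambda>i. l (enumerate {n. \<not> col n} i)"
        have "y (?m i) \<notin> M (g (?m j))" if "j < i" for i j
          using l[OF enumerate_mono[OF that inf]] enumerate_in_set[OF inf, of j] by (simp add: Q_def)
        then show False
          by (intro no_bad[OF p, of "\<lambda>i. M (g (?m i))" "\<lambda>i. y (?m i)" y'] PM(2)[OF g\<Phi>] yi
            J(3,6)[OF cJ])
      qed
    qed
  qed
  then show ?thesis by blast
qed

end

section \<open>Generated indices and their shadows\<close>

locale separated_space = level_set A r e cell
  for A :: "'p set" and r e cell +
  fixes X :: "'a topology" and I :: "'i set" and h :: "'i \<Rightarrow> 'a \<Rightarrow> real" and \<iota> :: "'i \<Rightarrow> 'p"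
  assumes compact: "compact_space X" and family: "separating_family X I h \<iota>"
begin

lemma h_cont: "s \<in> I \<Longrightarrow> continuous_map X euclideanreal (h s)"
  and label_in: "s \<in> I \<Longrightarrow> \<iota> s \<in> A"
  and h_separates: "x \<in> topspace X \<Longrightarrow> y \<in> topspace X \<Longrightarrow> x \<noteq> y \<Longrightarrow> \<exists>s\<in>I. h s x > 0 \<and> h s y < 0"
  and h_finite: "p \<in> A \<Longrightarrow> x \<in> topspace X \<Longrightarrow> y \<in> topspace X \<Longrightarrow>
    finite {s \<in> I. (\<iota> s, p) \<in> r \<and> h s x > 0 \<and> h s y < 0}"
  using family unfolding separating_family_def by simp_all

text \<open>A list of triples \<open>(s, u, v)\<close> with rational \<open>u, v\<close> prescribes values of finitely many \<open>h s\<close> up to an error.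
Rational bounds keep the number of prescriptions over a countable index set countable.\<close>
definition boxed :: "('i \<times> rat \<times> rat) list \<Rightarrow> 'a \<Rightarrow> bool" where
  "boxed l x \<longleftrightarrow> x \<in> topspace X \<and> (\<forall>(s, u, v)\<in>set l. of_rat u < h s x \<and> h s x < of_rat v)"

definition witness :: "('i \<times> rat \<times> rat) list \<Rightarrow> 'a" where
  "witness l = (SOME x. boxed l x)"

definition points :: "'i set \<Rightarrow> 'a set" where
  "points S = {witness l | l. fst ` set l \<subseteq> S \<and> (\<exists>x. boxed l x)}"

text \<open>Any rectangle that separates two witness points is added; point finiteness makes this a
countable set for each pair of witnesses.\<close>
definition grow :: "'i set \<Rightarrow> 'i set" where
  "grow S = S \<union> {s \<in> I. \<exists>d\<in>points S. \<exists>d'\<in>points S. h s d > 0 \<and> h s d' < 0}"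

text \<open>The closure of \<open>G\<close> under adding witnesses and separating rectangles; it plays the part of an
elementary submodel containing \<open>G\<close>.\<close>
definition gen :: "'i set \<Rightarrow> 'i set" where
  "gen G = (\<Union>n. (grow ^^ n) G)"

definition shadow :: "'i set \<Rightarrow> 'a set" where
  "shadow G = X closure_of points (gen G)"

lemma boxed_witness: "boxed l x \<Longrightarrow> boxed l (witness l)"
  unfolding witness_def by (rule someI)

lemma points_topspace: "points S \<subseteq> topspace X"
  unfolding points_def using boxed_witness by (auto simp: boxed_def)

lemma points_mono: "S \<subseteq> S' \<Longrightarrow> points S \<subseteq> points S'"
  unfolding points_def by blast

lemma grow_mono: "S \<subseteq> S' \<Longrightarrow> grow S \<subseteq> grow S'"
  unfolding grow_def using points_mono[of S S'] by blast

lemma grow_iterate_mono: "S \<subseteq> S' \<Longrightarrow> (grow ^^ n) S \<subseteq> (grow ^^ n) S'"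
  by (induction n) (auto intro: subsetD[OF grow_mono])

lemma grow_iterate_increasing: "n \<le> m \<Longrightarrow> (grow ^^ n) S \<subseteq> (grow ^^ m) S"
  by (rule lift_Suc_mono_le) (auto simp: grow_def)

lemma gen_mono: "G \<subseteq> G' \<Longrightarrow> gen G \<subseteq> gen G'"
  unfolding gen_def using grow_iterate_mono[of G G'] by blast

lemma subset_gen: "G \<subseteq> gen G"
  unfolding gen_def using UN_upper[of 0 UNIV "\<lambda>n. (grow ^^ n) G"] by simp

lemma gen_subset:
  assumes "G \<subseteq> I"
  shows "gen G \<subseteq> I"
proof -
  have "(grow ^^ n) G \<subseteq> I" for n
    by (induction n) (use assms in \<open>auto simp: grow_def\<close>)
  then show ?thesis unfolding gen_def by blast
qed

lemma shadow_mono: "G \<subseteq> G' \<Longrightarrow> shadow G \<subseteq> shadow G'"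
  unfolding shadow_def by (intro closure_of_mono points_mono gen_mono)

lemma shadow_topspace: "shadow G \<subseteq> topspace X"
  unfolding shadow_def by (rule closure_of_subset_topspace)

lemma points_gen_stage:
  assumes "d \<in> points (gen G)"
  shows "\<exists>n. d \<in> points ((grow ^^ n) G)"
proof -
  obtain l where l: "d = witness l" "fst ` set l \<subseteq> gen G" "\<exists>x. boxed l x"
    using assms unfolding points_def by blast
  have stage: "\<exists>n. F \<subseteq> (grow ^^ n) G" if "finite F" "F \<subseteq> gen G" for F
    using that
  proof (induction F)
    case (insert s F)
    then obtain n where n: "F \<subseteq> (grow ^^ n) G" by blast
    obtain m where m: "s \<in> (grow ^^ m) G" using insert.prems unfolding gen_def by blast
    have "F \<subseteq> (grow ^^ max n m) G" "s \<in> (grow ^^ max n m) G"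
      using n m grow_iterate_increasing[of n "max n m" G] grow_iterate_increasing[of m "max n m" G]
      by auto
    then show ?case by (intro exI[of _ "max n m"]) simp
  qed simp
  obtain n where "fst ` set l \<subseteq> (grow ^^ n) G" using stage[OF _ l(2)] by auto
  then show ?thesis using l unfolding points_def by blast
qed

lemma gen_closed:
  assumes "s \<in> I" "d \<in> points (gen G)" "d' \<in> points (gen G)" "h s d > 0" "h s d' < 0"
  shows "s \<in> gen G"
proof -
  obtain n m where "d \<in> points ((grow ^^ n) G)" "d' \<in> points ((grow ^^ m) G)"
    using points_gen_stage assms(2,3) by blast
  then have "d \<in> points ((grow ^^ max n m) G)" "d' \<in> points ((grow ^^ max n m) G)"
    using points_mono[OF grow_iterate_increasing[of n "max n m" G]]
      points_mono[OF grow_iterate_increasing[of m "max n m" G]] by auto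
  then have "s \<in> grow ((grow ^^ max n m) G)" unfolding grow_def using assms(1,4,5) by blast
  then have "s \<in> (grow ^^ Suc (max n m)) G" by simp
  then show ?thesis unfolding gen_def by blast
qed

text \<open>Every index is produced from finitely many witnesses, each of which depends on finitely many
indices. This makes \<open>gen\<close> commute with increasing unions, so nothing new appears at limit stages.\<close>
lemma gen_finitary:
  assumes "s \<in> gen G"
  shows "\<exists>G0\<subseteq>G. finite G0 \<and> s \<in> gen G0"
proof -
  have pts: "\<exists>G0\<subseteq>G. finite G0 \<and> d \<in> points ((grow ^^ n) G0)"
    if d: "d \<in> points ((grow ^^ n) G)"
      and IH: "\<forall>s\<in>(grow ^^ n) G. \<exists>G0\<subseteq>G. finite G0 \<and> s \<in> (grow ^^ n) G0" for d n
  proof -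
    obtain l where l: "d = witness l" "fst ` set l \<subseteq> (grow ^^ n) G" "\<exists>x. boxed l x"
      using d unfolding points_def by blast
    have "\<forall>s\<in>fst ` set l. \<exists>G0. G0 \<subseteq> G \<and> finite G0 \<and> s \<in> (grow ^^ n) G0" using IH l(2) by blast
    from bchoice[OF this] obtain G0 where G0: "\<forall>s\<in>fst ` set l. G0 s \<subseteq> G \<and> finite (G0 s) \<and>
        s \<in> (grow ^^ n) (G0 s)" ..
    let ?G = "\<Union>s\<in>fst ` set l. G0 s"
    have "fst ` set l \<subseteq> (grow ^^ n) ?G"
    proof
      fix s assume s: "s \<in> fst ` set l"
      then have "(grow ^^ n) (G0 s) \<subseteq> (grow ^^ n) ?G" by (intro grow_iterate_mono UN_upper)
      then show "s \<in> (grow ^^ n) ?G" using G0 s by blast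
    qed
    then have "d \<in> points ((grow ^^ n) ?G)" using l unfolding points_def by blast
    moreover have "?G \<subseteq> G" "finite ?G" using G0 by auto
    ultimately show ?thesis by blast
  qed
  have "\<forall>s\<in>(grow ^^ n) G. \<exists>G0\<subseteq>G. finite G0 \<and> s \<in> (grow ^^ n) G0" for n
  proof (induction n)
    case 0
    have "\<exists>G0\<subseteq>G. finite G0 \<and> s \<in> G0" if "s \<in> G" for s using that by (intro exI[of _ "{s}"]) simp
    then show ?case by simp
  next
    case (Suc n)
    show ?case
    proof
      fix s assume "s \<in> (grow ^^ Suc n) G"
      then consider "s \<in> (grow ^^ n) G"
        | d d' where "s \<in> I" "d \<in> points ((grow ^^ n) G)" "d' \<in> points ((grow ^^ n) G)"
          "h s d > 0" "h s d' < 0"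
        unfolding funpow.simps comp_def grow_def[of "(grow ^^ n) G"] by blast
      then show "\<exists>G0\<subseteq>G. finite G0 \<and> s \<in> (grow ^^ Suc n) G0"
      proof cases
        case 1
        then obtain G0 where "G0 \<subseteq> G" "finite G0" "s \<in> (grow ^^ n) G0" using Suc by blast
        moreover have "(grow ^^ n) G0 \<subseteq> (grow ^^ Suc n) G0"
          by (rule grow_iterate_increasing) simp
        ultimately show ?thesis by blast
      next
        case 2
        obtain G1 where G1: "G1 \<subseteq> G" "finite G1" "d \<in> points ((grow ^^ n) G1)"
          using pts[OF 2(2) Suc] by blast
        obtain G2 where G2: "G2 \<subseteq> G" "finite G2" "d' \<in> points ((grow ^^ n) G2)"
          using pts[OF 2(3) Suc] by blast
        have "points ((grow ^^ n) G1) \<subseteq> points ((grow ^^ n) (G1 \<union> G2))"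
          "points ((grow ^^ n) G2) \<subseteq> points ((grow ^^ n) (G1 \<union> G2))"
          by (intro points_mono grow_iterate_mono; blast)+
        then have "d \<in> points ((grow ^^ n) (G1 \<union> G2))" "d' \<in> points ((grow ^^ n) (G1 \<union> G2))"
          using G1(3) G2(3) by auto
        then have "s \<in> grow ((grow ^^ n) (G1 \<union> G2))"
          unfolding grow_def[of "(grow ^^ n) (G1 \<union> G2)"] using 2 by blast
        then have "s \<in> (grow ^^ Suc n) (G1 \<union> G2)" by simp
        moreover have "G1 \<union> G2 \<subseteq> G" "finite (G1 \<union> G2)" using G1 G2 by auto
        ultimately show ?thesis by blast
      qed
    qed
  qed
  moreover obtain n where n: "s \<in> (grow ^^ n) G" using assms unfolding gen_def by blast
  ultimately obtain G0 where "G0 \<subseteq> G" "finite G0" "s \<in> (grow ^^ n) G0" by blast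
  then show ?thesis unfolding gen_def by blast
qed

lemma countable_gen:
  assumes "countable G"
  shows "countable (gen G)"
proof -
  have pts: "countable (points S)" if "countable S" for S
  proof -
    have "points S \<subseteq> witness ` lists (S \<times> (UNIV :: (rat \<times> rat) set))"
    proof
      fix d assume "d \<in> points S"
      then obtain l where "d = witness l" "fst ` set l \<subseteq> S" unfolding points_def by blast
      moreover from this have "l \<in> lists (S \<times> UNIV)" by (auto simp: lists_eq_set)
      ultimately show "d \<in> witness ` lists (S \<times> UNIV)" by blast
    qed
    moreover have "countable (witness ` lists (S \<times> (UNIV :: (rat \<times> rat) set)))"
      using that by simp
    ultimately show ?thesis by (rule countable_subset)
  qed
  have pair: "countable {s \<in> I. h s d > 0 \<and> h s d' < 0}"
    if "d \<in> topspace X" "d' \<in> topspace X" for d d'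
  proof (rule countable_if_finite_levels(2)[where \<iota> = \<iota>])
    show "\<iota> s \<in> A" if "s \<in> {s \<in> I. h s d > 0 \<and> h s d' < 0}" for s using that label_in by simp
    show "finite {s \<in> {s \<in> I. h s d > 0 \<and> h s d' < 0}. (\<iota> s, p) \<in> r}" if "p \<in> A" for p
      by (rule finite_subset[OF _ h_finite[OF that \<open>d \<in> topspace X\<close> \<open>d' \<in> topspace X\<close>]]) auto
  qed
  have "countable (grow S)" if S: "countable S" for S
  proof -
    have "grow S = S \<union> (\<Union>d\<in>points S. \<Union>d'\<in>points S. {s \<in> I. h s d > 0 \<and> h s d' < 0})"
      unfolding grow_def by blast
    moreover have "countable \<dots>"
      using S pts[OF S] pair points_topspace[of S]
      by (intro countable_Un countable_UN) auto
    ultimately show ?thesis by simp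
  qed
  then have "countable ((grow ^^ n) G)" for n by (induction n) (use assms in auto)
  then show ?thesis unfolding gen_def by simp
qed

lemma shadow_approximate:
  assumes "s \<in> I" "x \<in> shadow G"
  shows "h s x > 0 \<Longrightarrow> \<exists>d\<in>points (gen G). h s d > 0"
    and "h s x < 0 \<Longrightarrow> \<exists>d\<in>points (gen G). h s d < 0"
proof -
  have dense: "\<exists>d\<in>points (gen G). d \<in> T" if "openin X T" "x \<in> T" for T
    using assms(2) that unfolding shadow_def in_closure_of by blast
  have x: "x \<in> topspace X" using assms(2) shadow_topspace by blast
  show "\<exists>d\<in>points (gen G). h s d > 0" if "h s x > 0"
    using dense[OF openin_continuous_pos(1)[OF h_cont[OF assms(1)]]] x that by auto
  show "\<exists>d\<in>points (gen G). h s d < 0" if "h s x < 0"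
    using dense[OF openin_continuous_pos(2)[OF h_cont[OF assms(1)]]] x that by auto
qed

text \<open>A rectangle separating two points of the closure separates two witnesses as well, so it belongs to \<open>gen G\<close>.\<close>
lemma shadow_separated:
  assumes "x \<in> shadow G" "y \<in> shadow G" "x \<noteq> y"
  shows "\<exists>s\<in>gen G. h s x \<noteq> h s y"
proof -
  obtain s where s: "s \<in> I" "h s x > 0" "h s y < 0"
    using h_separates assms shadow_topspace by blast
  have "s \<in> gen G"
    using gen_closed[OF s(1)] shadow_approximate(1)[OF s(1) assms(1) s(2)]
      shadow_approximate(2)[OF s(1) assms(2) s(3)] by blast
  then show ?thesis using s by force
qed

text \<open>Compactness: any finitely many approximate values of the \<open>h s\<close> at \<open>x\<close> are attained at a witness.\<close>
lemma shadow_represents: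
  assumes G: "G \<subseteq> I" and x: "x \<in> topspace X"
  shows "\<exists>x'\<in>shadow G. \<forall>s\<in>gen G. h s x' = h s x"
proof -
  define Z where "Z = (\<lambda>(s, n). {z \<in> topspace X. h s z \<in> {h s x - 1 / real (Suc n)..h s x + 1 / real (Suc n)}})"
  let ?\<U> = "insert (shadow G) (Z ` (gen G \<times> (UNIV :: nat set)))"
  have closed: "closedin X C" if "C \<in> ?\<U>" for C
  proof -
    have "closedin X (shadow G)" unfolding shadow_def by simp
    moreover have "closedin X (Z (s, n))" if "s \<in> gen G" for s n
    proof -
      have "s \<in> I" using that gen_subset[OF G] by blast
      then show ?thesis unfolding Z_def prod.case
        by (intro closedin_continuous_map_preimage[OF h_cont]) auto
    qed
    ultimately show ?thesis using that by auto
  qed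
  have "\<Inter>\<F> \<noteq> {}" if \<F>: "finite \<F>" "\<F> \<subseteq> ?\<U>" for \<F>
  proof -
    have sub: "\<F> - {shadow G} \<subseteq> Z ` (gen G \<times> UNIV)" using \<F>(2) by blast
    have fin: "finite (\<F> - {shadow G})" using \<F>(1) by simp
    obtain J where J: "finite J" "J \<subseteq> gen G \<times> (UNIV :: nat set)" "\<F> - {shadow G} = Z ` J"
      using finite_subset_image[OF fin sub] by blast
    obtain js where js: "set js = J" using finite_list[OF J(1)] by blast
    have "\<forall>j. \<exists>uv. h (fst j) x - 1 / real (Suc (snd j)) < of_rat (fst uv) \<and>
        of_rat (fst uv) < h (fst j) x \<and> h (fst j) x < of_rat (snd uv) \<and>
        of_rat (snd uv) < h (fst j) x + 1 / real (Suc (snd j))"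
    proof
      fix j :: "'i \<times> nat"
      have "h (fst j) x - 1 / real (Suc (snd j)) < h (fst j) x"
        "h (fst j) x < h (fst j) x + 1 / real (Suc (snd j))" by simp_all
      then obtain u v where "h (fst j) x - 1 / real (Suc (snd j)) < of_rat u \<and> of_rat u < h (fst j) x"
        "h (fst j) x < of_rat v \<and> of_rat v < h (fst j) x + 1 / real (Suc (snd j))"
        using of_rat_dense by meson
      then show "\<exists>uv. h (fst j) x - 1 / real (Suc (snd j)) < of_rat (fst uv) \<and>
        of_rat (fst uv) < h (fst j) x \<and> h (fst j) x < of_rat (snd uv) \<and>
        of_rat (snd uv) < h (fst j) x + 1 / real (Suc (snd j))"
        by (intro exI[of _ "(u, v)"]) simp
    qed
    from choice[OF this] obtain uv where uv: "\<And>j. h (fst j) x - 1 / real (Suc (snd j)) < of_rat (fst (uv j))"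
        "\<And>j. of_rat (fst (uv j)) < h (fst j) x" "\<And>j. h (fst j) x < of_rat (snd (uv j))"
        "\<And>j. of_rat (snd (uv j)) < h (fst j) x + 1 / real (Suc (snd j))" by blast
    define l where "l = map (\<lambda>j. (fst j, fst (uv j), snd (uv j))) js"
    have boxed: "boxed l z \<longleftrightarrow> z \<in> topspace X \<and> (\<forall>j\<in>J. of_rat (fst (uv j)) < h (fst j) z \<and>
        h (fst j) z < of_rat (snd (uv j)))" for z
      by (simp add: boxed_def l_def js case_prod_unfold)
    have "boxed l x" using x uv(2,3) by (simp add: boxed)
    then have bw: "boxed l (witness l)" by (rule boxed_witness)
    have "fst ` set l \<subseteq> gen G" using J(2) js by (auto simp: l_def)
    then have "witness l \<in> points (gen G)" unfolding points_def using \<open>boxed l x\<close> by blast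
    then have "witness l \<in> shadow G"
      unfolding shadow_def using closure_of_subset[OF points_topspace] by blast
    moreover have "witness l \<in> Z j" if "j \<in> J" for j
    proof -
      have "of_rat (fst (uv j)) < h (fst j) (witness l)" "h (fst j) (witness l) < of_rat (snd (uv j))"
        using bw that by (simp_all add: boxed)
      then have "h (fst j) x - 1 / real (Suc (snd j)) \<le> h (fst j) (witness l)"
        "h (fst j) (witness l) \<le> h (fst j) x + 1 / real (Suc (snd j))"
        using uv(1,4)[of j] by linarith+
      moreover have "witness l \<in> topspace X" using bw by (simp add: boxed_def)
      ultimately show ?thesis by (simp add: Z_def case_prod_unfold)
    qed
    ultimately have "witness l \<in> \<Inter>\<F>" using J(3) by blast
    then show ?thesis by blast
  qed
  then have "\<Inter>?\<U> \<noteq> {}"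
    using compact closed unfolding compact_space_fip by meson
  then obtain x' where x': "x' \<in> \<Inter>?\<U>" by blast
  have "h s x' = h s x" if s: "s \<in> gen G" for s
  proof (rule ccontr)
    assume "h s x' \<noteq> h s x"
    then obtain n where n: "1 / real (Suc n) < \<bar>h s x' - h s x\<bar>"
      using nat_approx_posE[of "\<bar>h s x' - h s x\<bar>"] by auto
    have "(s, n) \<in> gen G \<times> UNIV" using s by simp
    then have "x' \<in> Z (s, n)" by (intro InterD[OF x'] insertI2 imageI)
    then have "h s x - 1 / real (Suc n) \<le> h s x'" "h s x' \<le> h s x + 1 / real (Suc n)"
      by (simp_all add: Z_def)
    then show False using n by linarith
  qed
  moreover have "x' \<in> shadow G" using x' by simp
  ultimately show ?thesis by blast
qed

end

section \<open>Pieces at which new points appear\<close>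

context separated_space
begin

text \<open>The finite sets \<open>F\<close> of rectangles that separate some point of \<open>K'\<close> from all of \<open>K\<close>. Minimality
excludes redundant members, which would allow infinitely many \<open>F\<close> for the same \<open>K\<close>.\<close>
definition piece :: "'a set \<Rightarrow> 'a set \<Rightarrow> 'i set \<Rightarrow> bool" where
  "piece K K' F \<longleftrightarrow> finite F \<and> F \<subseteq> I \<and> K \<subseteq> (\<Union>s\<in>F. {u. h s u < 0}) \<and>
     (\<forall>F'. F' \<subset> F \<longrightarrow> \<not> K \<subseteq> (\<Union>s\<in>F'. {u. h s u < 0})) \<and> (\<exists>u\<in>K'. \<forall>s\<in>F. h s u > 0)"

text \<open>An infinite set of pairs \<open>(\<xi>, F)\<close> with \<open>card F \<le> N\<close> would contain, for each \<open>k\<close>, an infinite subset all of whose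
\<open>F\<close> contain a common \<open>H\<close> with \<open>k\<close> elements. Given \<open>H\<close>, there is a point \<open>u\<close> that lies in \<open>K \<xi>\<close> for infinitely many of
these pairs and where no \<open>h s\<close>, \<open>s \<in> H\<close>, is negative: if infinitely many pairs share the first stage, by minimality of
\<open>F\<close>; otherwise a point that was new at the first stage. Each \<open>F\<close> of these pairs must have a member that is
negative at \<open>u\<close> and positive at \<open>x\<close>; only finitely many indices qualify, so one of them is shared by infinitely
many \<open>F\<close>, and it is not in \<open>H\<close>.\<close>
lemma finite_pieces:
  fixes K K' :: "'g \<Rightarrow> 'a set"
  assumes least: "\<And>Z. Z \<subseteq> \<Xi> \<Longrightarrow> Z \<noteq> {} \<Longrightarrow> \<exists>\<xi>\<in>Z. \<forall>\<zeta>\<in>Z. \<zeta> \<noteq> \<xi> \<longrightarrow> K' \<xi> \<subseteq> K \<zeta>"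
    and top: "\<And>\<xi>. K \<xi> \<subseteq> topspace X"
    and x: "x \<in> topspace X" and p: "p \<in> A"
  shows "finite {(\<xi>, F). \<xi> \<in> \<Xi> \<and> piece (K \<xi>) (K' \<xi>) F \<and> card F \<le> N \<and>
    (\<forall>s\<in>F. (\<iota> s, p) \<in> r \<and> h s x > 0)}" (is "finite ?Q")
proof (rule ccontr)
  assume inf: "infinite ?Q"
  have "\<exists>Q'\<subseteq>?Q. infinite Q' \<and> (\<exists>H. finite H \<and> card H = k \<and> (\<forall>c\<in>Q'. H \<subseteq> snd c))" for k
  proof (induction k)
    case 0
    have "infinite ?Q \<and> (\<exists>H :: 'i set. finite H \<and> card H = 0 \<and> (\<forall>c\<in>?Q. H \<subseteq> snd c))"
      using inf by (intro conjI exI[of _ "{}"]) auto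
    then show ?case by blast
  next
    case (Suc k)
    then obtain Q' H where Q': "Q' \<subseteq> ?Q" "infinite Q'" and H: "finite H" "card H = k"
      "\<And>c. c \<in> Q' \<Longrightarrow> H \<subseteq> snd c" by blast
    have Q'D: "fst c \<in> \<Xi>" "piece (K (fst c)) (K' (fst c)) (snd c)"
      "\<And>s. s \<in> snd c \<Longrightarrow> (\<iota> s, p) \<in> r \<and> h s x > 0" if "c \<in> Q'" for c
      using Q'(1) that by auto
    have "fst ` Q' \<subseteq> \<Xi>" using Q'D(1) by (rule image_subsetI)
    moreover have "fst ` Q' \<noteq> {}" using Q'(2) by auto
    ultimately obtain \<xi> where \<xi>: "\<xi> \<in> fst ` Q'" "\<forall>\<zeta>\<in>fst ` Q'. \<zeta> \<noteq> \<xi> \<longrightarrow> K' \<xi> \<subseteq> K \<zeta>"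
      by (rule bexE[OF least])
    have "\<exists>Q''\<subseteq>Q'. infinite Q'' \<and> (\<exists>u. \<forall>c\<in>Q''. u \<in> K (fst c) \<and> (\<forall>s\<in>H. \<not> h s u < 0))"
    proof (cases "infinite {c \<in> Q'. fst c = \<xi>}")
      case True
      let ?Q = "{c \<in> Q'. fst c = \<xi>}"
      have "\<exists>c\<in>?Q. snd c \<noteq> H"
      proof (rule ccontr)
        assume "\<not> ?thesis"
        then have "?Q \<subseteq> {(\<xi>, H)}" by auto
        then have "finite ?Q" by (rule finite_subset) simp
        with True show False ..
      qed
      then obtain c where c: "c \<in> Q'" "fst c = \<xi>" "snd c \<noteq> H" by blast
      then have "H \<subset> snd c" using H(3) by blast
      then have "\<not> K \<xi> \<subseteq> (\<Union>s\<in>H. {u. h s u < 0})"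
        using Q'D(2)[OF c(1)] c(2) unfolding piece_def by simp
      then obtain u where "u \<in> K \<xi>" "\<forall>s\<in>H. \<not> h s u < 0" by blast
      then have "\<forall>c\<in>?Q. u \<in> K (fst c) \<and> (\<forall>s\<in>H. \<not> h s u < 0)" by auto
      moreover have "?Q \<subseteq> Q'" by blast
      ultimately show ?thesis using True by meson
    next
      case False
      let ?Q = "{c \<in> Q'. fst c \<noteq> \<xi>}"
      have "Q' - {c \<in> Q'. fst c = \<xi>} = ?Q" by blast
      moreover have "infinite (Q' - {c \<in> Q'. fst c = \<xi>})"
        using False Q'(2) by (intro Diff_infinite_finite) simp_all
      ultimately have infQ: "infinite ?Q" by simp
      obtain c where c: "c \<in> Q'" "fst c = \<xi>" using \<xi>(1) by blast
      obtain u where u: "u \<in> K' \<xi>" "\<forall>s\<in>snd c. h s u > 0"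
        using Q'D(2)[OF c(1)] c(2) unfolding piece_def by auto
      have "\<forall>c\<in>?Q. u \<in> K (fst c) \<and> (\<forall>s\<in>H. \<not> h s u < 0)"
      proof (intro ballI conjI)
        fix c' assume "c' \<in> ?Q"
        then have "K' \<xi> \<subseteq> K (fst c')" by (intro \<xi>(2)[rule_format]) auto
        then show "u \<in> K (fst c')" using u(1) by blast
        show "\<not> h s u < 0" if "s \<in> H" for s using u(2) H(3)[OF c(1)] that by force
      qed
      moreover have "?Q \<subseteq> Q'" by blast
      ultimately show ?thesis using infQ by meson
    qed
    then obtain Q'' u where Q'': "Q'' \<subseteq> Q'" "infinite Q''" and uK: "\<And>c. c \<in> Q'' \<Longrightarrow> u \<in> K (fst c)"
      and uH: "\<And>c s. c \<in> Q'' \<Longrightarrow> s \<in> H \<Longrightarrow> \<not> h s u < 0" by blast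
    let ?S = "{s \<in> I. (\<iota> s, p) \<in> r \<and> h s x > 0 \<and> h s u < 0}"
    obtain c0 where c0: "c0 \<in> Q''" using Q''(2) by (metis finite.emptyI ex_in_conv)
    have "finite ?S" by (rule h_finite[OF p x]) (use uK[OF c0] top in blast)
    have "\<exists>s. s \<in> snd c \<inter> ?S" if c: "c \<in> Q''" for c
    proof -
      have cQ: "c \<in> Q'" using c Q''(1) by blast
      have "K (fst c) \<subseteq> (\<Union>s\<in>snd c. {u. h s u < 0})" "snd c \<subseteq> I"
        using Q'D(2)[OF cQ] unfolding piece_def by auto
      then obtain s where "s \<in> snd c" "h s u < 0" "s \<in> I" using uK[OF c] by blast
      then show ?thesis using Q'D(3)[OF cQ] by blast
    qed
    then have "\<forall>c\<in>Q''. \<exists>s. s \<in> snd c \<inter> ?S" by simp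
    from bchoice[OF this] obtain f where f: "\<forall>c\<in>Q''. f c \<in> snd c \<inter> ?S" ..
    then have "f ` Q'' \<subseteq> ?S" by blast
    then have fin: "finite (f ` Q'')" using \<open>finite ?S\<close> by (rule finite_subset)
    obtain c1 where c1: "c1 \<in> Q''" "infinite {c \<in> Q''. f c = f c1}"
      using pigeonhole_infinite[OF Q''(2) fin] by blast
    have "f c1 \<notin> H" using f uH c1(1) by blast
    show ?case
    proof (intro exI[of _ "{c \<in> Q''. f c = f c1}"] exI[of _ "insert (f c1) H"] conjI ballI)
      show "{c \<in> Q''. f c = f c1} \<subseteq> ?Q" using Q''(1) Q'(1) by blast
      show "infinite {c \<in> Q''. f c = f c1}" by (rule c1(2))
      show "finite (insert (f c1) H)" using H(1) by simp
      show "card (insert (f c1) H) = Suc k" using H(1,2) \<open>f c1 \<notin> H\<close> by simp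
      fix c assume c: "c \<in> {c \<in> Q''. f c = f c1}"
      then have cQ: "c \<in> Q''" and fc: "f c = f c1" by auto
      have "f c1 \<in> snd c" using bspec[OF f cQ] unfolding fc by (rule IntD1)
      moreover have "H \<subseteq> snd c" by (rule H(3)) (use Q''(1) cQ in blast)
      ultimately show "insert (f c1) H \<subseteq> snd c" by simp
    qed
  qed
  from this[of "Suc N"] obtain Q' H where Q': "Q' \<subseteq> ?Q" "infinite Q'"
    and H: "finite H" "card H = Suc N" "\<And>c. c \<in> Q' \<Longrightarrow> H \<subseteq> snd c"
    by (elim exE conjE) simp
  obtain c where c: "c \<in> Q'" using Q'(2) by (metis finite.emptyI ex_in_conv)
  then have "finite (snd c)" "card (snd c) \<le> N" using Q'(1) by (auto simp: piece_def)
  then show False using card_mono[OF _ H(3)[OF c]] H(2) by simp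
qed

end

section \<open>Families of functions distinguishing all points\<close>

lemma minimal_finite_subset:
  assumes "finite F" "P F"
  shows "\<exists>F'\<subseteq>F. P F' \<and> (\<forall>F''. F'' \<subset> F' \<longrightarrow> \<not> P F'')"
  using assms
proof (induction F rule: finite_psubset_induct)
  case (psubset F)
  show ?case
  proof (cases "\<exists>F''. F'' \<subset> F \<and> P F''")
    case True
    then obtain F'' where "F'' \<subset> F" "P F''" by blast
    from psubset.IH[OF this] \<open>F'' \<subset> F\<close> show ?thesis by (meson psubset_imp_subset subset_trans)
  next
    case False
    then show ?thesis using psubset.prems by blast
  qed
qed

context level_set
begin

text \<open>Functions stand for their cozero sets. A family is a relation between functions and labels, because the
same function may arise from several constructions with different labels.\<close>
definition cozero_family :: "'a topology \<Rightarrow> (('a \<Rightarrow> real) \<times> 'p) set \<Rightarrow> bool" where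
  "cozero_family X L \<longleftrightarrow>
     (\<forall>f q. (f, q) \<in> L \<longrightarrow>
        continuous_map X euclideanreal f \<and> (\<forall>x\<in>topspace X. 0 \<le> f x) \<and> q \<in> A) \<and>
     (\<forall>p\<in>A. \<forall>x\<in>topspace X. finite {f. \<exists>q. (f, q) \<in> L \<and> (q, p) \<in> r \<and> f x > 0})"

lemma cozero_familyD:
  assumes "cozero_family X L"
  shows "(f, q) \<in> L \<Longrightarrow> continuous_map X euclideanreal f"
    "(f, q) \<in> L \<Longrightarrow> x \<in> topspace X \<Longrightarrow> 0 \<le> f x" "(f, q) \<in> L \<Longrightarrow> q \<in> A"
    "p \<in> A \<Longrightarrow> x \<in> topspace X \<Longrightarrow> finite {f. \<exists>q. (f, q) \<in> L \<and> (q, p) \<in> r \<and> f x > 0}"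
  using assms unfolding cozero_family_def by simp_all

definition distinguishes :: "(('a \<Rightarrow> real) \<times> 'p) set \<Rightarrow> 'a \<Rightarrow> 'a \<Rightarrow> bool" where
  "distinguishes L x y \<longleftrightarrow> (\<exists>f q. (f, q) \<in> L \<and> (f x > 0) \<noteq> (f y > 0))"

lemma distinguishes_sym: "distinguishes L x y \<Longrightarrow> distinguishes L y x"
  unfolding distinguishes_def by metis

lemma distinguishesI: "(f, q) \<in> L \<Longrightarrow> (f x > 0) \<noteq> (f y > 0) \<Longrightarrow> distinguishes L x y"
  unfolding distinguishes_def by blast

lemma distinguishes_mono: "distinguishes L x y \<Longrightarrow> L \<subseteq> L' \<Longrightarrow> distinguishes L' x y"
  unfolding distinguishes_def by blast

end

context separated_space
begin

text \<open>Rational superlevel sets of countably many functions; numbering them along \<open>e\<close> makes every level finite.\<close>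
lemma countable_family:
  assumes G: "G \<subseteq> I" and "countable G"
  shows "\<exists>L. cozero_family X L \<and>
    (\<forall>x\<in>topspace X. \<forall>y\<in>topspace X. (\<exists>s\<in>gen G. h s x \<noteq> h s y) \<longrightarrow> distinguishes L x y)"
proof -
  define C where "C = gen G \<times> (UNIV :: rat set)"
  have cC: "countable C" unfolding C_def using countable_gen[OF assms(2)] by simp
  define f where "f = (\<lambda>(s, c) x. max 0 (h s x - of_rat c))"
  define L where "L = {(f c, e (to_nat_on C c)) | c. c \<in> C}"
  have "cozero_family X L"
    unfolding cozero_family_def
  proof (intro conjI allI impI ballI)
    fix g q assume "(g, q) \<in> L"
    then obtain s c where sc: "g = f (s, c)" "q \<in> A" "s \<in> gen G"
      using e_in by (auto simp: L_def C_def)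
    show "q \<in> A" by fact
    show "0 \<le> g x" for x by (simp add: sc(1) f_def)
    have "s \<in> I" using sc(3) gen_subset[OF G] by blast
    then show "continuous_map X euclideanreal g"
      unfolding sc(1) f_def prod.case
      by (intro continuous_map_real_max continuous_map_diff h_cont) auto
  next
    fix p x assume p: "p \<in> A" and "x \<in> topspace X"
    have "finite (to_nat_on C -` {n. (e n, p) \<in> r} \<inter> C)"
      by (rule finite_vimage_IntI[OF e_finite[OF p] inj_on_to_nat_on[OF cC]])
    then have "finite (f ` (to_nat_on C -` {n. (e n, p) \<in> r} \<inter> C))" by (rule finite_imageI)
    moreover have "{g. \<exists>q. (g, q) \<in> L \<and> (q, p) \<in> r \<and> g x > 0}
        \<subseteq> f ` (to_nat_on C -` {n. (e n, p) \<in> r} \<inter> C)"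
      by (auto simp: L_def)
    ultimately show "finite {g. \<exists>q. (g, q) \<in> L \<and> (q, p) \<in> r \<and> g x > 0}"
      by (rule rev_finite_subset)
  qed
  moreover have "distinguishes L x y" if s: "s \<in> gen G" and less: "h s x < h s y" for x y s
  proof -
    obtain c where c: "h s x < of_rat c" "of_rat c < h s y" using of_rat_dense[OF less] by blast
    have "(f (s, c), e (to_nat_on C (s, c))) \<in> L" using s unfolding L_def C_def by blast
    moreover have "(f (s, c) x > 0) \<noteq> (f (s, c) y > 0)" using c by (simp add: f_def)
    ultimately show ?thesis by (rule distinguishesI)
  qed
  then have "distinguishes L x y" if "s \<in> gen G" "h s x \<noteq> h s y" for x y s
    using that distinguishes_sym by (metis linorder_neq_iff)
  ultimately show ?thesis by (intro exI[of _ L]) auto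
qed

text \<open>Every rectangle needed by a minimal cover separates a point of the old shadow from \<open>x\<close>, hence two
witnesses of the larger stage, so its index has been generated there. Consequently, whether the
functions in \<open>F\<close> are positive at a point can be read off from its representative.\<close>
lemma new_point_piece:
  assumes G: "G \<subseteq> G'" "G' \<subseteq> I" and x: "x \<in> shadow G'" "x \<notin> shadow G"
  shows "\<exists>F. piece (shadow G) (shadow G') F \<and> F \<subseteq> gen G' \<and> (\<forall>s\<in>F. h s x > 0)"
proof -
  have xX: "x \<in> topspace X" using x(1) shadow_topspace by blast
  have comp: "compactin X (shadow G)"
    unfolding shadow_def by (rule closedin_compact_space[OF compact]) simp
  have op: "openin X {u \<in> topspace X. h s u < 0}" if "s \<in> {s \<in> I. h s x > 0}" for s
    by (rule openin_continuous_pos(2)) (use that h_cont in simp)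
  have "shadow G \<subseteq> (\<Union>s\<in>{s \<in> I. h s x > 0}. {u \<in> topspace X. h s u < 0})"
  proof
    fix u assume u: "u \<in> shadow G"
    then have uX: "u \<in> topspace X" using shadow_topspace by blast
    have "x \<noteq> u" using u x(2) by blast
    from h_separates[OF xX uX this] obtain s where "s \<in> I" "h s x > 0" "h s u < 0" by blast
    then show "u \<in> (\<Union>s\<in>{s \<in> I. h s x > 0}. {u \<in> topspace X. h s u < 0})" using uX by blast
  qed
  from compactin_indexed_subcover[OF comp op this] obtain F0 where
    F0: "F0 \<subseteq> {s \<in> I. h s x > 0}" "finite F0" "shadow G \<subseteq> (\<Union>s\<in>F0. {u \<in> topspace X. h s u < 0})"
    by blast
  have cov: "shadow G \<subseteq> (\<Union>s\<in>F0. {u. h s u < 0})" using F0(3) by blast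
  obtain F where F: "F \<subseteq> F0" "shadow G \<subseteq> (\<Union>s\<in>F. {u. h s u < 0})"
    and min: "\<forall>F'. F' \<subset> F \<longrightarrow> \<not> shadow G \<subseteq> (\<Union>s\<in>F'. {u. h s u < 0})"
    using minimal_finite_subset[of F0 "\<lambda>F. shadow G \<subseteq> (\<Union>s\<in>F. {u. h s u < 0})", OF F0(2) cov]
    by blast
  have FI: "F \<subseteq> I" and Fx: "\<And>s. s \<in> F \<Longrightarrow> h s x > 0" using F(1) F0(1) by auto
  have "finite F" using F(1) F0(2) by (rule finite_subset)
  then have "piece (shadow G) (shadow G') F"
    unfolding piece_def using FI F(2) min x(1) Fx by blast
  moreover have "F \<subseteq> gen G'"
  proof
    fix s assume s: "s \<in> F"
    then have sI: "s \<in> I" using FI by blast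
    have "F - {s} \<subset> F" using s by blast
    then have "\<not> shadow G \<subseteq> (\<Union>t\<in>F - {s}. {u. h t u < 0})" using min by blast
    then obtain u where u: "u \<in> shadow G" "h s u < 0" using F(2) by blast
    obtain d' where d': "d' \<in> points (gen G)" "h s d' < 0"
      using shadow_approximate(2)[OF sI u] by blast
    obtain d where d: "d \<in> points (gen G')" "h s d > 0"
      using shadow_approximate(1)[OF sI x(1) Fx[OF s]] by blast
    have "d' \<in> points (gen G')" using d'(1) points_mono[OF gen_mono[OF G(1)]] by blast
    then show "s \<in> gen G'" by (rule gen_closed[OF sI d(1) _ d(2) d'(2)])
  qed
  ultimately show ?thesis using Fx by blast
qed

text \<open>Its cozero set is the intersection of the \<open>{h s > 0}\<close>, \<open>s \<in> F\<close>, by \<open>bump_pos_iff\<close>.\<close>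
definition bump :: "'i set \<Rightarrow> 'a \<Rightarrow> real" where
  "bump F x = (\<Prod>s\<in>F. max 0 (h s x))"

lemma bump_nonneg: "0 \<le> bump F x"
  unfolding bump_def by (rule prod_nonneg) simp

lemma bump_pos_iff:
  assumes "finite F"
  shows "bump F x > 0 \<longleftrightarrow> (\<forall>s\<in>F. h s x > 0)"
proof
  assume pos: "bump F x > 0"
  show "\<forall>s\<in>F. h s x > 0"
  proof
    fix s assume s: "s \<in> F"
    show "h s x > 0"
    proof (rule ccontr)
      assume "\<not> h s x > 0"
      then have "max 0 (h s x) = 0" by simp
      then have "bump F x = 0" unfolding bump_def by (intro prod_zero assms bexI[OF _ s])
      then show False using pos by simp
    qed
  qed
qed (simp add: bump_def prod_pos)

lemma bump_cont:
  assumes "finite F" "F \<subseteq> I"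
  shows "continuous_map X euclideanreal (bump F)"
proof -
  have "continuous_map X euclideanreal (\<lambda>x. \<Prod>s\<in>F. max 0 (h s x))"
    by (intro continuous_map_prod assms(1) continuous_map_real_max h_cont) (use assms(2) in auto)
  then show ?thesis by (simp add: bump_def[abs_def])
qed

text \<open>Well-order \<open>G\<close> by its cardinal, so that initial segments are smaller. The functions \<open>bump F\<close> for
pieces \<open>F\<close> of any stage, and their products with the functions available for the closed initial segment, have the
required finiteness by \<open>finite_pieces\<close>. Points \<open>x\<close>, \<open>y\<close> first told apart at stage \<open>\<xi>\<close> have representatives
in the new shadow that cannot both be old, since the old indices separate old points; the
\<open>F\<close> belonging to a new representative either distinguishes \<open>x\<close> and \<open>y\<close> or contains both in its
cozero set, and then a product does.\<close>
lemma uncountable_family: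
  assumes G: "G \<subseteq> I" and unc: "uncountable G"
    and IH: "\<And>G'. (card_of G', card_of G) \<in> ordLess \<Longrightarrow> G' \<subseteq> I \<Longrightarrow> \<exists>L. cozero_family X L \<and>
      (\<forall>x\<in>topspace X. \<forall>y\<in>topspace X. (\<exists>s\<in>gen G'. h s x \<noteq> h s y) \<longrightarrow> distinguishes L x y)"
  shows "\<exists>L. cozero_family X L \<and>
    (\<forall>x\<in>topspace X. \<forall>y\<in>topspace X. (\<exists>s\<in>gen G. h s x \<noteq> h s y) \<longrightarrow> distinguishes L x y)"
proof -
  define w where "w = card_of G"
  have wo: "well_order_on G w" unfolding w_def by (rule card_of_well_order_on)
  have refl: "(\<xi>, \<xi>) \<in> w" if "\<xi> \<in> G" for \<xi>
    using wo that by (auto simp: order_on_defs dest: refl_onD)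
  have trans: "trans w" and anti: "antisym w" and tot: "total_on G w"
    using wo by (auto simp: order_on_defs)
  have Field: "Field w = G" unfolding w_def by (rule Field_card_of)
  have card: "Card_order w" unfolding w_def by (rule card_of_Card_order)
  have inf: "infinite G" using unc countable_finite by blast
  define lower upper where "lower = underS w" and "upper = under w"
  have lower_upper: "lower \<xi> \<subseteq> upper \<xi>" for \<xi> unfolding lower_def upper_def underS_def under_def by blast
  have upperG: "upper \<xi> \<subseteq> G" for \<xi> using under_Field[of w \<xi>] Field unfolding upper_def by blast
  have lowerG: "lower \<xi> \<subseteq> G" for \<xi> using lower_upper upperG by blast
  have upper_lower: "upper \<xi> \<subseteq> lower \<zeta>" if "(\<xi>, \<zeta>) \<in> w" "\<xi> \<noteq> \<zeta>" for \<xi> \<zeta>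
  proof
    fix t assume "t \<in> upper \<xi>"
    then have "(t, \<xi>) \<in> w" by (simp add: upper_def under_def)
    then have "(t, \<zeta>) \<in> w" "t \<noteq> \<zeta>" using that trans anti by (auto dest: transD antisymD)
    then show "t \<in> lower \<zeta>" by (simp add: lower_def underS_def)
  qed
  \<comment> \<open>A cardinal is a limit, so a closed initial segment lies in an open one.\<close>
  have small: "(card_of (upper \<xi>), card_of G) \<in> ordLess" if \<xi>: "\<xi> \<in> G" for \<xi>
  proof -
    obtain \<zeta> where \<zeta>: "\<zeta> \<in> Field w" "\<xi> \<noteq> \<zeta>" "(\<xi>, \<zeta>) \<in> w"
      using infinite_Card_order_limit[OF card] inf \<xi> Field by auto
    have "(card_of (upper \<xi>), card_of (lower \<zeta>)) \<in> ordLeq"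
      by (rule card_of_mono1[OF upper_lower[OF \<zeta>(3,2)]])
    moreover have "(card_of (lower \<zeta>), w) \<in> ordLess"
      unfolding lower_def by (rule card_of_underS[OF card \<zeta>(1)])
    ultimately show ?thesis unfolding w_def by (rule ordLeq_ordLess_trans)
  qed
  have "\<forall>\<xi>\<in>G. \<exists>L. cozero_family X L \<and> (\<forall>x\<in>topspace X. \<forall>y\<in>topspace X.
      (\<exists>s\<in>gen (upper \<xi>). h s x \<noteq> h s y) \<longrightarrow> distinguishes L x y)"
    using IH[OF small] upperG G by blast
  from bchoice[OF this] obtain Lu where Lu: "\<forall>\<xi>\<in>G. cozero_family X (Lu \<xi>) \<and>
      (\<forall>x\<in>topspace X. \<forall>y\<in>topspace X. (\<exists>s\<in>gen (upper \<xi>). h s x \<noteq> h s y) \<longrightarrow> distinguishes (Lu \<xi>) x y)" ..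
  have Lu_fam: "cozero_family X (Lu \<xi>)" if "\<xi> \<in> G" for \<xi> using Lu that by simp
  obtain L0 where L0: "cozero_family X L0" "\<forall>x\<in>topspace X. \<forall>y\<in>topspace X.
      (\<exists>s\<in>gen {}. h s x \<noteq> h s y) \<longrightarrow> distinguishes L0 x y"
    using countable_family[of "{}"] by auto
  define new where "new = (\<lambda>\<xi>. piece (shadow (lower \<xi>)) (shadow (upper \<xi>)))"
  have newD: "finite F" "F \<subseteq> I" if "new \<xi> F" for \<xi> F using that by (auto simp: new_def piece_def)
  \<comment> \<open>The term \<open>e (card F)\<close> bounds the size of the pieces at each level, as \<open>finite_pieces\<close> requires.\<close>
  define above where "above = (\<lambda>F q. q \<in> A \<and> (\<forall>s\<in>F. (\<iota> s, q) \<in> r) \<and> (e (card F), q) \<in> r)"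
  define L1 where "L1 = {(bump F, q) | \<xi> F q. \<xi> \<in> G \<and> new \<xi> F \<and> above F q}"
  define L2 where "L2 = {(\<lambda>x. bump F x * g x, q) | \<xi> F q g q0.
      \<xi> \<in> G \<and> new \<xi> F \<and> above F q \<and> (g, q0) \<in> Lu \<xi> \<and> (q0, q) \<in> r}"
  have "cozero_family X (L0 \<union> L1 \<union> L2)"
    unfolding cozero_family_def
  proof (intro conjI allI impI ballI)
    fix f q assume "(f, q) \<in> L0 \<union> L1 \<union> L2"
    then consider "(f, q) \<in> L0" | "(f, q) \<in> L1" | "(f, q) \<in> L2" by blast
    then have "continuous_map X euclideanreal f \<and> (\<forall>x\<in>topspace X. 0 \<le> f x) \<and> q \<in> A"
    proof cases
      case 1
      then show ?thesis using cozero_familyD[OF L0(1)] by blast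
    next
      case 2
      then obtain \<xi> F where F: "f = bump F" "new \<xi> F" "above F q" unfolding L1_def by blast
      then show ?thesis using bump_cont[OF newD[OF F(2)]] bump_nonneg by (simp add: above_def)
    next
      case 3
      then obtain \<xi> F g q0 where F: "f = (\<lambda>x. bump F x * g x)" "\<xi> \<in> G" "new \<xi> F" "above F q"
        "(g, q0) \<in> Lu \<xi>" unfolding L2_def by blast
      have "continuous_map X euclideanreal f"
        unfolding F(1) using bump_cont[OF newD[OF F(3)]] cozero_familyD(1)[OF Lu_fam[OF F(2)] F(5)]
        by (rule continuous_map_real_mult)
      moreover have "0 \<le> f x" if "x \<in> topspace X" for x
        unfolding F(1) using bump_nonneg cozero_familyD(2)[OF Lu_fam[OF F(2)] F(5) that]
        by (rule mult_nonneg_nonneg)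
      ultimately show ?thesis using F(4) by (simp add: above_def)
    qed
    then show "continuous_map X euclideanreal f" "q \<in> A" "\<And>x. x \<in> topspace X \<Longrightarrow> 0 \<le> f x" by blast+
  next
    fix p x assume p: "p \<in> A" and x: "x \<in> topspace X"
    obtain N where N: "\<And>n. (e n, p) \<in> r \<Longrightarrow> n \<le> N"
      using e_finite[OF p] by (auto simp: finite_nat_set_iff_bounded_le)
    let ?Q = "{(\<xi>, F). \<xi> \<in> G \<and> piece (shadow (lower \<xi>)) (shadow (upper \<xi>)) F \<and> card F \<le> N \<and>
        (\<forall>s\<in>F. (\<iota> s, p) \<in> r \<and> h s x > 0)}"
    have finQ: "finite ?Q"
    proof (rule finite_pieces[OF _ shadow_topspace x p])
      fix Z assume Z: "Z \<subseteq> G" "Z \<noteq> {}"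
      obtain \<xi> where \<xi>: "\<xi> \<in> Z" "\<forall>\<zeta>\<in>Z. (\<xi>, \<zeta>) \<in> w" using well_order_on_least[OF wo Z] by blast
      have "\<forall>\<zeta>\<in>Z. \<zeta> \<noteq> \<xi> \<longrightarrow> shadow (upper \<xi>) \<subseteq> shadow (lower \<zeta>)"
        using \<xi>(2) by (intro ballI impI shadow_mono upper_lower) auto
      then show "\<exists>\<xi>\<in>Z. \<forall>\<zeta>\<in>Z. \<zeta> \<noteq> \<xi> \<longrightarrow> shadow (upper \<xi>) \<subseteq> shadow (lower \<zeta>)" using \<xi>(1) by blast
    qed
    have inQ: "(\<xi>, F) \<in> ?Q" if "\<xi> \<in> G" "new \<xi> F" "above F q" "(q, p) \<in> r" "bump F x > 0" for \<xi> F q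
      using that newD(1)[OF that(2)] le_trans[OF _ that(4)] N
      by (auto simp: new_def above_def bump_pos_iff)
    define S where "S = (\<lambda>\<xi>. {g. \<exists>q. (g, q) \<in> Lu \<xi> \<and> (q, p) \<in> r \<and> g x > 0})"
    have finS: "finite (S \<xi>)" if "\<xi> \<in> G" for \<xi>
      unfolding S_def by (rule cozero_familyD(4)[OF Lu_fam[OF that] p x])
    let ?T = "{f. \<exists>q. (f, q) \<in> L0 \<and> (q, p) \<in> r \<and> f x > 0} \<union> (\<lambda>c. bump (snd c)) ` ?Q \<union>
      (\<Union>c\<in>?Q. (\<lambda>g z. bump (snd c) z * g z) ` S (fst c))"
    have "finite ?T"
    proof (intro finite_UnI finite_imageI finite_UN_I finQ)
      show "finite {f. \<exists>q. (f, q) \<in> L0 \<and> (q, p) \<in> r \<and> f x > 0}"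
        by (rule cozero_familyD(4)[OF L0(1) p x])
      show "finite (S (fst c))" if "c \<in> ?Q" for c using that by (intro finS) auto
    qed
    moreover have "{f. \<exists>q. (f, q) \<in> L0 \<union> L1 \<union> L2 \<and> (q, p) \<in> r \<and> f x > 0} \<subseteq> ?T"
    proof
      fix f assume "f \<in> {f. \<exists>q. (f, q) \<in> L0 \<union> L1 \<union> L2 \<and> (q, p) \<in> r \<and> f x > 0}"
      then obtain q where q: "(f, q) \<in> L0 \<union> L1 \<union> L2" "(q, p) \<in> r" "f x > 0" by blast
      then consider "(f, q) \<in> L0" | "(f, q) \<in> L1" | "(f, q) \<in> L2" by blast
      then show "f \<in> ?T"
      proof cases
        case 1
        then show ?thesis using q by blast
      next
        case 2
        then obtain \<xi> F where F: "f = bump F" "\<xi> \<in> G" "new \<xi> F" "above F q" unfolding L1_def by blast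
        have "(\<xi>, F) \<in> ?Q" by (rule inQ[OF F(2-4) q(2)]) (use q(3) F(1) in simp)
        then have "f \<in> (\<lambda>c. bump (snd c)) ` ?Q" by (rule rev_image_eqI) (simp add: F(1))
        then show ?thesis by (intro UnI1 UnI2)
      next
        case 3
        then obtain \<xi> F g q0 where F: "f = (\<lambda>x. bump F x * g x)" "\<xi> \<in> G" "new \<xi> F" "above F q"
          "(g, q0) \<in> Lu \<xi>" "(q0, q) \<in> r" unfolding L2_def by blast
        have "bump F x * g x > 0" using q(3) F(1) by simp
        moreover have "0 \<le> g x" by (rule cozero_familyD(2)[OF Lu_fam[OF F(2)] F(5) x])
        ultimately have pos: "bump F x > 0" "g x > 0"
          using bump_nonneg[of F x] by (auto simp: zero_less_mult_iff)
        have cQ: "(\<xi>, F) \<in> ?Q" by (rule inQ[OF F(2-4) q(2) pos(1)])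
        have "g \<in> S \<xi>" unfolding S_def using F(5) le_trans[OF F(6) q(2)] pos(2) by blast
        then have "f \<in> (\<lambda>g z. bump (snd (\<xi>, F)) z * g z) ` S (fst (\<xi>, F))"
          unfolding F(1) fst_conv snd_conv by (rule imageI)
        then have "f \<in> (\<Union>c\<in>?Q. (\<lambda>g z. bump (snd c) z * g z) ` S (fst c))" by (rule UN_I[OF cQ])
        then show ?thesis by (rule UnI2)
      qed
    qed
    ultimately show "finite {f. \<exists>q. (f, q) \<in> L0 \<union> L1 \<union> L2 \<and> (q, p) \<in> r \<and> f x > 0}"
      by (rule rev_finite_subset)
  qed
  moreover have "distinguishes (L0 \<union> L1 \<union> L2) x y"
    if x: "x \<in> topspace X" and y: "y \<in> topspace X" and s: "s \<in> gen G" "h s x \<noteq> h s y" for x y s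
  proof (cases "\<exists>t\<in>gen {}. h t x \<noteq> h t y")
    case True
    then have "distinguishes L0 x y" by (rule mp[OF bspec[OF bspec[OF L0(2) x] y]])
    then show ?thesis by (rule distinguishes_mono) blast
  next
    case False
    have max: "\<exists>\<xi>\<in>G0. t \<in> gen (upper \<xi>)"
      if t: "t \<in> gen G0" "finite G0" "G0 \<noteq> {}" "G0 \<subseteq> G" for t G0
    proof -
      have "\<exists>\<xi>\<in>G0. \<forall>\<zeta>\<in>G0. (\<zeta>, \<xi>) \<in> w"
        using t(2-4)
      proof (induction G0 rule: finite_ne_induct)
        case (singleton \<zeta>)
        then show ?case using refl by simp
      next
        case (insert \<zeta> G0)
        then obtain \<xi> where \<xi>: "\<xi> \<in> G0" "\<forall>\<eta>\<in>G0. (\<eta>, \<xi>) \<in> w" by auto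
        have "\<zeta> \<in> G" "\<xi> \<in> G" using insert.prems \<xi>(1) by auto
        then have "(\<zeta>, \<xi>) \<in> w \<or> (\<xi>, \<zeta>) \<in> w" using tot refl unfolding total_on_def by metis
        then show ?case
        proof
          assume "(\<zeta>, \<xi>) \<in> w"
          then show ?thesis using \<xi> by auto
        next
          assume "(\<xi>, \<zeta>) \<in> w"
          then have "\<forall>\<eta>\<in>G0. (\<eta>, \<zeta>) \<in> w" using \<xi>(2) trans by (meson transD)
          then show ?thesis using refl[OF \<open>\<zeta> \<in> G\<close>] by auto
        qed
      qed
      then obtain \<xi> where \<xi>: "\<xi> \<in> G0" "\<forall>\<zeta>\<in>G0. (\<zeta>, \<xi>) \<in> w" by blast
      have "G0 \<subseteq> upper \<xi>" using \<xi>(2) by (auto simp: upper_def under_def)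
      then have "t \<in> gen (upper \<xi>)" using t(1) gen_mono by blast
      then show ?thesis using \<xi>(1) by blast
    qed
    let ?Z = "{\<xi> \<in> G. \<exists>t\<in>gen (upper \<xi>). h t x \<noteq> h t y}"
    obtain G0 where G0: "G0 \<subseteq> G" "finite G0" "s \<in> gen G0" using gen_finitary[OF s(1)] by blast
    have "G0 \<noteq> {}" using False G0(3) s(2) by auto
    then obtain \<xi>0 where "\<xi>0 \<in> G0" "s \<in> gen (upper \<xi>0)" using max[OF G0(3,2) _ G0(1)] by blast
    then have "\<xi>0 \<in> ?Z" using G0(1) s(2) by blast
    then have "?Z \<noteq> {}" by blast
    moreover have "?Z \<subseteq> G" by blast
    ultimately obtain \<xi> where \<xi>: "\<xi> \<in> ?Z" "\<forall>\<zeta>\<in>?Z. (\<xi>, \<zeta>) \<in> w"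
      using well_order_on_least[OF wo, of ?Z] by blast
    then obtain t where t: "t \<in> gen (upper \<xi>)" "h t x \<noteq> h t y" and \<xi>G: "\<xi> \<in> G" by blast
    have agree: "h u x = h u y" if u: "u \<in> gen (lower \<xi>)" for u
    proof (rule ccontr)
      assume neq: "h u x \<noteq> h u y"
      obtain G1 where G1: "G1 \<subseteq> lower \<xi>" "finite G1" "u \<in> gen G1" using gen_finitary[OF u] by blast
      have "G1 \<noteq> {}" using False G1(3) neq by auto
      moreover have "G1 \<subseteq> G" using G1(1) lowerG by blast
      ultimately obtain \<zeta> where \<zeta>: "\<zeta> \<in> G1" "u \<in> gen (upper \<zeta>)" using max[OF G1(3,2)] by blast
      then have "\<zeta> \<in> ?Z" using neq \<open>G1 \<subseteq> G\<close> by blast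
      then have "(\<xi>, \<zeta>) \<in> w" using \<xi>(2) by blast
      moreover have "\<zeta> \<noteq> \<xi>" "(\<zeta>, \<xi>) \<in> w" using \<zeta>(1) G1(1) by (auto simp: lower_def underS_def)
      ultimately show False using anti by (auto dest: antisymD)
    qed
    have upI: "upper \<xi> \<subseteq> I" using upperG G by blast
    obtain x' where x': "x' \<in> shadow (upper \<xi>)" "\<forall>u\<in>gen (upper \<xi>). h u x' = h u x"
      using shadow_represents[OF upI x] by blast
    obtain y' where y': "y' \<in> shadow (upper \<xi>)" "\<forall>u\<in>gen (upper \<xi>). h u y' = h u y"
      using shadow_represents[OF upI y] by blast
    have split: "distinguishes (L0 \<union> L1 \<union> L2) z z'"
      if z: "z \<in> topspace X" "z' \<in> topspace X" "h t z \<noteq> h t z'"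
        and zz: "z1 \<in> shadow (upper \<xi>)" "\<forall>u\<in>gen (upper \<xi>). h u z1 = h u z" "z1 \<notin> shadow (lower \<xi>)"
      for z z' z1
    proof -
      obtain F where F: "new \<xi> F" "F \<subseteq> gen (upper \<xi>)" "\<forall>s\<in>F. h s z1 > 0"
        using new_point_piece[OF lower_upper upI zz(1,3)] unfolding new_def by blast
      have "h s z > 0" if "s \<in> F" for s
      proof -
        have "s \<in> gen (upper \<xi>)" using F(2) that by blast
        then have "h s z1 = h s z" by (rule bspec[OF zz(2)])
        then show ?thesis using F(3) that by force
      qed
      then have Fz: "bump F z > 0" using newD(1)[OF F(1)] by (simp add: bump_pos_iff)
      have "\<exists>s\<in>gen (upper \<xi>). h s z \<noteq> h s z'" using t(1) z(3) by (rule bexI[rotated])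
      then have "distinguishes (Lu \<xi>) z z'"
        by (rule mp[OF bspec[OF bspec[OF conjunct2[OF bspec[OF Lu \<xi>G]] z(1)] z(2)]])
      then obtain g q0 where g: "(g, q0) \<in> Lu \<xi>" "(g z > 0) \<noteq> (g z' > 0)"
        unfolding distinguishes_def by blast
      have q0: "q0 \<in> A" by (rule cozero_familyD(3)[OF Lu_fam[OF \<xi>G] g(1)])
      have "insert q0 (insert (e (card F)) (\<iota> ` F)) \<subseteq> A"
        using q0 e_in label_in newD(2)[OF F(1)] by auto
      then obtain q where q: "q \<in> A" "\<forall>p\<in>insert q0 (insert (e (card F)) (\<iota> ` F)). (p, q) \<in> r"
        using upper_bound[of "insert q0 (insert (e (card F)) (\<iota> ` F))"] newD(1)[OF F(1)] by auto
      then have ab: "above F q" "(q0, q) \<in> r" by (auto simp: above_def)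
      show ?thesis
      proof (cases "bump F z' > 0")
        case True
        have "(\<lambda>u. bump F u * g u, q) \<in> L2" unfolding L2_def using \<xi>G F(1) ab g(1) by blast
        moreover have "(bump F z * g z > 0) \<noteq> (bump F z' * g z' > 0)"
          using g(2) True Fz by (simp add: zero_less_mult_iff)
        ultimately show ?thesis by (intro distinguishesI[of "\<lambda>u. bump F u * g u" q]) auto
      next
        case False
        have "(bump F, q) \<in> L1" unfolding L1_def using \<xi>G F(1) ab(1) by blast
        then show ?thesis using Fz False by (intro distinguishesI[of "bump F" q]) auto
      qed
    qed
    have "x' \<notin> shadow (lower \<xi>) \<or> y' \<notin> shadow (lower \<xi>)"
    proof (rule ccontr)
      assume "\<not> ?thesis"
      moreover have "x' \<noteq> y'" using x'(2) y'(2) t by metis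
      ultimately obtain u where u: "u \<in> gen (lower \<xi>)" "h u x' \<noteq> h u y'"
        using shadow_separated by blast
      have "u \<in> gen (upper \<xi>)" using u(1) gen_mono[OF lower_upper] by blast
      then show False using u agree[OF u(1)] x'(2) y'(2) by simp
    qed
    then show ?thesis
    proof
      assume "x' \<notin> shadow (lower \<xi>)"
      then show ?thesis by (rule split[OF x y t(2) x'])
    next
      assume "y' \<notin> shadow (lower \<xi>)"
      then have "distinguishes (L0 \<union> L1 \<union> L2) y x" by (rule split[OF y x t(2)[symmetric] y'])
      then show ?thesis by (rule distinguishes_sym)
    qed
  qed
  ultimately show ?thesis by (intro exI[of _ "L0 \<union> L1 \<union> L2"]) auto
qed

lemma generated_family:
  assumes "G \<subseteq> I"
  shows "\<exists>L. cozero_family X L \<and>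
    (\<forall>x\<in>topspace X. \<forall>y\<in>topspace X. (\<exists>s\<in>gen G. h s x \<noteq> h s y) \<longrightarrow> distinguishes L x y)"
  using assms
proof (induction G rule: wf_induct_rule[OF wf_inv_image[OF wf_ordLess, of card_of]])
  case (1 G)
  show ?case
  proof (cases "countable G")
    case True
    then show ?thesis using countable_family 1(2) by blast
  next
    case False
    show ?thesis
    proof (rule uncountable_family[OF 1(2) False])
      fix G' assume "(card_of G', card_of G) \<in> ordLess" "G' \<subseteq> I"
      then show "\<exists>L. cozero_family X L \<and> (\<forall>x\<in>topspace X. \<forall>y\<in>topspace X.
          (\<exists>s\<in>gen G'. h s x \<noteq> h s y) \<longrightarrow> distinguishes L x y)"
        by (intro 1(1)) simp_all
    qed
  qed
qed

lemma distinguishing_family: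
  "\<exists>L. cozero_family X L \<and> (\<forall>x\<in>topspace X. \<forall>y\<in>topspace X. x \<noteq> y \<longrightarrow> distinguishes L x y)"
proof -
  have "\<exists>s\<in>gen I. h s x \<noteq> h s y" if xy: "x \<in> topspace X" "y \<in> topspace X" "x \<noteq> y" for x y
  proof -
    obtain s where "s \<in> I" "h s x > 0" "h s y < 0" using h_separates[OF xy] by blast
    then show ?thesis using subset_gen[of I] by (intro bexI[of _ s]) auto
  qed
  then show ?thesis using generated_family[OF order_refl] by meson
qed

end

section \<open>From distinguishing functions to an almost subbase\<close>

lemma zero_set_superlevel:
  assumes "continuous_map X euclideanreal f"
  shows "zero_set X {x \<in> topspace X. a \<le> f x}"
proof -
  let ?g = "\<lambda>x. min 1 (max 0 (a - f x))"
  have "continuous_map X euclideanreal ?g"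
    by (intro continuous_map_real_min continuous_map_real_max continuous_map_diff assms) auto
  then have "continuous_map X (top_of_set {0..1}) ?g"
    by (auto simp: continuous_map_in_subtopology)
  moreover have "{x \<in> topspace X. a \<le> f x} = {x \<in> topspace X. ?g x = 0}"
    by (auto simp: min_def max_def)
  ultimately show ?thesis unfolding zero_set_def by (intro exI[of _ ?g]) simp
qed

lemma cozero_set_superlevel:
  assumes "continuous_map X euclideanreal f"
  shows "cozero_set X {x \<in> topspace X. a < f x}"
proof -
  let ?g = "\<lambda>x. min 1 (max 0 (f x - a))"
  have "continuous_map X euclideanreal ?g"
    by (intro continuous_map_real_min continuous_map_real_max continuous_map_diff assms) auto
  then have "continuous_map X (top_of_set {0..1}) ?g"
    by (auto simp: continuous_map_in_subtopology)
  moreover have "{x \<in> topspace X. a < f x} = {x \<in> topspace X. ?g x \<noteq> 0}"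
    by (auto simp: min_def max_def)
  ultimately show ?thesis unfolding cozero_set_def by (intro exI[of _ ?g]) simp
qed

lemma openin_superlevel:
  "continuous_map X euclideanreal f \<Longrightarrow> openin X {x \<in> topspace X. a < f x}"
  using openin_continuous_map_preimage[of X euclideanreal f "{a<..}"] by simp

text \<open>The sets \<open>{f \<ge> a + 1/n}\<close> for odd \<open>n\<close>, which are zero sets, and \<open>{f > a + 1/n}\<close> for even \<open>n\<close>, which are
cozero sets, increase to \<open>{f > a}\<close>.\<close>
definition superlevel_rep :: "'a topology \<Rightarrow> ('a \<Rightarrow> real) \<Rightarrow> real \<Rightarrow> nat \<Rightarrow> 'a set" where
  "superlevel_rep X f a n =
     {x \<in> topspace X. if odd n then a + 1 / real n \<le> f x else a + 1 / real n < f x}"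

lemma U_representation_superlevel:
  assumes "continuous_map X euclideanreal f"
  shows "U_representation X {x \<in> topspace X. a < f x} (superlevel_rep X f a)"
  unfolding U_representation_def
proof (intro conjI allI impI)
  show "{x \<in> topspace X. a < f x} = (\<Union>n\<in>{1..}. superlevel_rep X f a n)"
  proof (intro equalityI subsetI)
    fix x assume x: "x \<in> {x \<in> topspace X. a < f x}"
    then have "0 < f x - a" by simp
    then obtain n where n: "1 / real (Suc n) < f x - a" using nat_approx_posE by blast
    then have "a + 1 / real (Suc n) < f x" by linarith
    then have "x \<in> superlevel_rep X f a (Suc n)" using x by (simp add: superlevel_rep_def)
    then show "x \<in> (\<Union>n\<in>{1..}. superlevel_rep X f a n)" by (intro UN_I[of "Suc n"]) simp_all
  next
    fix x assume "x \<in> (\<Union>n\<in>{1..}. superlevel_rep X f a n)"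
    then obtain n where n: "n \<ge> 1" "x \<in> superlevel_rep X f a n" by blast
    then have "a + 1 / real n \<le> f x" "x \<in> topspace X"
      by (auto simp: superlevel_rep_def split: if_splits)
    moreover have "0 < 1 / real n" using n(1) by simp
    ultimately have "x \<in> topspace X" "a < f x" by linarith+
    then show "x \<in> {x \<in> topspace X. a < f x}" by simp
  qed
  fix n :: nat assume n: "1 \<le> n"
  have less: "1 / real (n + 1) < 1 / real n" using n by (simp add: frac_less2)
  show "superlevel_rep X f a n \<subseteq> superlevel_rep X f a (n + 1)"
  proof
    fix x assume "x \<in> superlevel_rep X f a n"
    then have "a + 1 / real n \<le> f x" "x \<in> topspace X"
      by (auto simp: superlevel_rep_def split: if_splits)
    then have "a + 1 / real (n + 1) < f x" "x \<in> topspace X" using less by linarith+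
    then show "x \<in> superlevel_rep X f a (n + 1)" by (simp add: superlevel_rep_def)
  qed
  have "odd (2 * n - 1)" using n by presburger
  then show "zero_set X (superlevel_rep X f a (2 * n - 1))"
    using zero_set_superlevel[OF assms] by (simp add: superlevel_rep_def)
  show "cozero_set X (superlevel_rep X f a (2 * n))"
    using cozero_set_superlevel[OF assms] by (simp add: superlevel_rep_def)
qed

lemma openin_cozero_set: "cozero_set X C \<Longrightarrow> openin X C"
proof -
  assume "cozero_set X C"
  then obtain f :: "'a \<Rightarrow> real" where f: "continuous_map X (top_of_set {0..1}) f"
    and C: "C = {x \<in> topspace X. f x \<noteq> 0}" unfolding cozero_set_def by blast
  have "continuous_map X euclideanreal f" using f by (simp add: continuous_map_in_subtopology)
  then have "openin X {x \<in> topspace X. f x \<in> - {0}}"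
    by (rule openin_continuous_map_preimage) auto
  then show "openin X C" using C by simp
qed

text \<open>A Hausdorff topology coarser than a compact one is equal to it; the argument is carried out on the
subbase: cover the complement of a neighbourhood of \<open>x\<close> by finitely many members that avoid members containing \<open>x\<close>.\<close>
lemma subbase_of_compactI:
  assumes comp: "compact_space X" and op: "\<And>S. S \<in> \<S> \<Longrightarrow> openin X S"
    and sep: "\<And>x y. x \<in> topspace X \<Longrightarrow> y \<in> topspace X \<Longrightarrow> x \<noteq> y \<Longrightarrow>
      \<exists>S T. S \<in> \<S> \<and> T \<in> \<S> \<and> x \<in> S \<and> y \<in> T \<and> S \<inter> T = {}"
  shows "subbase_of X \<S>"
  unfolding subbase_of_iff
proof
  show "\<S> \<subseteq> Pow (topspace X)" using op openin_subset by blast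
  let ?\<B> = "{topspace X \<inter> \<Inter>\<E> | \<E>. finite \<E> \<and> \<E> \<subseteq> \<S>}"
  have opB: "openin X b" if b: "b \<in> ?\<B>" for b
  proof -
    obtain \<E> where \<E>: "b = topspace X \<inter> \<Inter>\<E>" "finite \<E>" "\<E> \<subseteq> \<S>" using b by blast
    then show ?thesis using op by (auto intro!: openin_Int_Inter)
  qed
  have nbh: "\<exists>b\<in>?\<B>. x \<in> b \<and> b \<subseteq> G" if G: "openin X G" "x \<in> G" for x G
  proof -
    have x: "x \<in> topspace X" using G openin_subset by blast
    have "\<forall>y\<in>topspace X - G. \<exists>c. fst c \<in> \<S> \<and> snd c \<in> \<S> \<and> x \<in> fst c \<and> y \<in> snd c \<and>
        fst c \<inter> snd c = {}"
    proof
      fix y assume y: "y \<in> topspace X - G"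
      then have "x \<noteq> y" using G(2) by blast
      then obtain S T where "S \<in> \<S> \<and> T \<in> \<S> \<and> x \<in> S \<and> y \<in> T \<and> S \<inter> T = {}"
        using sep[OF x] y by blast
      then show "\<exists>c. fst c \<in> \<S> \<and> snd c \<in> \<S> \<and> x \<in> fst c \<and> y \<in> snd c \<and> fst c \<inter> snd c = {}"
        by (intro exI[of _ "(S, T)"]) simp
    qed
    from bchoice[OF this] obtain c where c: "\<forall>y\<in>topspace X - G. fst (c y) \<in> \<S> \<and> snd (c y) \<in> \<S> \<and>
        x \<in> fst (c y) \<and> y \<in> snd (c y) \<and> fst (c y) \<inter> snd (c y) = {}" ..
    have comp': "compactin X (topspace X - G)"
      by (intro closedin_compact_space[OF comp] closedin_diff closedin_topspace G(1))
    have "\<exists>F\<subseteq>topspace X - G. finite F \<and> topspace X - G \<subseteq> (\<Union>y\<in>F. snd (c y))"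
      by (rule compactin_indexed_subcover[OF comp']) (use c op in auto)
    then obtain F where F: "F \<subseteq> topspace X - G" "finite F" "topspace X - G \<subseteq> (\<Union>y\<in>F. snd (c y))"
      by blast
    have cF: "fst (c y) \<in> \<S>" "x \<in> fst (c y)" "fst (c y) \<inter> snd (c y) = {}" if "y \<in> F" for y
      using c F(1) that by auto
    let ?b = "topspace X \<inter> \<Inter>((fst \<circ> c) ` F)"
    have sub: "?b \<subseteq> G"
    proof
      fix z assume z: "z \<in> ?b"
      show "z \<in> G"
      proof (rule ccontr)
        assume "z \<notin> G"
        then obtain y where y: "y \<in> F" "z \<in> snd (c y)" using F(3) z by blast
        have "z \<in> fst (c y)" using z y(1) by auto
        then show False using cF(3)[OF y(1)] y(2) by blast
      qed
    qed
    have xb: "x \<in> ?b" using x cF(2) by auto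
    have "(fst \<circ> c) ` F \<subseteq> \<S>" using cF(1) by auto
    then have bB: "?b \<in> ?\<B>" using F(2) by blast
    show ?thesis by (rule bexI[OF _ bB]) (rule conjI[OF xb sub])
  qed
  show "base_of X ?\<B>"
    unfolding base_of_iff
  proof (intro allI iffI ballI)
    fix G x assume "openin X G" "x \<in> G"
    then show "\<exists>b\<in>?\<B>. x \<in> b \<and> b \<subseteq> G" by (rule nbh)
  next
    fix G assume G: "\<forall>x\<in>G. \<exists>b\<in>?\<B>. x \<in> b \<and> b \<subseteq> G"
    have "\<exists>T. openin X T \<and> x \<in> T \<and> T \<subseteq> G" if "x \<in> G" for x
      using bspec[OF G that] opB by blast
    then show "openin X G" by (subst openin_subopen) blast
  qed
qed

context level_set
begin

text \<open>The almost subbase consists of the sets \<open>{f > c k}\<close>, where \<open>c\<close> enumerates the nonnegative rationals and \<open>e k\<close>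
bounds \<open>k\<close> at each level. If \<open>f x > 0\<close> and \<open>f y = 0\<close>, choose \<open>0 < c k < c l < f x\<close>; the compact set
\<open>{f \<ge> c l}\<close> lies in a single zero set of the chosen representation of \<open>{f > c k}\<close>, so \<open>{f > c l}\<close> and
the complement of that zero set are disjoint members containing \<open>x\<close> and \<open>y\<close>.\<close>
lemma cozero_family_imp_almost_subbase:
  assumes comp: "compact_space X" and fam: "cozero_family X L"
    and dis: "\<forall>x\<in>topspace X. \<forall>y\<in>topspace X. x \<noteq> y \<longrightarrow> distinguishes L x y"
  shows "has_point_finite_almost_subbase A r X"
proof -
  note famD = cozero_familyD[OF fam]
  define c where "c = (\<lambda>k. \<bar>real_of_rat (nat_to_rat_surj k)\<bar>)"
  have c0: "0 \<le> c k" for k by (simp add: c_def)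
  have dense: "\<exists>k. a < c k \<and> c k < b" if ab: "0 \<le> a" "a < b" for a b
  proof -
    obtain u where u: "a < of_rat u" "of_rat u < b" using of_rat_dense[OF ab(2)] by blast
    obtain k where "nat_to_rat_surj k = u" using surj_nat_to_rat_surj by (metis surjD)
    moreover have "0 < real_of_rat u" using u(1) ab(1) by linarith
    ultimately have "c k = of_rat u" unfolding c_def by (metis abs_of_pos)
    then show ?thesis using u by (intro exI[of _ k]) simp
  qed
  define cut where "cut = (\<lambda>f k. {x \<in> topspace X. c k < f x})"
  define \<alpha>p where "\<alpha>p = (\<lambda>p. {cut f k | f k. (\<exists>q. (f, q) \<in> L \<and> (q, p) \<in> r) \<and> (e k, p) \<in> r})"
  define \<alpha> where "\<alpha> = (\<Union>p\<in>A. \<alpha>p p)"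
  have cut_in: "cut f k \<in> \<alpha>" if fq: "(f, q) \<in> L" for f q k
  proof -
    obtain p where "p \<in> A" "(q, p) \<in> r" "(e k, p) \<in> r"
      using upper_bound[of "{q, e k}"] famD(3)[OF fq] e_in by auto
    then show ?thesis using fq unfolding \<alpha>_def \<alpha>p_def by blast
  qed
  have "\<forall>V\<in>\<alpha>. \<exists>d. continuous_map X euclideanreal (fst d) \<and> V = cut (fst d) (snd d)"
  proof
    fix V assume "V \<in> \<alpha>"
    then obtain f k q where "V = cut f k" "(f, q) \<in> L" unfolding \<alpha>_def \<alpha>p_def by blast
    then show "\<exists>d. continuous_map X euclideanreal (fst d) \<and> V = cut (fst d) (snd d)"
      using famD(1) by (intro exI[of _ "(f, k)"]) simp
  qed
  from bchoice[OF this] obtain d where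
    d: "\<forall>V\<in>\<alpha>. continuous_map X euclideanreal (fst (d V)) \<and> V = cut (fst (d V)) (snd (d V))" ..
  \<comment> \<open>A set can be a superlevel set of several functions; its representation comes from a chosen one.\<close>
  define U where "U = (\<lambda>V. superlevel_rep X (fst (d V)) (c (snd (d V))))"
  have U: "U_representation X V (U V)" if "V \<in> \<alpha>" for V
  proof -
    have "V = {x \<in> topspace X. c (snd (d V)) < fst (d V) x}"
      using bspec[OF d that] by (simp add: cut_def)
    moreover have "U_representation X {x \<in> topspace X. c (snd (d V)) < fst (d V) x} (U V)"
      unfolding U_def by (rule U_representation_superlevel) (use d that in blast)
    ultimately show ?thesis by simp
  qed
  let ?\<S> = "\<alpha> \<union> {topspace X - U V (2 * n - 1) | V n. V \<in> \<alpha> \<and> n \<ge> 1}"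
  have op\<alpha>: "openin X V" if "V \<in> \<alpha>" for V
  proof -
    have "V = {x \<in> topspace X. c (snd (d V)) < fst (d V) x}"
      using bspec[OF d that] by (simp add: cut_def)
    moreover have "openin X {x \<in> topspace X. c (snd (d V)) < fst (d V) x}"
      by (rule openin_superlevel) (use d that in blast)
    ultimately show ?thesis by simp
  qed
  have sep: "\<exists>S T. S \<in> ?\<S> \<and> T \<in> ?\<S> \<and> x \<in> S \<and> y \<in> T \<and> S \<inter> T = {}"
    if f: "(f, q) \<in> L" "f x > 0" "\<not> f y > 0" and x: "x \<in> topspace X" and y: "y \<in> topspace X"
    for f q x y
  proof -
    obtain k where k: "0 < c k" "c k < f x" using dense[of 0 "f x"] f(2) by auto
    obtain l where l: "c k < c l" "c l < f x" using dense[OF c0 k(2)] by blast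
    let ?V = "cut f k"
    have V: "?V \<in> \<alpha>" by (rule cut_in[OF f(1)])
    note rep = U[OF V]
    have fc: "continuous_map X euclideanreal f" by (rule famD(1)[OF f(1)])
    have comp': "compactin X {z \<in> topspace X. f z \<in> {c l..}}"
      by (intro closedin_compact_space[OF comp] closedin_continuous_map_preimage[OF fc]) auto
    have cover: "{z \<in> topspace X. f z \<in> {c l..}} \<subseteq> (\<Union>n\<in>{1..}. U ?V (2 * n))"
    proof
      fix z assume "z \<in> {z \<in> topspace X. f z \<in> {c l..}}"
      then have "z \<in> ?V" using l(1) by (auto simp: cut_def)
      moreover have "?V = (\<Union>n\<in>{1..}. U ?V n)" using rep unfolding U_representation_def by (rule conjunct1)
      ultimately have "z \<in> (\<Union>n\<in>{1..}. U ?V n)" by (rule back_subst[of "\<lambda>S. z \<in> S"])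
      then obtain n where n: "n \<ge> 1" "z \<in> U ?V n" by (elim UN_E) simp
      have "U ?V n \<subseteq> U ?V (2 * n)" by (rule U_representation_props(2)[OF rep n(1)]) simp
      then show "z \<in> (\<Union>n\<in>{1..}. U ?V (2 * n))" using n by auto
    qed
    have "\<exists>F\<subseteq>{1..}. finite F \<and> {z \<in> topspace X. f z \<in> {c l..}} \<subseteq> (\<Union>n\<in>F. U ?V (2 * n))"
    proof (rule compactin_indexed_subcover[OF comp' _ cover])
      show "openin X (U ?V (2 * n))" if "n \<in> {1..}" for n
        using rep that unfolding U_representation_def by (auto intro: openin_cozero_set)
    qed
    then obtain F where F: "F \<subseteq> {1..}" "finite F"
      "{z \<in> topspace X. f z \<in> {c l..}} \<subseteq> (\<Union>n\<in>F. U ?V (2 * n))" by blast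
    obtain N where N: "\<And>n. n \<in> F \<Longrightarrow> n \<le> N"
      using F(2) by (auto simp: finite_nat_set_iff_bounded_le)
    have inU: "cut f l \<subseteq> U ?V (2 * Suc N - 1)"
    proof
      fix z assume "z \<in> cut f l"
      then have "z \<in> {z \<in> topspace X. f z \<in> {c l..}}" by (auto simp: cut_def)
      then obtain n where n: "n \<in> F" "z \<in> U ?V (2 * n)" using F(3) by blast
      have "1 \<le> 2 * n" using F(1) n(1) by auto
      moreover have "2 * n \<le> 2 * Suc N - 1" using N[OF n(1)] by simp
      ultimately have "U ?V (2 * n) \<subseteq> U ?V (2 * Suc N - 1)" by (rule U_representation_props(2)[OF rep])
      then show "z \<in> U ?V (2 * Suc N - 1)" using n(2) by blast
    qed
    have "y \<notin> ?V" using f(3) k(1) by (auto simp: cut_def)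
    moreover have "U ?V (2 * Suc N - 1) \<subseteq> ?V" by (rule U_representation_props(1)[OF rep]) simp
    ultimately have yT: "y \<in> topspace X - U ?V (2 * Suc N - 1)" using y by blast
    have "topspace X - U ?V (2 * Suc N - 1) \<in> {topspace X - U V (2 * n - 1) | V n. V \<in> \<alpha> \<and> n \<ge> 1}"
      using V by (intro CollectI exI[of _ ?V] exI[of _ "Suc N"]) simp
    then have "topspace X - U ?V (2 * Suc N - 1) \<in> ?\<S>" by (rule UnI2)
    moreover have "cut f l \<in> ?\<S>" by (rule UnI1[OF cut_in[OF f(1)]])
    moreover have "x \<in> cut f l" using x l(2) by (simp add: cut_def)
    moreover have "cut f l \<inter> (topspace X - U ?V (2 * Suc N - 1)) = {}" using inU by blast
    ultimately show ?thesis using yT by blast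
  qed
  have "subbase_of X ?\<S>"
  proof (rule subbase_of_compactI[OF comp])
    show "openin X S" if "S \<in> ?\<S>" for S
      using that
    proof
      assume "S \<in> {topspace X - U V (2 * n - 1) | V n. V \<in> \<alpha> \<and> n \<ge> 1}"
      then obtain V n where "S = topspace X - U V (2 * n - 1)" "V \<in> \<alpha>" "n \<ge> 1" by blast
      then show ?thesis using U_representation_props(3)[OF U] by auto
    qed (rule op\<alpha>)
    fix x y assume x: "x \<in> topspace X" and y: "y \<in> topspace X" and "x \<noteq> y"
    then have "distinguishes L x y" using dis by blast
    then obtain f q where f: "(f, q) \<in> L" "(f x > 0) \<noteq> (f y > 0)" unfolding distinguishes_def by blast
    show "\<exists>S T. S \<in> ?\<S> \<and> T \<in> ?\<S> \<and> x \<in> S \<and> y \<in> T \<and> S \<inter> T = {}"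
    proof (cases "f x > 0")
      case True
      then have "\<not> f y > 0" using f(2) by blast
      from sep[OF f(1) True this x y] show ?thesis .
    next
      case False
      then have "f y > 0" using f(2) by blast
      from sep[OF f(1) this False y x] obtain S T
        where "S \<in> ?\<S>" "T \<in> ?\<S>" "y \<in> S" "x \<in> T" "S \<inter> T = {}" by (elim exE conjE)
      then show ?thesis by (intro exI[of _ T] exI[of _ S]) (simp add: Int_commute)
    qed
  qed
  moreover have "\<alpha> \<subseteq> Pow (topspace X)" using op\<alpha> openin_subset by blast
  ultimately have "almost_subbase X \<alpha>"
    unfolding almost_subbase_def using U by (intro conjI exI[of _ U] ballI) simp_all
  moreover have "ordered_as A r \<alpha> \<alpha>p"
  proof (rule ordered_asI_level)
    show "\<alpha> \<subseteq> (\<Union>p\<in>A. \<alpha>p p)" by (simp add: \<alpha>_def)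
    show "\<alpha>p p \<subseteq> \<alpha>" if "p \<in> A" for p using that unfolding \<alpha>_def by blast
    show "\<alpha>p p \<subseteq> \<alpha>p p'" if "p \<in> A" "p' \<in> A" "(p, p') \<in> r" for p p'
      using le_trans[OF _ that(3)] unfolding \<alpha>p_def by blast
  qed
  moreover have "point_finite X (\<alpha>p p)" if p: "p \<in> A" for p
    unfolding point_finite_def
  proof
    fix x assume x: "x \<in> topspace X"
    let ?J = "{f. \<exists>q. (f, q) \<in> L \<and> (q, p) \<in> r \<and> f x > 0} \<times> {k. (e k, p) \<in> r}"
    have "at_point (\<alpha>p p) x \<subseteq> (\<lambda>(f, k). cut f k) ` ?J"
    proof
      fix V assume "V \<in> at_point (\<alpha>p p) x"
      then obtain f k q where V: "V = cut f k" "x \<in> cut f k" "(f, q) \<in> L" "(q, p) \<in> r" "(e k, p) \<in> r"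
        unfolding at_point_def \<alpha>p_def by blast
      have "f x > 0" using V(2) c0[of k] by (simp add: cut_def)
      then have "(f, k) \<in> ?J" using V by blast
      then show "V \<in> (\<lambda>(f, k). cut f k) ` ?J" by (rule rev_image_eqI) (simp add: V(1))
    qed
    moreover have "finite ?J" using famD(4)[OF p x] e_finite[OF p] by (rule finite_cartesian_product)
    ultimately show "finite (at_point (\<alpha>p p) x)" by (meson finite_imageI finite_subset)
  qed
  ultimately show ?thesis
    unfolding has_point_finite_almost_subbase_def ordered_prop_def
    by (intro exI[of _ \<alpha>] exI[of _ \<alpha>p] conjI ballI)
qed

lemma assignment_imp_almost_subbase:
  fixes X :: "'a topology"
  assumes "compact_space X" "Hausdorff_space X" "completely_regular_space X"
    and "\<exists>V \<pi>. noetherian_assignment X V \<pi>"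
  shows "has_point_finite_almost_subbase A r X"
proof -
  obtain V \<pi> where "noetherian_assignment X V \<pi>" using assms(4) by blast
  from assignment_imp_separating_family[OF assms(1-3) this]
  obtain I :: "(('a \<Rightarrow> real) \<times> nat \<times> 'a \<times> 'a) set" and h \<iota> where "separating_family X I h \<iota>"
    by blast
  then interpret separated_space A r e cell X I h \<iota>
    using assms(1) by unfold_locales
  obtain L where "cozero_family X L"
    "\<forall>x\<in>topspace X. \<forall>y\<in>topspace X. x \<noteq> y \<longrightarrow> distinguishes L x y"
    using distinguishing_family by blast
  then show ?thesis by (rule cozero_family_imp_almost_subbase[OF assms(1)])
qed

end

theorem theorem35:
  fixes X :: "'a topology"
    and T :: "'p topology"
    and r :: "'p rel"
  assumes "compact_space X" "Hausdorff_space X" "completely_regular_space X"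
    and "directed_set (topspace T) r"
    and "separable_space T" "metrizable_space T" "\<not> compact_space T"
    and "\<forall>p\<in>topspace T. compactin T (down_set (topspace T) r p)"
    and "convergent_seqs_bounded T r"
  shows "(has_point_finite_almost_subbase (topspace T) r X
            \<longleftrightarrow> has_point_additively_noetherian_base (topspace T) r X)
       \<and> (has_point_additively_noetherian_base (topspace T) r X
            \<longleftrightarrow> has_point_finite_expandable_network (topspace T) r X)
       \<and> (has_point_finite_expandable_network (topspace T) r X
            \<longleftrightarrow> has_finite_strong_point_network (topspace T) r X)
       \<and> (has_finite_strong_point_network (topspace T) r X
            \<longleftrightarrow> has_finite_point_network (topspace T) r X)"
proof -
  obtain e cell where "level_set (topspace T) r e cell"
    using level_set_exists[OF assms(4-9)] by blast
  then interpret level_set "topspace T" r e cell .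
  note close = assignment_imp_almost_subbase[OF assms(1-3)]
  have 12: "has_point_finite_almost_subbase (topspace T) r X \<Longrightarrow>
      has_point_additively_noetherian_base (topspace T) r X"
    by (rule almost_subbase_imp_noetherian_base[OF assms(1)])
  have 21: "has_point_additively_noetherian_base (topspace T) r X \<Longrightarrow>
      has_point_finite_almost_subbase (topspace T) r X"
    by (rule close[OF noetherian_base_imp_assignment])
  have 13: "has_point_finite_almost_subbase (topspace T) r X \<Longrightarrow>
      has_point_finite_expandable_network (topspace T) r X"
    by (rule almost_subbase_imp_expandable_network)
  have 34: "has_point_finite_expandable_network (topspace T) r X \<Longrightarrow>
      has_finite_strong_point_network (topspace T) r X"
    by (rule expandable_network_imp_strong_point_network)
  have 45: "has_finite_strong_point_network (topspace T) r X \<Longrightarrow>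
      has_finite_point_network (topspace T) r X"
    by (rule strong_point_network_imp_point_network)
  have 51: "has_finite_point_network (topspace T) r X \<Longrightarrow>
      has_point_finite_almost_subbase (topspace T) r X"
    by (rule close[OF point_network_imp_assignment])
  show ?thesis using 12 21 13 34 45 51 by argo
qed

end
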